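(* Let $F$ be a field of characteristic $2$ and let $\varphi,\psi$ be totally singular quadratic forms over $F$ such that the anisotropic part $\varphi_{\mathrm{an}}$ is minimal over $F$. If $\varphi$ and $\psi$ are Vishik equivalent, then they are similar.
   Context: A totally singular quadratic form over a field $F$ of characteristic $2$ is a map $\varphi:V\to F$ on a finite-dimensional $F$-vector space $V$ with $\varphi(av)=a^2\varphi(v)$ and $\varphi(v+w)=\varphi(v)+\varphi(w)$ for all $a\in F$, $v,w\in V$; $\dim\varphi=\dim V$. Write $\langle a_1,\dots,a_n\rangle$ for the form $(x_1,\dots,x_n)\mapsto\sum a_ix_i^2$ on $F^n$. Isometry $\varphi\simeq\psi$ means there is a bijective linear map $f$ with $\varphi(v)=\psi(f(v))$ for all $v$; $\varphi,\psi$ are similar if $\varphi\simeq c\psi$ for some $c\in F^*$. A form is isotropic if it vanishes at some nonzero vector, anisotropic otherwise. Every form decomposes as $\varphi\simeq\varphi_{\mathrm{an}}\perp k\times\langle0\rangle$ with $\varphi_{\mathrm{an}}$ anisotropic, unique up to isometry (the anisotropic part); $\mathfrak{i}_{\mathrm d}(\varphi):=k$ is the defect. For a field extension $E/F$, $\varphi_E$ is the form on $E\otimes_F V$ with $\varphi_E(e\otimes v)=e^2\varphi(v)$. Vishik equivalence of $\varphi,\psi$: $\dim\varphi=\dim\psi$ and $\mathfrak{i}_{\mathrm d}(\varphi_E)=\mathfrak{i}_{\mathrm d}(\psi_E)$ for every field extension $E/F$. Let $D_F^*(\varphi)=\{\varphi(v)\mid v\in V\}\setminus\{0\}$. The norm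 field is $N_F(\varphi)=F^2(a/b\mid a,b\in D_F^*(\varphi))$, and the norm degree is $\mathrm{ndeg}_F\varphi=[N_F(\varphi):F^2]$ (finite). An anisotropic form $\varphi$ is minimal over $F$ if $\mathrm{ndeg}_F\varphi=2^{\dim\varphi-1}$. *)

theory Defs
  imports "HOL-Algebra.Generated_Fields" "HOL-Algebra.Embedded_Algebras"
    "Jordan_Normal_Form.Missing_VectorSpace"
begin

section \<open>Totally singular quadratic forms\<close>

text \<open>
  A form is a vector space together with a map into the field of scalars. The record
  extends \<^typ>\<open>('a, 'v) module\<close>, so a form can be used wherever its underlying vector space
  is expected. (As for every module record in \<^theory>\<open>HOL-Algebra.Module\<close>, the multiplicative
  fields carry no meaning.)
\<close>

record ('a, 'v) qform = "('a, 'v) module" +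
  qf :: "'v \<Rightarrow> 'a"

definition form_on :: "('a, 'v) module \<Rightarrow> ('v \<Rightarrow> 'a) \<Rightarrow> ('a, 'v) qform" where
  "form_on V q = module.extend V (qform.fields q)"

lemma form_on_simps [simp]:
  "carrier (form_on V q) = carrier V"
  "\<zero>\<^bsub>form_on V q\<^esub> = \<zero>\<^bsub>V\<^esub>"
  "x \<oplus>\<^bsub>form_on V q\<^esub> y = x \<oplus>\<^bsub>V\<^esub> y"
  "a \<odot>\<^bsub>form_on V q\<^esub> x = a \<odot>\<^bsub>V\<^esub> x"
  "qf (form_on V q) = q"
  by (simp_all add: form_on_def module.defs qform.defs)

locale ts_form = vectorspace F \<phi>
  for F :: "('a, 'm) ring_scheme" and \<phi> :: "('a, 'v) qform" +
  assumes char_two: "\<one>\<^bsub>F\<^esub> \<oplus>\<^bsub>F\<^esub> \<one>\<^bsub>F\<^esub> = \<zero>\<^bsub>F\<^esub>"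
    and finite_dimensional: "fin_dim"
    and qf_closed: "v \<in> carrier \<phi> \<Longrightarrow> qf \<phi> v \<in> carrier F"
    and qf_smult: "\<lbrakk>a \<in> carrier F; v \<in> carrier \<phi>\<rbrakk>
      \<Longrightarrow> qf \<phi> (a \<odot>\<^bsub>\<phi>\<^esub> v) = a [^]\<^bsub>F\<^esub> (2::nat) \<otimes>\<^bsub>F\<^esub> qf \<phi> v"
    and qf_add: "\<lbrakk>v \<in> carrier \<phi>; w \<in> carrier \<phi>\<rbrakk>
      \<Longrightarrow> qf \<phi> (v \<oplus>\<^bsub>\<phi>\<^esub> w) = qf \<phi> v \<oplus>\<^bsub>F\<^esub> qf \<phi> w"

definition isometric ::
  "('a, 'm) ring_scheme \<Rightarrow> ('a, 'v) qform \<Rightarrow> ('a, 'w) qform \<Rightarrow> bool" where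
  "isometric F \<phi> \<psi> \<longleftrightarrow>
    (\<exists>f \<in> module_hom F \<phi> \<psi>. bij_betw f (carrier \<phi>) (carrier \<psi>) \<and>
      (\<forall>v \<in> carrier \<phi>. qf \<phi> v = qf \<psi> (f v)))"

definition scale_form ::
  "('a, 'm) ring_scheme \<Rightarrow> 'a \<Rightarrow> ('a, 'v) qform \<Rightarrow> ('a, 'v) qform" where
  "scale_form F c \<phi> = \<phi>\<lparr>qf := \<lambda>v. c \<otimes>\<^bsub>F\<^esub> qf \<phi> v\<rparr>"

definition similar_forms ::
  "('a, 'm) ring_scheme \<Rightarrow> ('a, 'v) qform \<Rightarrow> ('a, 'w) qform \<Rightarrow> bool" where
  "similar_forms F \<phi> \<psi> \<longleftrightarrow>
    (\<exists>c \<in> carrier F - {\<zero>\<^bsub>F\<^esub>}. isometric F \<phi> (scale_form F c \<psi>))"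

definition anisotropic :: "('a, 'm) ring_scheme \<Rightarrow> ('a, 'v) qform \<Rightarrow> bool" where
  "anisotropic F \<phi> \<longleftrightarrow> (\<forall>v \<in> carrier \<phi>. qf \<phi> v = \<zero>\<^bsub>F\<^esub> \<longrightarrow> v = \<zero>\<^bsub>\<phi>\<^esub>)"

definition orth_sum ::
  "('a, 'm) ring_scheme \<Rightarrow> ('a, 'v) qform \<Rightarrow> ('a, 'w) qform \<Rightarrow> ('a, 'v \<times> 'w) qform" where
  "orth_sum F \<phi> \<psi> =
    form_on (direct_sum \<phi> \<psi>) (\<lambda>(v, w). qf \<phi> v \<oplus>\<^bsub>F\<^esub> qf \<psi> w)"

text \<open>
  \<open>diag_form F n a\<close> is the form \<open>\<langle>a 0, \<dots>, a (n - 1)\<rangle>\<close> on the space of functions from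
  \<open>{..<n}\<close> to \<open>F\<close>.
\<close>

definition diag_form ::
  "('a, 'm) ring_scheme \<Rightarrow> nat \<Rightarrow> (nat \<Rightarrow> 'a) \<Rightarrow> ('a, nat \<Rightarrow> 'a) qform" where
  "diag_form F n a = form_on (ring.func_space F {..<n})
    (\<lambda>x. \<Oplus>\<^bsub>F\<^esub>i\<in>{..<n}. a i \<otimes>\<^bsub>F\<^esub> x i [^]\<^bsub>F\<^esub> (2::nat))"

abbreviation zero_form :: "('a, 'm) ring_scheme \<Rightarrow> nat \<Rightarrow> ('a, nat \<Rightarrow> 'a) qform" where
  "zero_form F k \<equiv> diag_form F k (\<lambda>_. \<zero>\<^bsub>F\<^esub>)"

definition anisotropic_decomp ::
  "('a, 'm) ring_scheme \<Rightarrow> ('a, 'v) qform \<Rightarrow> ('a, 'w) qform \<Rightarrow> nat \<Rightarrow> bool" where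
  "anisotropic_decomp F \<phi> \<chi> k \<longleftrightarrow>
    ts_form F \<chi> \<and> anisotropic F \<chi> \<and> isometric F \<phi> (orth_sum F \<chi> (zero_form F k))"

definition is_anisotropic_part ::
  "('a, 'm) ring_scheme \<Rightarrow> ('a, 'v) qform \<Rightarrow> ('a, 'w) qform \<Rightarrow> bool" where
  "is_anisotropic_part F \<phi> \<chi> \<longleftrightarrow> (\<exists>k. anisotropic_decomp F \<phi> \<chi> k)"

text \<open>
  The anisotropic part can always be taken on a subspace of the space of \<open>\<phi>\<close>, so for the defect
  it suffices to let \<open>\<chi>\<close> range over forms whose vectors have the same type as those of \<open>\<phi>\<close>.
\<close>

definition defect :: "('a, 'm) ring_scheme \<Rightarrow> ('a, 'v) qform \<Rightarrow> nat" where
  "defect F \<phi> = (THE k. \<exists>\<chi> :: ('a, 'v) qform. anisotropic_decomp F \<phi> \<chi> k)"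


section \<open>Norm field and minimal forms\<close>

definition nonzero_values :: "('a, 'm) ring_scheme \<Rightarrow> ('a, 'v) qform \<Rightarrow> 'a set" where
  "nonzero_values F \<phi> = qf \<phi> ` carrier \<phi> - {\<zero>\<^bsub>F\<^esub>}"

definition squares :: "('a, 'm) ring_scheme \<Rightarrow> 'a set" where
  "squares F = {x [^]\<^bsub>F\<^esub> (2::nat) | x. x \<in> carrier F}"

definition norm_field :: "('a, 'm) ring_scheme \<Rightarrow> ('a, 'v) qform \<Rightarrow> 'a set" where
  "norm_field F \<phi> = generate_field F
    (squares F \<union> {a \<otimes>\<^bsub>F\<^esub> inv\<^bsub>F\<^esub> b | a b. a \<in> nonzero_values F \<phi> \<and> b \<in> nonzero_values F \<phi>})"

definition norm_degree :: "('a, 'm) ring_scheme \<Rightarrow> ('a, 'v) qform \<Rightarrow> nat" where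
  "norm_degree F \<phi> = ring.dim F (squares F) (norm_field F \<phi>)"

text \<open>
  The conjunct on the dimension only excludes the zero-dimensional form, for which
  \<open>2 ^ (dim - 1)\<close> would otherwise be \<open>1\<close> because of truncated subtraction.
\<close>

definition minimal_form :: "('a, 'm) ring_scheme \<Rightarrow> ('a, 'v) qform \<Rightarrow> bool" where
  "minimal_form F \<phi> \<longleftrightarrow> anisotropic F \<phi> \<and> 1 \<le> vectorspace.dim F \<phi> \<and>
    norm_degree F \<phi> = 2 ^ (vectorspace.dim F \<phi> - 1)"


section \<open>Extension of scalars\<close>

definition free_module :: "('e, 'n) ring_scheme \<Rightarrow> 'v set \<Rightarrow> ('e, 'v \<Rightarrow> 'e) module" where
  "free_module E S =
    \<lparr>carrier = {f. (\<forall>v. f v \<in> carrier E) \<and> (\<forall>v. v \<notin> S \<longrightarrow> f v = \<zero>\<^bsub>E\<^esub>)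
        \<and> finite {v. f v \<noteq> \<zero>\<^bsub>E\<^esub>}},
     mult = (\<lambda>f g v. \<zero>\<^bsub>E\<^esub>),
     one = (\<lambda>v. \<zero>\<^bsub>E\<^esub>),
     zero = (\<lambda>v. \<zero>\<^bsub>E\<^esub>),
     add = (\<lambda>f g v. f v \<oplus>\<^bsub>E\<^esub> g v),
     smult = (\<lambda>c f v. c \<otimes>\<^bsub>E\<^esub> f v)\<rparr>"

definition single :: "('e, 'n) ring_scheme \<Rightarrow> 'e \<Rightarrow> 'v \<Rightarrow> 'v \<Rightarrow> 'e" where
  "single E e v = (\<lambda>w. if w = v then e else \<zero>\<^bsub>E\<^esub>)"

text \<open>
  For a homomorphism \<open>h\<close> from \<open>F\<close> to \<open>E\<close> and a vector space \<open>V\<close> over \<open>F\<close>, the space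
  \<open>E \<otimes>\<^sub>F V\<close> is the free \<open>E\<close>-module on the vectors of \<open>V\<close> modulo the relations
  \<open>1 \<otimes> (v + w) = 1 \<otimes> v + 1 \<otimes> w\<close> and \<open>1 \<otimes> a v = h a \<otimes> v\<close>; the class of
  \<open>single E e v\<close> is the tensor \<open>e \<otimes> v\<close>.
\<close>

definition tensor_relations ::
  "('a, 'm) ring_scheme \<Rightarrow> ('e, 'n) ring_scheme \<Rightarrow> ('a \<Rightarrow> 'e) \<Rightarrow> ('a, 'v, 'x) module_scheme
    \<Rightarrow> ('v \<Rightarrow> 'e) set" where
  "tensor_relations F E h V =
    (let M = free_module E (carrier V) in
      module.span E M
       ({single E \<one>\<^bsub>E\<^esub> (v \<oplus>\<^bsub>V\<^esub> w) \<ominus>\<^bsub>M\<^esub> (single E \<one>\<^bsub>E\<^esub> v \<oplus>\<^bsub>M\<^esub> single E \<one>\<^bsub>E\<^esub> w) | v w.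
           v \<in> carrier V \<and> w \<in> carrier V} \<union>
        {single E \<one>\<^bsub>E\<^esub> (a \<odot>\<^bsub>V\<^esub> v) \<ominus>\<^bsub>M\<^esub> single E (h a) v | a v.
           a \<in> carrier F \<and> v \<in> carrier V}))"

definition extend_scalars ::
  "('a, 'm) ring_scheme \<Rightarrow> ('e, 'n) ring_scheme \<Rightarrow> ('a \<Rightarrow> 'e) \<Rightarrow> ('a, 'v, 'x) module_scheme
    \<Rightarrow> ('e, ('v \<Rightarrow> 'e) set) module" where
  "extend_scalars F E h V =
    (let M = free_module E (carrier V); N = tensor_relations F E h V in
      \<lparr>carrier = a_rcosets\<^bsub>M\<^esub> N,
       mult = (\<lambda>X Y. N),
       one = N,
       zero = N,
       add = set_add M,
       smult = (\<lambda>c X. \<Union>f\<in>X. N +>\<^bsub>M\<^esub> (c \<odot>\<^bsub>M\<^esub> f))\<rparr>)"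

text \<open>
  The form on \<open>E \<otimes>\<^sub>F V\<close> sending \<open>\<Sum> e\<^sub>i \<otimes> v\<^sub>i\<close> to \<open>\<Sum> e\<^sub>i\<^sup>2 \<phi>(v\<^sub>i)\<close>, computed on any
  representative of the class.
\<close>

definition base_change ::
  "('a, 'm) ring_scheme \<Rightarrow> ('e, 'n) ring_scheme \<Rightarrow> ('a \<Rightarrow> 'e) \<Rightarrow> ('a, 'v) qform
    \<Rightarrow> ('e, ('v \<Rightarrow> 'e) set) qform" where
  "base_change F E h \<phi> = form_on (extend_scalars F E h \<phi>)
    (\<lambda>X. THE y. \<exists>f\<in>X. y =
      (\<Oplus>\<^bsub>E\<^esub>v\<in>{v. f v \<noteq> \<zero>\<^bsub>E\<^esub>}. f v [^]\<^bsub>E\<^esub> (2::nat) \<otimes>\<^bsub>E\<^esub> h (qf \<phi> v)))"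


section \<open>Vishik equivalence\<close>

text \<open>
  A field extension of \<open>F\<close> is a field \<open>E\<close> with a (necessarily injective) ring homomorphism from
  \<open>F\<close> to \<open>E\<close>. HOL cannot quantify over types inside a definition, so the elements of \<open>E\<close> are
  taken from \<^typ>\<open>'a list\<close>, where \<^typ>\<open>'a\<close> is the type of the elements of \<open>F\<close>. This is no
  restriction: \<^typ>\<open>'a list\<close> is infinite and at least as large as \<open>F\<close>, so every finitely
  generated extension of \<open>F\<close> has an isomorphic copy there, and the defect over an arbitrary
  extension \<open>K\<close> is already attained over a finitely generated subextension and does not change
  between the latter and \<open>K\<close> (finitely many coefficients suffice to express the values of a
  form on a basis as \<open>K\<^sup>2\<close>-linear combinations of a maximal \<open>K\<^sup>2\<close>-independent subset).
\<close>

definition vishik_equivalent ::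
  "('a, 'm) ring_scheme \<Rightarrow> ('a, 'v) qform \<Rightarrow> ('a, 'w) qform \<Rightarrow> bool" where
  "vishik_equivalent F \<phi> \<psi> \<longleftrightarrow>
    vectorspace.dim F \<phi> = vectorspace.dim F \<psi> \<and>
    (\<forall>(E :: 'a list ring) h. field E \<and> h \<in> ring_hom F E \<longrightarrow>
      defect E (base_change F E h \<phi>) = defect E (base_change F E h \<psi>))"

end

theory Submission
  imports Defs
begin

text \<open>
  Let \<open>U\<close> be the set of values of a totally singular form \<open>\<phi>\<close>. As \<open>\<phi>\<close> is additive and \<open>\<phi>(a v) = a\<^sup>2 \<phi>(v)\<close>,
  \<open>U\<close> is an \<open>F\<^sup>2\<close>-subspace of \<open>F\<close>, and \<open>U\<close> together with the dimension determines \<open>\<phi>\<close> up to isometry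
  (\<open>isometric_if_same_values\<close>). So for forms \<open>\<phi>, \<psi>\<close> of the same dimension with values \<open>U, W\<close>, similarity
  means \<open>W = c U\<close> for some \<open>c \<noteq> 0\<close>, and the theorem becomes a statement about subspaces of \<open>F\<close>.

  Vishik equivalence enters through the fields \<open>K\<close> with \<open>F\<^sup>2 \<subseteq> K \<subseteq> F\<close>. The embedding \<open>x \<mapsto> x\<^sup>2\<close> makes
  \<open>K\<close> an extension of \<open>F\<close>, over which \<open>\<phi>\<close> sends \<open>\<Sum> k\<^sub>i \<otimes> v\<^sub>i\<close> to \<open>(\<Sum> k\<^sub>i \<phi>(v\<^sub>i))\<^sup>2\<close>. Its defect there is
  therefore \<open>dim \<phi> - dim\<^sub>K (K U)\<close> (\<open>defect_over_copy_field\<close>), and Vishik equivalence implies that \<open>K U\<close>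
  and \<open>K W\<close> have the same dimension over \<open>K\<close>, for all these \<open>K\<close>.

  Minimality of the anisotropic part means that \<open>U\<close> has an \<open>F\<^sup>2\<close>-basis \<open>u, u a\<^sub>1, \<dots>, u a\<^sub>r\<close> where no
  \<open>a\<^sub>i\<close> lies in the field generated over \<open>F\<^sup>2\<close> by the others (\<open>minimal_form_values\<close>). The rest is
  projective geometry in \<open>W\<close>. Taking \<open>K = F\<^sup>2(a\<^sub>i)\<close> one finds a line through \<open>w\<^sub>i\<close> and \<open>a\<^sub>i w\<^sub>i\<close> in \<open>W\<close>
  (\<open>ratio_transfer\<close>). Taking \<open>K = F\<^sup>2(a\<^sub>i, a\<^sub>j)\<close> one sees that any two of these lines meet
  (\<open>lines_meet\<close>). Three of them are not coplanar, since their ratios \<open>a\<^sub>i, a\<^sub>j, a\<^sub>k\<close> would otherwise satisfy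
  \<open>a\<^sub>k \<in> F\<^sup>2(a\<^sub>i, a\<^sub>j)\<close>; so all of them pass through one point \<open>z\<close> (\<open>common_point\<close>). Then \<open>z, a\<^sub>1 z, \<dots>, a\<^sub>r z\<close> are in \<open>W\<close>, which is to say that
  \<open>(z/u) U \<subseteq> W\<close>, and equality holds because the dimensions agree (\<open>proportional\<close>).
\<close>

section \<open>Fields between \<open>F\<^sup>2\<close> and \<open>F\<close>\<close>

lemmas (in ring) subfield_props = subringE[OF subfieldE(1)]

locale field2 = field F for F (structure) +
  assumes char2: "\<one> \<oplus> \<one> = \<zero>"
begin

lemma add_self [simp]: "x \<in> carrier F \<Longrightarrow> x \<oplus> x = \<zero>"
  by (metis char2 l_distr l_null l_one one_closed)

lemma neg_eq [simp]: "x \<in> carrier F \<Longrightarrow> \<ominus> x = x"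
  using add_self minus_equality by blast

lemma add_eq_zero_iff: "x \<in> carrier F \<Longrightarrow> y \<in> carrier F \<Longrightarrow> x \<oplus> y = \<zero> \<longleftrightarrow> x = y"
  by (metis add_self minus_equality neg_eq)

lemma square_eq: "x \<in> carrier F \<Longrightarrow> x [^] (2::nat) = x \<otimes> x"
  by (simp add: numeral_2_eq_2)

lemma square_add:
  assumes "x \<in> carrier F" "y \<in> carrier F"
  shows "(x \<oplus> y) [^] (2::nat) = x [^] (2::nat) \<oplus> y [^] (2::nat)"
proof -
  have "(x \<oplus> y) \<otimes> (x \<oplus> y) = x \<otimes> x \<oplus> (x \<otimes> y \<oplus> x \<otimes> y) \<oplus> y \<otimes> y"
    using assms by (simp only: l_distr r_distr a_ac m_closed a_closed m_comm)
  with assms show ?thesis by (simp add: square_eq)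
qed

lemma square_mult:
  "x \<in> carrier F \<Longrightarrow> y \<in> carrier F \<Longrightarrow>
    (x \<otimes> y) [^] (2::nat) = x [^] (2::nat) \<otimes> y [^] (2::nat)"
  by (simp add: nat_pow_distrib)

lemma square_zero_iff [simp]: "x \<in> carrier F \<Longrightarrow> x [^] (2::nat) = \<zero> \<longleftrightarrow> x = \<zero>"
  using integral_iff by (auto simp: square_eq)

lemma squares_in_carrier: "squares F \<subseteq> carrier F"
  by (auto simp: squares_def)

lemma square_in_squares [simp]: "x \<in> carrier F \<Longrightarrow> x [^] (2::nat) \<in> squares F"
  by (auto simp: squares_def)

text \<open>Inverses come for free: \<open>1/x = x (1/x)\<^sup>2\<close>, and \<open>(1/x)\<^sup>2\<close> is a square.\<close>

lemma subring_over_squares_is_subfield: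
  assumes K: "subring K F" and sq: "\<And>x. x \<in> carrier F \<Longrightarrow> x [^] (2::nat) \<in> K"
  shows "subfield K F"
proof (rule subfieldI'[OF K])
  fix k assume "k \<in> K - {\<zero>}"
  then have k: "k \<in> carrier F" "k \<in> K" "k \<noteq> \<zero>" using subringE(1)[OF K] by auto
  then have i: "inv k \<in> carrier F" using field_Units by auto
  have "inv k = k \<otimes> (inv k) [^] (2::nat)"
    using k i field_Units by (simp add: square_eq m_assoc[symmetric])
  then show "inv k \<in> K" using subringE(6)[OF K] k(2) sq[OF i] by metis
qed

lemma subfield_squares: "subfield (squares F) F"
proof (rule subring_over_squares_is_subfield)
  show "subring (squares F) F"
  proof (rule subringI)
    show "squares F \<subseteq> carrier F" by (rule squares_in_carrier)
    show "\<one> \<in> squares F" using square_in_squares[of \<one>] by simp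
    fix h assume "h \<in> squares F"
    then show "\<ominus> h \<in> squares F" using squares_in_carrier by auto
  next
    fix h1 h2 assume "h1 \<in> squares F" "h2 \<in> squares F"
    then obtain x y where "x \<in> carrier F" "y \<in> carrier F"
        "h1 = x [^] (2::nat)" "h2 = y [^] (2::nat)"
      by (auto simp: squares_def)
    then show "h1 \<otimes> h2 \<in> squares F" "h1 \<oplus> h2 \<in> squares F"
      by (metis square_mult square_in_squares m_closed, metis square_add square_in_squares a_closed)
  qed
qed simp

text \<open>The comments below write \<open>F\<^sup>2(B)\<close> for \<open>adj B\<close>.\<close>

definition adj :: "'a set \<Rightarrow> 'a set" where
  "adj B = generate_field F (squares F \<union> B)"

lemma adj_subfield: "B \<subseteq> carrier F \<Longrightarrow> subfield (adj B) F"
  unfolding adj_def by (intro generate_field_is_subfield) (use squares_in_carrier in auto)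

lemma squares_subset_adj: "squares F \<subseteq> adj B"
  by (auto simp: adj_def intro: generate_field.incl)

lemma adj_incl: "b \<in> B \<Longrightarrow> b \<in> adj B"
  by (auto simp: adj_def intro: generate_field.incl)

lemma adj_least:
  assumes "subfield K F" "squares F \<subseteq> K" "B \<subseteq> K"
  shows "adj B \<subseteq> K"
  unfolding adj_def using assms subfieldE(3)[OF assms(1)]
  by (intro generate_field_min_subfield1) blast+

lemma adj_mono: "A \<subseteq> B \<Longrightarrow> B \<subseteq> carrier F \<Longrightarrow> adj A \<subseteq> adj B"
  by (rule adj_least) (auto simp: adj_subfield squares_subset_adj intro: adj_incl)

lemma adj_empty: "adj {} = squares F"
  by (intro equalityI adj_least subfield_squares squares_subset_adj) auto

text \<open>Adjoining one element \<open>b\<close> is at most a quadratic extension because \<open>b\<^sup>2\<close> is there already.\<close>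

lemma adj_insert:
  assumes B: "B \<subseteq> carrier F" and b: "b \<in> carrier F"
  shows "adj (insert b B) = {p \<oplus> q \<otimes> b | p q. p \<in> adj B \<and> q \<in> adj B}" (is "_ = ?Q")
proof
  let ?K = "adj B"
  have K: "subfield ?K F" by (rule adj_subfield[OF B])
  note Kr = subfield_props[OF K]
  have Kc: "x \<in> carrier F" if "x \<in> ?K" for x using Kr(1) that by auto
  have bb: "b \<otimes> b \<in> ?K"
    using squares_subset_adj[of B] square_in_squares[OF b] b by (auto simp: square_eq)
  have in_Q: "p \<in> ?Q" if "p \<in> ?K" for p
  proof -
    have "p = p \<oplus> \<zero> \<otimes> b" using Kc[OF that] b by simp
    with that Kr(2) show ?thesis by blast
  qed
  have "subring ?Q F"
  proof (rule subringI)
    show "?Q \<subseteq> carrier F" using Kc b by auto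
    show "\<one> \<in> ?Q" using in_Q Kr(3) by blast
    fix h assume "h \<in> ?Q"
    then have "h \<in> carrier F" using Kc b by auto
    with \<open>h \<in> ?Q\<close> show "\<ominus> h \<in> ?Q" by simp
  next
    fix h1 h2 assume "h1 \<in> ?Q" "h2 \<in> ?Q"
    then obtain p q p' q' where pq: "p \<in> ?K" "q \<in> ?K" "p' \<in> ?K" "q' \<in> ?K"
        and h: "h1 = p \<oplus> q \<otimes> b" "h2 = p' \<oplus> q' \<otimes> b" by auto
    note c = Kc[OF pq(1)] Kc[OF pq(2)] Kc[OF pq(3)] Kc[OF pq(4)] b
    have "h1 \<otimes> h2 = (p \<otimes> p' \<oplus> (q \<otimes> q') \<otimes> (b \<otimes> b)) \<oplus> (p \<otimes> q' \<oplus> q \<otimes> p') \<otimes> b"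
      unfolding h using c by (simp add: l_distr r_distr a_ac m_ac)
    moreover have "p \<otimes> p' \<oplus> (q \<otimes> q') \<otimes> (b \<otimes> b) \<in> ?K" "p \<otimes> q' \<oplus> q \<otimes> p' \<in> ?K"
      using pq bb Kr(6,7) by auto
    ultimately show "h1 \<otimes> h2 \<in> ?Q" by blast
    have "h1 \<oplus> h2 = (p \<oplus> p') \<oplus> (q \<oplus> q') \<otimes> b"
      unfolding h using c by (simp add: l_distr r_distr a_ac)
    then show "h1 \<oplus> h2 \<in> ?Q" using pq Kr(7) by blast
  qed
  then have sub: "subfield ?Q F"
    by (rule subring_over_squares_is_subfield)
      (use squares_subset_adj in_Q square_in_squares in blast)
  have "b = \<zero> \<oplus> \<one> \<otimes> b" using b by simp
  then have "b \<in> ?Q" using Kr(2,3) by blast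
  then show "adj (insert b B) \<subseteq> ?Q"
    using sub in_Q squares_subset_adj adj_incl by (intro adj_least) blast+
  have "?K \<subseteq> adj (insert b B)" by (rule adj_mono) (use B b in auto)
  moreover have "b \<in> adj (insert b B)" by (rule adj_incl) simp
  ultimately show "?Q \<subseteq> adj (insert b B)"
    using subringE(6,7)[OF subfieldE(1)[OF adj_subfield[of "insert b B"]]] B b by blast
qed

text \<open>Otherwise \<open>b\<close> could be solved for inside \<open>K\<close>.\<close>

lemma coefficient_zero_if_notin:
  assumes K: "subfield K F" and b: "b \<in> carrier F" "b \<notin> K"
    and pq: "p \<in> K" "q \<in> K" and eq: "p \<oplus> q \<otimes> b \<in> K"
  shows "q = \<zero>"
proof (rule ccontr)
  assume q0: "q \<noteq> \<zero>"
  note Kr = subfield_props[OF K]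
  have c: "p \<in> carrier F" "q \<in> carrier F" using Kr(1) pq by auto
  have "inv q \<in> K" using subfield_m_inv(1)[OF K] pq q0 by auto
  moreover have "q \<otimes> b \<in> K"
  proof -
    have "p \<oplus> (p \<oplus> q \<otimes> b) \<in> K" using Kr(7) pq eq by blast
    moreover have "p \<oplus> (p \<oplus> q \<otimes> b) = q \<otimes> b" using c b by (simp add: a_assoc[symmetric])
    ultimately show ?thesis by simp
  qed
  ultimately have "inv q \<otimes> (q \<otimes> b) \<in> K" using Kr(6) by blast
  moreover have "inv q \<otimes> (q \<otimes> b) = b"
    using c b q0 field_Units by (simp add: m_assoc[symmetric])
  ultimately show False using b by simp
qed

lemma adj_Int:
  assumes AB: "A \<subseteq> B" "B \<subseteq> carrier F" and c: "c \<in> carrier F" "c \<notin> adj B"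
  shows "adj (insert c A) \<inter> adj B = adj A"
proof
  have m: "adj A \<subseteq> adj B" by (rule adj_mono[OF AB])
  show "adj (insert c A) \<inter> adj B \<subseteq> adj A"
  proof
    fix x assume x: "x \<in> adj (insert c A) \<inter> adj B"
    then obtain p q where pq: "p \<in> adj A" "q \<in> adj A" "x = p \<oplus> q \<otimes> c"
      using adj_insert[of A c] AB c by auto
    have "q = \<zero>" using coefficient_zero_if_notin[OF adj_subfield[OF AB(2)] c, of p q] pq m x by auto
    moreover have "p \<in> carrier F" using pq adj_subfield[of A] AB subfieldE(3) by blast
    ultimately show "x \<in> adj A" using pq c by simp
  qed
  show "adj A \<subseteq> adj (insert c A) \<inter> adj B"
    using m adj_mono[of A "insert c A"] AB c by auto
qed

end

section \<open>Spans over intermediate fields and 2-independence\<close>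

declare (in ring) Span.simps [simp del]

context ring begin

lemma combine_in_closed:
  assumes "\<zero> \<in> X" "\<And>x y. x \<in> X \<Longrightarrow> y \<in> X \<Longrightarrow> x \<oplus> y \<in> X"
    "\<And>k x. k \<in> K \<Longrightarrow> x \<in> X \<Longrightarrow> k \<otimes> x \<in> X"
  shows "set Ks \<subseteq> K \<Longrightarrow> set Us \<subseteq> X \<Longrightarrow> combine Ks Us \<in> X"
  by (induction Ks Us rule: combine.induct) (use assms in auto)

lemma Span_in_closed:
  assumes K: "subfield K R" and Us: "set Us \<subseteq> carrier R" "set Us \<subseteq> X"
    and X: "\<zero> \<in> X" "\<And>x y. x \<in> X \<Longrightarrow> y \<in> X \<Longrightarrow> x \<oplus> y \<in> X"
      "\<And>k x. k \<in> K \<Longrightarrow> x \<in> X \<Longrightarrow> k \<otimes> x \<in> X"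
  shows "Span K Us \<subseteq> X"
proof
  fix x assume "x \<in> Span K Us"
  then obtain Ks where "set Ks \<subseteq> K" "x = combine Ks Us"
    using Span_eq_combine_set[OF K Us(1)] by auto
  then show "x \<in> X" using combine_in_closed[of X K, OF X] Us(2) by simp
qed

lemma Span_subset_subfield:
  assumes K: "subfield K R" and L: "subfield L R" and KL: "K \<subseteq> L" and Us: "set Us \<subseteq> L"
  shows "Span K Us \<subseteq> L"
proof -
  note Lr = subfield_props[OF L]
  show ?thesis
    by (rule Span_in_closed[OF K]) (use Lr KL Us in auto)
qed

lemma Span_mono_field:
  assumes K: "subfield K R" and L: "subfield L R" and KL: "K \<subseteq> L" and Us: "set Us \<subseteq> carrier R"
  shows "Span K Us \<subseteq> Span L Us"
proof -
  note Ls = Span_subgroup_props[OF L Us]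
  show ?thesis
    by (rule Span_in_closed[OF K Us Span_base_incl[OF L Us]])
      (use Ls KL Span_smult_closed[OF L Us] in auto)
qed

text \<open>Dropping every entry that depends on the later ones leaves a basis.\<close>

lemma dimension_Span_le:
  assumes K: "subfield K R"
  shows "set Us \<subseteq> carrier R \<Longrightarrow>
    \<exists>d \<le> length Us. dimension d K (Span K Us) \<and> (d = length Us \<longrightarrow> independent K Us)"
proof (induction Us)
  case Nil
  show ?case using zero_dim[of K] by (auto simp: Span.simps)
next
  case (Cons u Us)
  then obtain d where d: "d \<le> length Us" "dimension d K (Span K Us)"
      "d = length Us \<longrightarrow> independent K Us" by auto
  show ?case
  proof (cases "u \<in> Span K Us")
    case True
    then have "Span K (u # Us) = Span K Us"
      using Cons.prems Span_base_incl[OF K, of Us] mono_Span[OF K, of Us u]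
      by (intro equalityI mono_Span_subset[OF K]) auto
    with d show ?thesis by (intro exI[of _ d]) auto
  next
    case False
    have "dimension (Suc d) K (Span K (u # Us))"
      using Suc_dim[OF _ False d(2)] Cons.prems by (simp add: Span.simps)
    moreover have "Suc d = length (u # Us) \<longrightarrow> independent K (u # Us)"
      using d(3) li_Cons[OF _ False] Cons.prems by auto
    ultimately show ?thesis using d(1) by (intro exI[of _ "Suc d"]) simp
  qed
qed

lemma independent_if_dimension:
  assumes K: "subfield K R" and Us: "set Us \<subseteq> carrier R" and d: "dimension d K (Span K Us)"
    and "length Us \<le> d"
  shows "independent K Us"
  using dimension_Span_le[OF K Us] dimension_is_inj[OF K _ d] assms(4) by fastforce

end

context cring begin

lemma combine_map_mult:
  assumes u: "u \<in> carrier R"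
  shows "set Ks \<subseteq> carrier R \<Longrightarrow> set Us \<subseteq> carrier R \<Longrightarrow>
    combine Ks (map ((\<otimes>) u) Us) = u \<otimes> combine Ks Us"
  by (induction Ks Us rule: combine.induct) (use u in \<open>auto simp: r_distr m_lcomm\<close>)

lemma Span_map_mult:
  assumes K: "subfield K R" and u: "u \<in> carrier R" and Us: "set Us \<subseteq> carrier R"
  shows "Span K (map ((\<otimes>) u) Us) = (\<otimes>) u ` Span K Us"
proof -
  have Kc: "K \<subseteq> carrier R" using subfieldE(3)[OF K] .
  have uUs: "set (map ((\<otimes>) u) Us) \<subseteq> carrier R" using u Us by auto
  have "combine Ks (map ((\<otimes>) u) Us) = u \<otimes> combine Ks Us" if "set Ks \<subseteq> K" for Ks
    using combine_map_mult[OF u _ Us] that Kc by blast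
  note eq = this
  have "Span K (map ((\<otimes>) u) Us) = {u \<otimes> combine Ks Us | Ks. set Ks \<subseteq> K}"
    unfolding Span_eq_combine_set[OF K uUs] using eq by (intro Collect_cong) metis
  also have "\<dots> = (\<otimes>) u ` Span K Us"
    unfolding Span_eq_combine_set[OF K Us] by (auto simp only: image_Collect)
  finally show ?thesis .
qed

end

lemma (in domain) independent_map_mult:
  assumes K: "subfield K R" and u: "u \<in> carrier R" "u \<noteq> \<zero>" and ind: "independent K Us"
  shows "independent K (map ((\<otimes>) u) Us)"
proof (rule trivial_combine_imp_independent[OF K])
  have Us: "set Us \<subseteq> carrier R" by (rule independent_in_carrier[OF ind])
  then show "set (map ((\<otimes>) u) Us) \<subseteq> carrier R" using u by auto
  fix Ks assume Ks: "set Ks \<subseteq> K" "combine Ks (map ((\<otimes>) u) Us) = \<zero>"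
  then have "set Ks \<subseteq> carrier R" using subfieldE(3)[OF K] by auto
  then have "u \<otimes> combine Ks Us = \<zero>" using Ks Us combine_map_mult[OF u(1)] by simp
  then have "combine Ks Us = \<zero>"
    using u integral combine_in_carrier[OF \<open>set Ks \<subseteq> carrier R\<close> Us] by blast
  then show "set (take (length (map ((\<otimes>) u) Us)) Ks) \<subseteq> {\<zero>}"
    using independent_imp_trivial_combine[OF K ind Ks(1)] by simp
qed

context field2 begin

text \<open>A basis of \<open>F\<^sup>2(B)\<close> and its \<open>b\<close>-multiples together span \<open>F\<^sup>2(B)(b)\<close>.\<close>

lemma adj_dimension:
  assumes "finite B" "B \<subseteq> carrier F"
  shows "\<exists>d \<le> 2 ^ card B. dimension d (squares F) (adj B)"
proof -
  let ?S = "squares F"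
  note S = subfield_squares
  have "\<exists>L. set L \<subseteq> carrier F \<and> length L = 2 ^ card B \<and> adj B = Span ?S L"
    using assms
  proof (induction B rule: finite_induct)
    case empty
    have "Span ?S [\<one>] = ?S"
    proof
      show "Span ?S [\<one>] \<subseteq> ?S"
        using Span_subset_subfield[OF S S, of "[\<one>]"] subfield_props(3)[OF S] by simp
      show "?S \<subseteq> Span ?S [\<one>]"
        using Span_smult_closed[OF S, of "[\<one>]" _ \<one>] Span_base_incl[OF S, of "[\<one>]"]
          squares_in_carrier by force
    qed
    then show ?case by (intro exI[of _ "[\<one>]"]) (simp add: adj_empty)
  next
    case (insert b B)
    then obtain L where L: "set L \<subseteq> carrier F" "length L = 2 ^ card B" "adj B = Span ?S L"
      by auto
    have b: "b \<in> carrier F" and B: "B \<subseteq> carrier F" using insert.prems by auto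
    let ?L = "map ((\<otimes>) b) L"
    have L': "set ?L \<subseteq> carrier F" using L b by auto
    have "adj B \<subseteq> carrier F" using subfieldE(3)[OF adj_subfield[OF B]] .
    then have "q \<otimes> b = b \<otimes> q" if "q \<in> adj B" for q using b that m_comm by blast
    then have "adj (insert b B) = {p \<oplus> b \<otimes> q | p q. p \<in> adj B \<and> q \<in> adj B}"
      unfolding adj_insert[OF B b] by (intro Collect_cong ex_cong1) auto
    also have "\<dots> = adj B <+>\<^bsub>F\<^esub> (\<otimes>) b ` adj B"
      unfolding set_add_def' by auto
    also have "\<dots> = Span ?S (L @ ?L)"
      unfolding Span_append_eq_set_add[OF S L(1) L'] Span_map_mult[OF S b L(1)] L(3) ..
    finally have "adj (insert b B) = Span ?S (L @ ?L)" .
    then show ?case using L L' insert.hyps by (intro exI[of _ "L @ ?L"]) auto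
  qed
  then show ?thesis using dimension_Span_le[OF S] by metis
qed

text \<open>This is \<open>p\<close>-independence for \<open>p = 2\<close>, in the form that does not mention an enumeration of \<open>A\<close>.\<close>

definition two_independent :: "'a set \<Rightarrow> bool" where
  "two_independent A \<longleftrightarrow> A \<subseteq> carrier F \<and> (\<forall>a\<in>A. a \<notin> adj (A - {a}))"

lemma two_independent_notin:
  "two_independent A \<Longrightarrow> a \<in> A \<Longrightarrow> B \<subseteq> A - {a} \<Longrightarrow> a \<notin> adj B"
  using adj_mono[of B "A - {a}"] unfolding two_independent_def by blast

lemma two_independent_subset: "two_independent A \<Longrightarrow> B \<subseteq> A \<Longrightarrow> two_independent B"
  using two_independent_notin[of A _ "B - {_}"] unfolding two_independent_def by blast

text \<open>
  Adjoining \<open>m\<close> elements to \<open>F\<^sup>2\<close> gives degree at most \<open>2\<^sup>m\<close>, so the full degree leaves no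
  room for a repeated or superfluous element.
\<close>

lemma two_independent_if_dimension:
  assumes as: "set as \<subseteq> carrier F"
    and dim: "dimension (2 ^ length as) (squares F) (adj (set as))"
  shows "distinct as" "two_independent (set as)"
proof -
  have no: "\<not> (card B < length as \<and> adj B = adj (set as))" if BA: "B \<subseteq> set as" for B
  proof
    assume B: "card B < length as \<and> adj B = adj (set as)"
    obtain d where "d \<le> 2 ^ card B" "dimension d (squares F) (adj B)"
      using adj_dimension[of B] BA as finite_subset[OF BA] by auto
    then have "2 ^ length as \<le> (2::nat) ^ card B"
      using B dim dimension_is_inj[OF subfield_squares, of "2 ^ length as" "adj (set as)" d] by auto
    with B show False by (simp add: power_increasing_iff)
  qed
  show d: "distinct as"
    using no[of "set as"] card_length[of as] card_distinct[of as] by (auto simp: le_less)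
  show "two_independent (set as)"
    unfolding two_independent_def
  proof (intro conjI ballI as notI)
    fix a assume a: "a \<in> set as" "a \<in> adj (set as - {a})"
    let ?B = "set as - {a}"
    have "?B \<subseteq> carrier F" using as by auto
    then have "adj (set as) \<subseteq> adj ?B"
      using a adj_incl[of _ ?B] by (intro adj_least adj_subfield squares_subset_adj) blast+
    moreover have "adj ?B \<subseteq> adj (set as)" by (rule adj_mono) (use as in auto)
    moreover have "card ?B < length as"
      using a d by (metis card_Diff1_less distinct_card List.finite_set)
    ultimately show False using no[of ?B] by blast
  qed
qed

text \<open>
  Every entry of the list lies outside the field generated over \<open>F\<^sup>2(B)\<close> by the entries after it,
  and this field contains their span.
\<close>

lemma independent_over_adj:
  assumes "two_independent (B \<union> set cs)" "distinct cs" "set cs \<inter> B = {}"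
  shows "independent (adj B) (cs @ [\<one>])"
  using assms
proof (induction cs)
  case Nil
  have "\<one> \<notin> Span (adj B) []" by (simp add: Span.simps)
  then show ?case using li_Cons[OF one_closed] by auto
next
  case (Cons c cs)
  let ?C = "B \<union> set cs"
  have car: "?C \<subseteq> carrier F" "c \<in> carrier F" using Cons.prems unfolding two_independent_def by auto
  have "two_independent ?C"
    by (rule two_independent_subset[OF Cons.prems(1)]) auto
  then have IH: "independent (adj B) (cs @ [\<one>])" using Cons by auto
  have "Span (adj B) (cs @ [\<one>]) \<subseteq> adj ?C"
  proof (rule Span_subset_subfield)
    show "subfield (adj B) F" "subfield (adj ?C) F" using car by (auto intro: adj_subfield)
    show "adj B \<subseteq> adj ?C" using car by (intro adj_mono) auto
    show "set (cs @ [\<one>]) \<subseteq> adj ?C"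
      using adj_incl squares_subset_adj[of ?C] square_in_squares[OF one_closed] by auto
  qed
  moreover have "c \<notin> adj ?C"
    by (rule two_independent_notin[OF Cons.prems(1)]) (use Cons.prems in auto)
  ultimately show ?case using li_Cons[OF car(2) _ IH] by auto
qed

end

section \<open>Subspaces with equal ranks over all intermediate fields\<close>

context ring begin

lemma dimension_le_length:
  assumes K: "subfield K R" and dim: "dimension d K E" and Vs: "set Vs \<subseteq> carrier R"
    and sub: "E \<subseteq> Span K Vs"
  shows "d \<le> length Vs"
proof -
  obtain Us where Us: "independent K Us" "length Us = d" "Span K Us = E" "set Us \<subseteq> carrier R"
    using exists_base[OF K dim] by blast
  obtain d' where d': "d' \<le> length Vs" "dimension d' K (Span K Vs)"
    using dimension_Span_le[OF K Vs] by blast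
  have "set Us \<subseteq> Span K Vs" using Us sub Span_base_incl[OF K Us(4)] by blast
  then have "length Us \<le> d'" by (rule independent_length_le_dimension[OF K d'(2) Us(1)])
  with Us d' show ?thesis by simp
qed

end

lemma (in cring) combine_split:
  assumes c: "c \<in> carrier R"
    and PQ: "\<And>k. k \<in> set Ks \<Longrightarrow> P k \<in> carrier R \<and> Q k \<in> carrier R \<and> k = P k \<oplus> Q k \<otimes> c"
    and Us: "set Us \<subseteq> carrier R" and len: "length Ks = length Us"
  shows "combine Ks Us = combine (map P Ks) Us \<oplus> c \<otimes> combine (map Q Ks) Us"
  using len PQ Us
proof (induction Ks Us rule: list_induct2)
  case Nil
  then show ?case using c by simp
next
  case (Cons k Ks u Us)
  let ?p = "P k" and ?q = "Q k"
  have k: "k = ?p \<oplus> ?q \<otimes> c" and pq: "?p \<in> carrier R" "?q \<in> carrier R" "u \<in> carrier R"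
    using Cons.prems by auto
  have car: "set (map P Ks) \<subseteq> carrier R" "set (map Q Ks) \<subseteq> carrier R" "set Us \<subseteq> carrier R"
    using Cons.prems by auto
  let ?x = "combine (map P Ks) Us" and ?y = "combine (map Q Ks) Us"
  have xy: "?x \<in> carrier R" "?y \<in> carrier R" using car combine_in_carrier by blast+
  have "combine (k # Ks) (u # Us) = (?p \<oplus> ?q \<otimes> c) \<otimes> u \<oplus> (?x \<oplus> c \<otimes> ?y)"
    using Cons k by simp
  also have "\<dots> = (?p \<otimes> u \<oplus> ?x) \<oplus> c \<otimes> (?q \<otimes> u \<oplus> ?y)"
    using xy pq c by (simp add: l_distr r_distr a_ac m_ac)
  finally show ?case by simp
qed

text \<open>
  The linear-algebra form of the problem: \<open>U\<close> is the span over \<open>F\<^sup>2\<close> of \<open>u a\<close> for \<open>a\<close> in \<open>as\<close> and of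
  \<open>u\<close>, and \<open>W\<close> has the same rank as \<open>U\<close> over every field between \<open>F\<^sup>2\<close> and \<open>F\<close>. Here \<open>U\<close> and \<open>W\<close> are
  the sets of values of the anisotropic minimal form and of the form that is compared with it.
\<close>

locale same_ranks = field2 +
  fixes as ws :: "'a list" and u
  assumes distinct_as: "distinct as" and two_indep: "two_independent (set as)"
    and u: "u \<in> carrier F" "u \<noteq> \<zero>"
    and ws_indep: "independent (squares F) ws"
    and ranks: "\<And>K d. subfield K F \<Longrightarrow> squares F \<subseteq> K
      \<Longrightarrow> dimension d K (Span K (map ((\<otimes>) u) (as @ [\<one>]))) \<Longrightarrow> dimension d K (Span K ws)"
begin

abbreviation "us \<equiv> map ((\<otimes>) u) (as @ [\<one>])"
abbreviation "U \<equiv> Span (squares F) us"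
abbreviation "W \<equiv> Span (squares F) ws"

lemma as: "set as \<subseteq> carrier F"
  using two_indep by (auto simp: two_independent_def)

lemma us: "set us \<subseteq> carrier F"
  using as u by auto

lemma ws: "set ws \<subseteq> carrier F"
  by (rule independent_in_carrier[OF ws_indep])

lemma us_indep: "independent (squares F) us"
  by (rule independent_map_mult[OF subfield_squares u])
    (use independent_over_adj[of "{}" as] two_indep distinct_as in \<open>simp add: adj_empty\<close>)

lemma dim_U: "dimension (Suc (length as)) (squares F) U"
  using dimension_independent[OF us_indep] by simp

lemma dim_W: "dimension (Suc (length as)) (squares F) W"
  using ranks[OF subfield_squares order_refl dim_U] .

lemma length_ws: "length ws = Suc (length as)"
  using dimension_is_inj[OF subfield_squares dimension_independent[OF ws_indep] dim_W] .

lemmas U_props = Span_subgroup_props[OF subfield_squares us]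
lemmas W_props = Span_subgroup_props[OF subfield_squares ws]
lemmas W_smult = Span_smult_closed[OF subfield_squares ws]

lemma u_in_U: "u \<in> U" and u_as_in_U: "a \<in> set as \<Longrightarrow> u \<otimes> a \<in> U"
proof -
  have "set us \<subseteq> U" by (rule Span_base_incl[OF subfield_squares us])
  then show "u \<in> U" and "a \<in> set as \<Longrightarrow> u \<otimes> a \<in> U" using u by auto
qed

text \<open>
  The pair \<open>v, c v\<close> is linearly dependent over \<open>F\<^sup>2(c)\<close>, so passing to \<open>F\<^sup>2(c)\<close> lowers the rank of \<open>U\<close>
  and therefore that of \<open>W\<close>. A dependence between basis vectors of \<open>W\<close> over \<open>F\<^sup>2(c)\<close>, sorted by the
  powers \<open>1, c\<close>, reads \<open>x + c w = 0\<close> with \<open>x\<close> and \<open>w\<close> in \<open>W\<close>.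
\<close>

lemma ratio_transfer:
  assumes c: "c \<in> carrier F" "c \<notin> squares F"
    and v: "v \<in> U" "v \<noteq> \<zero>" "c \<otimes> v \<in> U"
  shows "\<exists>w\<in>W. w \<noteq> \<zero> \<and> c \<otimes> w \<in> W"
proof -
  let ?S = "squares F" and ?K = "adj {c}"
  note S = subfield_squares
  have K: "subfield ?K F" using adj_subfield c by blast
  have SK: "?S \<subseteq> ?K" by (rule squares_subset_adj)
  have cK: "c \<in> ?K" by (rule adj_incl) simp
  have vc: "v \<in> carrier F" using v U_props by blast
  have "c \<otimes> v \<notin> Span ?S [v]"
  proof
    assume "c \<otimes> v \<in> Span ?S [v]"
    then obtain k where k: "k \<in> ?S" "c \<otimes> v = k \<otimes> v"
      using Span_mem_iff_length_version[OF S, of "[v]" "c \<otimes> v"] vc squares_in_carrier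
      by (auto simp: length_Suc_conv)
    moreover have "k \<in> carrier F" using k squares_in_carrier by auto
    ultimately have "c = k" using m_rcancel c vc v by auto
    with k c show False by simp
  qed
  moreover have "independent ?S [v]"
    using li_Cons[of v ?S "[]"] vc v by (simp add: Span.simps)
  ultimately have "independent ?S [c \<otimes> v, v]" using li_Cons[of "c \<otimes> v" ?S "[v]"] c vc by simp
  then obtain vs where vs: "length (vs @ [c \<otimes> v, v]) = Suc (length as)"
      "independent ?S (vs @ [c \<otimes> v, v])" "Span ?S (vs @ [c \<otimes> v, v]) = U"
    using complete_base[OF S dim_U, of "[c \<otimes> v, v]"] v by auto
  have vsc: "set (vs @ [c \<otimes> v, v]) \<subseteq> carrier F" "set (vs @ [v]) \<subseteq> carrier F"
    using independent_in_carrier[OF vs(2)] by auto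
  note V = Span_base_incl[OF K vsc(2)]
  have "U \<subseteq> Span ?K (vs @ [c \<otimes> v, v])"
    using Span_mono_field[OF S K SK vsc(1)] vs(3) by simp
  also have "\<dots> \<subseteq> Span ?K (vs @ [v])"
    by (rule mono_Span_subset[OF K _ vsc(2)]) (use V Span_smult_closed[OF K vsc(2) cK] in auto)
  finally have "Span ?K us \<subseteq> Span ?K (vs @ [v])"
    using Span_base_incl[OF S us] vsc(2) by (intro mono_Span_subset[OF K]) auto
  moreover obtain d where d: "dimension d ?K (Span ?K us)"
    using dimension_Span_le[OF K us] by blast
  ultimately have "d \<le> length (vs @ [v])" using dimension_le_length[OF K _ vsc(2)] by blast
  then have "d < length ws" using vs(1) length_ws by simp
  then have "dependent ?K ws"
    using dimension_is_inj[OF K ranks[OF K SK d]] dimension_independent by fastforce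
  then obtain Ks where Ks: "length Ks = length ws" "combine Ks ws = \<zero>" "set Ks \<subseteq> ?K"
      "set Ks \<noteq> {\<zero>}"
    by (rule dependent_imp_non_trivial_combine[OF K ws])
  have "\<forall>k\<in>set Ks. \<exists>p q. p \<in> ?S \<and> q \<in> ?S \<and> k = p \<oplus> q \<otimes> c"
    using Ks(3) adj_insert[of "{}" c] c(1) unfolding adj_empty by blast
  then obtain P Q where PQ: "\<And>k. k \<in> set Ks \<Longrightarrow> P k \<in> ?S \<and> Q k \<in> ?S \<and> k = P k \<oplus> Q k \<otimes> c"
    by metis
  let ?x = "combine (map P Ks) ws" and ?w = "combine (map Q Ks) ws"
  have sets: "set (map P Ks) \<subseteq> ?S" "set (map Q Ks) \<subseteq> ?S" using PQ by auto
  then have W: "?x \<in> W" "?w \<in> W"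
    unfolding Span_eq_combine_set[OF S ws] by blast+
  then have car: "?x \<in> carrier F" "?w \<in> carrier F" using W_props by blast+
  have "?x \<oplus> c \<otimes> ?w = \<zero>"
  proof -
    have "\<And>k. k \<in> set Ks \<Longrightarrow> P k \<in> carrier F \<and> Q k \<in> carrier F \<and> k = P k \<oplus> Q k \<otimes> c"
      using PQ squares_in_carrier by blast
    then show ?thesis using combine_split[OF c(1) _ ws Ks(1), of P Q] Ks(2) by metis
  qed
  then have eq: "?x = c \<otimes> ?w" using add_eq_zero_iff car c by simp
  have "?w \<noteq> \<zero>"
  proof
    assume w0: "?w = \<zero>"
    then have "?x = \<zero>" using eq c by simp
    then have "set (map P Ks) \<subseteq> {\<zero>}" "set (map Q Ks) \<subseteq> {\<zero>}"
      using independent_imp_trivial_combine[OF S ws_indep sets(1)]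
        independent_imp_trivial_combine[OF S ws_indep sets(2) w0] Ks(1) by auto
    then have "set Ks \<subseteq> {\<zero>}" using PQ c by force
    moreover have "Ks \<noteq> []" using Ks(1) length_ws by auto
    ultimately show False using Ks(4) by (metis set_empty subset_singletonD)
  qed
  with W eq show ?thesis by metis
qed

text \<open>
  Suppose that the lines through \<open>w, a w\<close> and through \<open>x, b x\<close> in the projective space of \<open>W\<close> were
  disjoint. Then \<open>w, a w, x, b x\<close> is part of a basis of \<open>W\<close>. Over \<open>F\<^sup>2(a, b)\<close> this basis loses \<open>a w\<close> and
  \<open>b x\<close>, and what remains is independent because the rank of \<open>U\<close> drops by two only. But the ratio
  \<open>a/b\<close> of two vectors of \<open>U\<close> also occurs in \<open>W\<close>, and this is one dependence too many.
\<close>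

lemma lines_meet:
  assumes a: "a \<in> set as" and b: "b \<in> set as" and ab: "a \<noteq> b"
    and w: "w \<in> W" "w \<noteq> \<zero>" "a \<otimes> w \<in> W" and x: "x \<in> W" "x \<noteq> \<zero>" "b \<otimes> x \<in> W"
  shows "\<exists>\<alpha>\<in>adj {a}. \<exists>\<beta>\<in>adj {b}. \<alpha> \<noteq> \<zero> \<and> \<alpha> \<otimes> w = \<beta> \<otimes> x"
proof -
  let ?S = "squares F" and ?K = "adj {a, b}"
  note S = subfield_squares
  have ac: "a \<in> carrier F" "b \<in> carrier F" using a b as by auto
  have wc: "w \<in> carrier F" "x \<in> carrier F" using w x W_props by blast+
  have Sa: "subfield (adj {a}) F" and Sb: "subfield (adj {b}) F" and K: "subfield ?K F"
    using ac by (auto intro: adj_subfield)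
  have a_S: "a \<notin> ?S" "b \<notin> ?S" and a_b: "a \<notin> adj {b}" "b \<notin> adj {a}"
    using two_independent_notin[OF two_indep, of _ "{}"]
      two_independent_notin[OF two_indep a, of "{b}"]
      two_independent_notin[OF two_indep b, of "{a}"] a b ab by (auto simp: adj_empty)
  have adjI: "p \<oplus> q \<otimes> c \<in> adj {c}" if "p \<in> ?S" "q \<in> ?S" "c \<in> carrier F" for p q c
    using adj_insert[of "{}" c] that adj_empty by auto
  have triv: "p = \<zero> \<and> q = \<zero>"
    if "p \<in> ?S" "q \<in> ?S" "c \<in> carrier F" "c \<notin> ?S" "p \<oplus> q \<otimes> c = \<zero>" for p q c
  proof -
    have "q = \<zero>"
      using coefficient_zero_if_notin[OF S that(3,4,1,2)] that(5) subfield_props(2)[OF S] by simp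
    with that squares_in_carrier show ?thesis by auto
  qed
  have list4: "set [w, a \<otimes> w, x, b \<otimes> x] \<subseteq> carrier F" using ac wc by auto
  show ?thesis
  proof (cases "independent ?S [w, a \<otimes> w, x, b \<otimes> x]")
    case False
    then obtain Ks where Ks: "length Ks = length [w, a \<otimes> w, x, b \<otimes> x]"
        "combine Ks [w, a \<otimes> w, x, b \<otimes> x] = \<zero>" "set Ks \<subseteq> ?S" "set Ks \<noteq> {\<zero>}"
      by (rule dependent_imp_non_trivial_combine[OF S list4])
    then obtain p1 p2 p3 p4 where Ks_eq: "Ks = [p1, p2, p3, p4]"
      by (auto simp: length_Suc_conv numeral_eq_Suc)
    have p: "p1 \<in> ?S" "p2 \<in> ?S" "p3 \<in> ?S" "p4 \<in> ?S" using Ks Ks_eq by auto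
    then have pc: "p1 \<in> carrier F" "p2 \<in> carrier F" "p3 \<in> carrier F" "p4 \<in> carrier F"
      using squares_in_carrier by auto
    let ?\<alpha> = "p1 \<oplus> p2 \<otimes> a" and ?\<beta> = "p3 \<oplus> p4 \<otimes> b"
    have "?\<alpha> \<otimes> w \<oplus> ?\<beta> \<otimes> x = combine Ks [w, a \<otimes> w, x, b \<otimes> x]"
      unfolding Ks_eq using pc ac wc by (simp add: l_distr r_distr a_ac m_ac)
    then have eq: "?\<alpha> \<otimes> w = ?\<beta> \<otimes> x"
      using Ks(2) pc ac wc by (simp add: add_eq_zero_iff)
    have "?\<alpha> \<noteq> \<zero>"
    proof
      assume 0: "?\<alpha> = \<zero>"
      then have "?\<beta> \<otimes> x = \<zero>" using eq wc by simp
      then have "?\<beta> = \<zero>" using integral_iff pc ac wc x by auto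
      with 0 p ac a_S triv have "p1 = \<zero>" "p2 = \<zero>" "p3 = \<zero>" "p4 = \<zero>" by blast+
      with Ks(4) Ks_eq show False by simp
    qed
    with eq p adjI ac show ?thesis by blast
  next
    case True
    obtain vs where vs: "length (vs @ [w, a \<otimes> w, x, b \<otimes> x]) = Suc (length as)"
        "Span ?S (vs @ [w, a \<otimes> w, x, b \<otimes> x]) = W"
        "independent ?S (vs @ [w, a \<otimes> w, x, b \<otimes> x])"
      using complete_base[OF S dim_W True] w x by auto
    let ?B4 = "vs @ [w, a \<otimes> w, x, b \<otimes> x]" and ?B = "vs @ [w, x]"
    have B4: "set ?B4 \<subseteq> carrier F" and B: "set ?B \<subseteq> carrier F"
      using independent_in_carrier[OF vs(3)] by auto
    have SK: "?S \<subseteq> ?K" by (rule squares_subset_adj)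
    have abK: "a \<in> ?K" "b \<in> ?K" by (auto intro: adj_incl)
    have aK: "adj {a} \<subseteq> ?K" "adj {b} \<subseteq> ?K" using ac by (simp_all add: adj_mono)
    note BK = Span_base_incl[OF K B] and BKs = Span_smult_closed[OF K B]
    have "W \<subseteq> Span ?K ?B"
    proof -
      have "W \<subseteq> Span ?K ?B4" using Span_mono_field[OF S K SK B4] vs(2) by simp
      also have "\<dots> \<subseteq> Span ?K ?B"
        by (rule mono_Span_subset[OF K _ B]) (use BK BKs[OF abK(1)] BKs[OF abK(2)] in auto)
      finally show ?thesis .
    qed
    then have "Span ?K ws \<subseteq> Span ?K ?B"
      using Span_base_incl[OF S ws] by (intro mono_Span_subset[OF K _ B]) blast
    moreover have "Span ?K ?B \<subseteq> Span ?K ws"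
    proof (rule mono_Span_subset[OF K _ ws])
      have "set ?B4 \<subseteq> W" using Span_base_incl[OF S B4] vs(2) by simp
      then show "set ?B \<subseteq> Span ?K ws" using Span_mono_field[OF S K SK ws] by auto
    qed
    ultimately have Beq: "Span ?K ?B = Span ?K ws" by blast
    \<comment> \<open>\<open>U\<close> loses only two dimensions over \<open>F\<^sup>2(a, b)\<close>, hence so does \<open>W\<close>.\<close>
    define cs where "cs = filter (\<lambda>c. c \<noteq> a \<and> c \<noteq> b) as"
    have "set cs = set as - {a, b}" "distinct cs" using distinct_as by (auto simp: cs_def)
    moreover from this have "length cs = length as - 2"
      using distinct_card[of cs] distinct_card[OF distinct_as] a b ab
        card_Diff_subset[of "{a, b}" "set as"] by simp
    moreover have "{a, b} \<union> set cs = set as" using calculation a b by auto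
    ultimately have cs: "independent ?K (cs @ [\<one>])" "length cs = length as - 2"
        "set cs \<subseteq> set as"
      using independent_over_adj[of "{a, b}" cs] two_indep by auto
    obtain d where d: "dimension d ?K (Span ?K us)"
      using dimension_Span_le[OF K us] by blast
    have "length (map ((\<otimes>) u) (cs @ [\<one>])) \<le> d"
      by (rule independent_length_le_dimension[OF K d independent_map_mult[OF K u cs(1)]])
        (use Span_base_incl[OF K us] cs(3) in auto)
    then have "length ?B \<le> d" using vs(1) cs(2) by simp
    then have Bind: "independent ?K ?B"
      using independent_if_dimension[OF K B] ranks[OF K SK d] Beq by simp
    \<comment> \<open>coordinates over \<open>F\<^sup>2\<close> of an element of \<open>W\<close>, regrouped over \<open>F\<^sup>2(a, b)\<close>\<close>
    have coords: "\<exists>Ps \<alpha> \<beta>. set Ps \<subseteq> ?S \<and> length Ps = length vs \<and> \<alpha> \<in> adj {a} \<and> \<beta> \<in> adj {b}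
        \<and> y = combine (Ps @ [\<alpha>, \<beta>]) ?B" if "y \<in> W" for y
    proof -
      obtain Ks where Ks: "set Ks \<subseteq> ?S" "length Ks = length ?B4" "y = combine Ks ?B4"
        using Span_mem_iff_length_version[OF S B4, of y] \<open>y \<in> W\<close> vs(2) by auto
      define Ps where "Ps = take (length vs) Ks"
      have "length (drop (length vs) Ks) = Suc (Suc (Suc (Suc 0)))" using Ks(2) by simp
      then obtain p1 p2 p3 p4 where "drop (length vs) Ks = [p1, p2, p3, p4]"
        unfolding length_Suc_conv by auto
      then have Ks_eq: "Ks = Ps @ [p1, p2, p3, p4]" unfolding Ps_def by (metis append_take_drop_id)
      have lenP: "length Ps = length vs" using Ks(2) by (simp add: Ps_def)
      have p: "p1 \<in> ?S" "p2 \<in> ?S" "p3 \<in> ?S" "p4 \<in> ?S" and Ps: "set Ps \<subseteq> ?S"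
        using Ks Ks_eq by auto
      then have pc: "p1 \<in> carrier F" "p2 \<in> carrier F" "p3 \<in> carrier F" "p4 \<in> carrier F"
          "set Ps \<subseteq> carrier F" and vsc: "set vs \<subseteq> carrier F"
        using squares_in_carrier B by auto
      let ?\<alpha> = "p1 \<oplus> p2 \<otimes> a" and ?\<beta> = "p3 \<oplus> p4 \<otimes> b"
      have "y = combine Ps vs \<oplus> combine [p1, p2, p3, p4] [w, a \<otimes> w, x, b \<otimes> x]"
        unfolding Ks(3) Ks_eq using lenP pc vsc list4 by (intro combine_append[symmetric]) auto
      also have "combine [p1, p2, p3, p4] [w, a \<otimes> w, x, b \<otimes> x] = combine [?\<alpha>, ?\<beta>] [w, x]"
        using pc ac wc by (simp add: l_distr r_distr a_ac m_ac)
      also have "combine Ps vs \<oplus> \<dots> = combine (Ps @ [?\<alpha>, ?\<beta>]) ?B"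
        using lenP pc vsc ac wc by (intro combine_append) auto
      finally show ?thesis using p Ps lenP adjI ac by blast
    qed
    \<comment> \<open>The line through \<open>u a\<close> and \<open>u b\<close> in \<open>U\<close> supplies \<open>y \<noteq> 0\<close> with \<open>y\<close> and \<open>(a/b) y\<close> in \<open>W\<close>.\<close>
    have invb: "inv b \<in> carrier F" "b \<otimes> inv b = \<one>" "b \<noteq> \<zero>"
    proof -
      show "b \<noteq> \<zero>" using a_S subfield_props(2)[OF S] by auto
      then show "inv b \<in> carrier F" "b \<otimes> inv b = \<one>" using ac field_Units by auto
    qed
    let ?c = "a \<otimes> inv b"
    have cb: "?c \<otimes> b = a" "b \<otimes> ?c = a"
      using ac invb by (simp_all add: m_ac)
    have "?c \<notin> ?S"
    proof
      assume "?c \<in> ?S"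
      then have "?c \<otimes> b \<in> adj {b}"
        using squares_subset_adj[of "{b}"] adj_incl[of b "{b}"] subfield_props(6)[OF Sb]
        by blast
      with cb a_b show False by simp
    qed
    moreover have "?c \<otimes> (u \<otimes> b) = u \<otimes> a"
      using cb ac invb u by (metis m_lcomm m_closed)
    moreover have "u \<otimes> b \<noteq> \<zero>" using integral_iff u ac invb by auto
    ultimately obtain y where y: "y \<in> W" "y \<noteq> \<zero>" "?c \<otimes> y \<in> W"
      using ratio_transfer[of ?c "u \<otimes> b"] u_as_in_U a b ac invb by auto
    have yc: "y \<in> carrier F" using y W_props by blast
    obtain Ps \<alpha> \<beta> where P: "set Ps \<subseteq> ?S" "length Ps = length vs" "\<alpha> \<in> adj {a}" "\<beta> \<in> adj {b}"
        "y = combine (Ps @ [\<alpha>, \<beta>]) ?B" using coords[OF y(1)] by blast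
    obtain Qs \<alpha>' \<beta>' where Q: "set Qs \<subseteq> ?S" "length Qs = length vs" "\<alpha>' \<in> adj {a}" "\<beta>' \<in> adj {b}"
        "?c \<otimes> y = combine (Qs @ [\<alpha>', \<beta>']) ?B" using coords[OF y(3)] by blast
    let ?P = "Ps @ [\<alpha>, \<beta>]" and ?Q = "Qs @ [\<alpha>', \<beta>']"
    have PK: "set ?P \<subseteq> ?K" "set ?Q \<subseteq> ?K" using P Q SK aK by auto
    have Kc: "?K \<subseteq> carrier F" using subfieldE(3)[OF K] .
    have scale: "combine (map ((\<otimes>) k) Ks) Vs = k \<otimes> combine Ks Vs"
      if "k \<in> carrier F" "set Ks \<subseteq> carrier F" "set Vs \<subseteq> carrier F" for k Ks Vs
      using that(2,3)
      by (induction Ks Vs rule: combine.induct) (use that(1) in \<open>auto simp: r_distr m_assoc\<close>)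
    have "b \<otimes> (?c \<otimes> y) = a \<otimes> y" using cb ac yc invb by (simp add: m_assoc[symmetric])
    moreover have "combine (map ((\<otimes>) a) ?P) ?B = a \<otimes> combine ?P ?B"
      by (rule scale[OF ac(1) _ B]) (use PK Kc in blast)
    moreover have "combine (map ((\<otimes>) b) ?Q) ?B = b \<otimes> combine ?Q ?B"
      by (rule scale[OF ac(2) _ B]) (use PK Kc in blast)
    ultimately have ceq: "combine (map ((\<otimes>) a) ?P) ?B = combine (map ((\<otimes>) b) ?Q) ?B"
      using P(5) Q(5) by metis
    have sets: "set (map ((\<otimes>) a) ?P) \<subseteq> ?K" "set (map ((\<otimes>) b) ?Q) \<subseteq> ?K"
      using PK abK subfield_props(6)[OF K] by auto
    then have "combine (map ((\<otimes>) a) ?P) ?B \<in> Span ?K ?B"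
      unfolding Span_eq_combine_set[OF K B] by blast
    moreover have "length (map ((\<otimes>) a) ?P) = length ?B" "length (map ((\<otimes>) b) ?Q) = length ?B"
      using P Q by auto
    ultimately have "map ((\<otimes>) a) ?P = map ((\<otimes>) b) ?Q"
      using unique_decomposition[OF K Bind] ceq sets by metis
    then have Peq: "map ((\<otimes>) a) Ps = map ((\<otimes>) b) Qs" and ab_eq: "a \<otimes> \<alpha> = b \<otimes> \<alpha>'" "a \<otimes> \<beta> = b \<otimes> \<beta>'"
      using P(2) Q(2) by auto
    \<comment> \<open>In \<open>a y = b ((a/b) y)\<close> the coordinates of \<open>y\<close> are in \<open>F\<^sup>2(a)\<close> or \<open>F\<^sup>2(b)\<close>. A nonzero one would put
      \<open>b\<close> into \<open>F\<^sup>2(a)\<close> or \<open>a\<close> into \<open>F\<^sup>2(b)\<close>.\<close>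
    have clash: "p = \<zero>" if "p \<in> L" "q \<in> L" "subfield L F" "e \<in> L" "f \<in> carrier F" "f \<notin> L"
        "f \<otimes> p = e \<otimes> q" for p q e f L
    proof -
      have "p \<in> carrier F" "q \<in> carrier F" "e \<in> carrier F" using that subfieldE(3) by blast+
      moreover have "e \<otimes> q \<in> L"
        using subringE(6)[OF subfieldE(1)[OF that(3)] that(4) that(2)] .
      moreover have "\<zero> \<in> L" using subfield_props(2)[OF that(3)] .
      moreover have "e \<otimes> q \<oplus> p \<otimes> f = \<zero>" using calculation that m_comm by auto
      ultimately show "p = \<zero>" using coefficient_zero_if_notin[OF that(3,5,6), of "e \<otimes> q" p] that by simp
    qed
    have "\<beta> = \<zero>"
      by (rule clash[OF P(4) Q(4) Sb adj_incl ac(1) a_b(1) ab_eq(2)]) simp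
    moreover have "\<alpha>' = \<zero>"
      by (rule clash[OF Q(3) P(3) Sa adj_incl ac(2) a_b(2) ab_eq(1)[symmetric]]) simp
    moreover have "\<alpha> \<in> carrier F" using P(3) subfieldE(3)[OF Sa] by blast
    moreover have "a \<noteq> \<zero>" using a_S subfield_props(2)[OF S] by auto
    ultimately have "\<alpha> = \<zero>" "\<beta> = \<zero>" using ab_eq(1) ac integral by auto
    moreover have "set Ps \<subseteq> {\<zero>}"
    proof
      fix p assume "p \<in> set Ps"
      then obtain i where i: "i < length Ps" "p = Ps ! i" by (auto simp: in_set_conv_nth)
      then have "a \<otimes> p = b \<otimes> (Qs ! i)"
        using arg_cong[OF Peq, of "\<lambda>l. l ! i"] P(2) Q(2) by simp
      moreover have "p \<in> set Ps" "Qs ! i \<in> set Qs" using i P(2) Q(2) by simp_all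
      then have "p \<in> adj {b}" "Qs ! i \<in> adj {b}"
        using P(1) Q(1) squares_subset_adj[of "{b}"] by blast+
      ultimately have "p = \<zero>"
        by (intro clash[OF _ _ Sb adj_incl ac(1) a_b(1)]) auto
      then show "p \<in> {\<zero>}" by simp
    qed
    ultimately have "set ?P \<subseteq> {\<zero>}" by auto
    then have "combine ?P ?B = \<zero>"
    proof -
      have "combine Ks Vs = \<zero>" if "set Ks \<subseteq> {\<zero>}" "set Vs \<subseteq> carrier F" for Ks Vs
        using that by (induction Ks Vs rule: combine.induct) auto
      with \<open>set ?P \<subseteq> {\<zero>}\<close> B show ?thesis by blast
    qed
    with P(5) y(2) show ?thesis by simp
  qed
qed

text \<open>
  For each \<open>a\<close> there is a line through \<open>p a\<close> and \<open>a (p a)\<close> in \<open>W\<close>, and any two of these lines meet. Let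
  \<open>z\<close> be a common point for \<open>a\<close> and \<open>b\<close>. If the line for \<open>c\<close> met these two in different points, it would
  lie in their plane, which forces \<open>c\<close> into \<open>F\<^sup>2(a, b)\<close>; so it passes through \<open>z\<close>. As the line for \<open>c\<close> is
  stable under multiplication by \<open>c\<close>, it also contains \<open>c z\<close>.
\<close>

lemma common_point: "\<exists>z\<in>W. z \<noteq> \<zero> \<and> (\<forall>a\<in>set as. a \<otimes> z \<in> W)"
proof -
  let ?S = "squares F"
  note S = subfield_squares
  have "\<exists>w\<in>W. w \<noteq> \<zero> \<and> a \<otimes> w \<in> W" if a: "a \<in> set as" for a
  proof (rule ratio_transfer[OF _ _ u_in_U u(2)])
    show "a \<in> carrier F" using a as by auto
    then show "a \<otimes> u \<in> U" using u_as_in_U[OF a] u m_comm by simp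
    show "a \<notin> ?S" using two_independent_notin[OF two_indep a, of "{}"] by (simp add: adj_empty)
  qed
  then obtain p where p: "\<And>a. a \<in> set as \<Longrightarrow> p a \<in> W \<and> p a \<noteq> \<zero> \<and> a \<otimes> p a \<in> W" by metis
  have pc: "p a \<in> carrier F" if "a \<in> set as" for a using p[OF that] W_props by blast
  \<comment> \<open>The span of \<open>p a\<close> and \<open>a (p a)\<close> is \<open>F\<^sup>2(a) (p a)\<close>, hence stable under \<open>a\<close>.\<close>
  have line: "\<alpha> \<otimes> p a \<in> W \<and> a \<otimes> (\<alpha> \<otimes> p a) \<in> W" if a: "a \<in> set as" and al: "\<alpha> \<in> adj {a}" for a \<alpha>
  proof -
    have ac: "a \<in> carrier F" using a as by auto
    then obtain r s where rs: "r \<in> ?S" "s \<in> ?S" "\<alpha> = r \<oplus> s \<otimes> a"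
      using al adj_insert[of "{}" a] by (auto simp: adj_empty)
    then have rsc: "r \<in> carrier F" "s \<in> carrier F" using squares_in_carrier by auto
    have "a \<otimes> a \<in> ?S" using square_in_squares[OF ac] ac by (simp add: square_eq)
    then have "s \<otimes> (a \<otimes> a) \<in> ?S" using rs subfield_props(6)[OF S] by blast
    then have "r \<otimes> p a \<oplus> s \<otimes> (a \<otimes> p a) \<in> W" "s \<otimes> (a \<otimes> a) \<otimes> p a \<oplus> r \<otimes> (a \<otimes> p a) \<in> W"
      using rs p[OF a] W_props(3) W_smult by blast+
    moreover have "\<alpha> \<otimes> p a = r \<otimes> p a \<oplus> s \<otimes> (a \<otimes> p a)"
        "a \<otimes> (\<alpha> \<otimes> p a) = s \<otimes> (a \<otimes> a) \<otimes> p a \<oplus> r \<otimes> (a \<otimes> p a)"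
      using rs(3) rsc ac pc[OF a] by (simp_all add: l_distr r_distr a_ac m_ac)
    ultimately show ?thesis by simp
  qed
  have meet: "\<exists>\<alpha>\<in>adj {a}. \<exists>\<beta>\<in>adj {b}. \<alpha> \<noteq> \<zero> \<and> \<beta> \<noteq> \<zero> \<and> \<alpha> \<otimes> w = \<beta> \<otimes> x"
    if h: "a \<in> set as" "b \<in> set as" "a \<noteq> b" "w \<in> W" "w \<noteq> \<zero>" "a \<otimes> w \<in> W"
      "x \<in> W" "x \<noteq> \<zero>" "b \<otimes> x \<in> W" for a b w x
  proof -
    obtain \<alpha> \<beta> where ab: "\<alpha> \<in> adj {a}" "\<beta> \<in> adj {b}" "\<alpha> \<noteq> \<zero>" "\<alpha> \<otimes> w = \<beta> \<otimes> x"
      using lines_meet[OF h] by blast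
    have "\<alpha> \<in> carrier F" using ab(1) adj_subfield[of "{a}"] as h subfieldE(3) by blast
    moreover have "w \<in> carrier F" "x \<in> carrier F" using h W_props by blast+
    ultimately have "\<beta> \<noteq> \<zero>" using ab h integral_iff[of \<alpha> w] by auto
    with ab show ?thesis by blast
  qed
  consider "set as = {}" | a where "set as = {a}"
    | a b where "a \<in> set as" "b \<in> set as" "a \<noteq> b"
    by (metis insertI1 is_singletonI' is_singleton_def)
  then show ?thesis
  proof cases
    case 1
    obtain w ws' where "ws = w # ws'" using length_ws by (cases ws) auto
    then have "w \<in> W" "w \<noteq> \<zero>"
      using Span_base_incl[OF S ws] ws_indep independent_backwards(1)[of ?S w ws']
        Span_subgroup_props(2)[OF S, of ws'] ws by auto
    with 1 show ?thesis by auto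
  next
    case 2
    then show ?thesis using p[of a] by auto
  next
    case (3 a b)
    then obtain \<alpha>0 \<beta>0 where ab0: "\<alpha>0 \<in> adj {a}" "\<beta>0 \<in> adj {b}" "\<alpha>0 \<noteq> \<zero>" "\<beta>0 \<noteq> \<zero>"
        "\<alpha>0 \<otimes> p a = \<beta>0 \<otimes> p b"
      using meet[OF 3, of "p a" "p b"] p by blast
    define z where "z = \<alpha>0 \<otimes> p a"
    have ac: "a \<in> carrier F" "b \<in> carrier F" using 3 as by auto
    have Sa: "subfield (adj {a}) F" and Sb: "subfield (adj {b}) F" using ac by (auto intro: adj_subfield)
    have z: "z \<in> W" "a \<otimes> z \<in> W" "b \<otimes> z \<in> W"
      using line[OF 3(1) ab0(1)] line[OF 3(2) ab0(2)] ab0(5) by (auto simp: z_def)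
    have zc: "z \<in> carrier F" using z W_props by blast
    have z0: "z \<noteq> \<zero>"
      using ab0 p[OF 3(1)] pc[OF 3(1)] integral_iff subfieldE(3)[OF Sa] by (auto simp: z_def)
    have "c \<otimes> z \<in> W" if c: "c \<in> set as" for c
    proof (cases "c = a \<or> c = b")
      case True
      with z show ?thesis by auto
    next
      case False
      have cc: "c \<in> carrier F" using c as by auto
      have Sc: "subfield (adj {c}) F" and Sab: "subfield (adj {a, b}) F"
        using cc ac by (auto intro: adj_subfield)
      have pcc: "p c \<in> carrier F" by (rule pc[OF c])
      obtain \<alpha> \<gamma> where ag: "\<alpha> \<in> adj {a}" "\<gamma> \<in> adj {c}" "\<alpha> \<noteq> \<zero>" "\<gamma> \<noteq> \<zero>" "\<alpha> \<otimes> z = \<gamma> \<otimes> p c"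
        using meet[OF 3(1) c _ z(1) z0 z(2), of "p c"] p[OF c] False by blast
      obtain \<beta> \<gamma>' where bg: "\<beta> \<in> adj {b}" "\<gamma>' \<in> adj {c}" "\<beta> \<noteq> \<zero>" "\<gamma>' \<noteq> \<zero>" "\<beta> \<otimes> z = \<gamma>' \<otimes> p c"
        using meet[OF 3(2) c _ z(1) z0 z(3), of "p c"] p[OF c] False by blast
      have car: "\<alpha> \<in> carrier F" "\<beta> \<in> carrier F" "\<gamma> \<in> carrier F" "\<gamma>' \<in> carrier F"
        using ag bg Sa Sb Sc subfieldE(3) by blast+
      \<comment> \<open>The ratio \<open>\<alpha>/\<beta> = \<gamma>/\<gamma>'\<close> lies in \<open>F\<^sup>2(a, b)\<close> and in \<open>F\<^sup>2(c)\<close>, hence in \<open>F\<^sup>2\<close>.\<close>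
      define t where "t = \<alpha> \<otimes> inv \<beta>"
      have ib: "inv \<beta> \<in> carrier F" "\<beta> \<otimes> inv \<beta> = \<one>" and ig: "inv \<gamma>' \<in> carrier F" "\<gamma>' \<otimes> inv \<gamma>' = \<one>"
        using car bg field_Units by auto
      have tc: "t \<in> carrier F" using car ib by (simp add: t_def)
      have tb: "t \<otimes> \<beta> = \<alpha>" using car ib by (simp add: t_def m_ac)
      have "t \<otimes> \<gamma>' \<otimes> p c = t \<otimes> (\<beta> \<otimes> z)" using bg(5) car tc pcc by (simp add: m_assoc)
      also have "\<dots> = \<gamma> \<otimes> p c" using tb ag(5) tc car zc by (simp add: m_assoc[symmetric])
      finally have "t \<otimes> \<gamma>' = \<gamma>"
        using m_rcancel[of "p c" "t \<otimes> \<gamma>'" \<gamma>] p[OF c] pcc tc car by simp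
      then have "t = \<gamma> \<otimes> inv \<gamma>'" using tc car ig by (simp add: m_assoc flip: \<open>t \<otimes> \<gamma>' = \<gamma>\<close>)
      then have "t \<in> adj {c}"
        using ag bg subfield_m_inv(1)[OF Sc] subfield_props(6)[OF Sc] by auto
      moreover have "t \<in> adj {a, b}"
      proof -
        have "\<alpha> \<in> adj {a, b}" "\<beta> \<in> adj {a, b}"
          using ag bg adj_mono[of "{a}" "{a, b}"] adj_mono[of "{b}" "{a, b}"] ac by auto
        then show ?thesis unfolding t_def
          using bg(3) subfield_m_inv(1)[OF Sab] subfield_props(6)[OF Sab] by auto
      qed
      moreover have "c \<notin> adj {a, b}"
        by (rule two_independent_notin[OF two_indep c]) (use False 3 in auto)
      ultimately have tS: "t \<in> ?S"
        using adj_Int[of "{}" "{a, b}" c] ac cc by (auto simp: adj_empty)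
      \<comment> \<open>So \<open>\<alpha>\<close> is in \<open>F\<^sup>2(a)\<close> and in \<open>F\<^sup>2(b)\<close>, hence in \<open>F\<^sup>2\<close>, and \<open>z\<close> is an \<open>F\<^sup>2(c)\<close>-multiple of \<open>p c\<close>.\<close>
      have "\<alpha> \<in> adj {b}"
        using tS squares_subset_adj[of "{b}"] bg(1) subfield_props(6)[OF Sb] tb by blast
      moreover have "a \<notin> adj {b}"
        by (rule two_independent_notin[OF two_indep 3(1)]) (use 3 in auto)
      ultimately have aS: "\<alpha> \<in> ?S"
        using adj_Int[of "{}" "{b}" a] ag(1) ac by (auto simp: adj_empty)
      have ia: "inv \<alpha> \<in> ?S" using subfield_m_inv(1)[OF S] aS ag(3) by auto
      then have "inv \<alpha> \<otimes> \<gamma> \<in> adj {c}"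
        using squares_subset_adj[of "{c}"] ag(2) subfield_props(6)[OF Sc] by blast
      then have "c \<otimes> (inv \<alpha> \<otimes> \<gamma> \<otimes> p c) \<in> W" using line[OF c] by blast
      moreover have "inv \<alpha> \<otimes> \<gamma> \<otimes> p c = z"
      proof -
        have iac: "inv \<alpha> \<in> carrier F" "inv \<alpha> \<otimes> \<alpha> = \<one>" using ag(3) car field_Units by auto
        have "inv \<alpha> \<otimes> \<gamma> \<otimes> p c = inv \<alpha> \<otimes> (\<alpha> \<otimes> z)" using iac car pcc ag(5) by (simp add: m_assoc)
        also have "\<dots> = z" using iac car zc by (simp add: m_assoc[symmetric])
        finally show ?thesis .
      qed
      ultimately show ?thesis by simp
    qed
    with z z0 show ?thesis by blast
  qed
qed

theorem proportional: "\<exists>c\<in>carrier F - {\<zero>}. W = (\<otimes>) c ` U"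
proof -
  let ?S = "squares F"
  note S = subfield_squares
  obtain z where z: "z \<in> W" "z \<noteq> \<zero>" "\<And>a. a \<in> set as \<Longrightarrow> a \<otimes> z \<in> W"
    using common_point by blast
  have zc: "z \<in> carrier F" using z W_props by blast
  have iu: "inv u \<in> carrier F" "u \<otimes> inv u = \<one>" "inv u \<noteq> \<zero>" using u field_Units by auto
  let ?c = "z \<otimes> inv u"
  have c: "?c \<in> carrier F" "?c \<noteq> \<zero>" using zc iu z integral_iff by auto
  have cu: "?c \<otimes> (u \<otimes> a) = a \<otimes> z" if "a \<in> carrier F" for a
  proof -
    have "?c \<otimes> (u \<otimes> a) = z \<otimes> (u \<otimes> inv u) \<otimes> a" using zc iu(1) u that by (simp add: m_ac)
    also have "\<dots> = a \<otimes> z" using iu zc that by (simp add: m_comm)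
    finally show ?thesis .
  qed
  let ?V = "map ((\<otimes>) ?c) us"
  have V: "set ?V \<subseteq> W" using cu as z zc by auto
  have Vi: "independent ?S ?V" by (rule independent_map_mult[OF S c us_indep])
  have "W = Span ?S ?V"
    by (rule independent_length_eq_dimension[OF S dim_W Vi V, THEN iffD1, symmetric]) simp
  then have "W = (\<otimes>) ?c ` U" using Span_map_mult[OF S c(1) us] by simp
  with c show ?thesis by blast
qed

end

section \<open>Linear isomorphisms and coordinates\<close>

abbreviation tuples where
  "tuples R n \<equiv> {..<n} \<rightarrow>\<^sub>E carrier R"

definition lin_iso where
  "lin_iso F V W f \<longleftrightarrow> f \<in> module_hom F V W \<and> bij_betw f (carrier V) (carrier W)"

lemma lin_isoI:
  assumes "\<And>v. v \<in> carrier V \<Longrightarrow> f v \<in> carrier W"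
    "\<And>v w. v \<in> carrier V \<Longrightarrow> w \<in> carrier V \<Longrightarrow> f (v \<oplus>\<^bsub>V\<^esub> w) = f v \<oplus>\<^bsub>W\<^esub> f w"
    "\<And>a v. a \<in> carrier F \<Longrightarrow> v \<in> carrier V \<Longrightarrow> f (a \<odot>\<^bsub>V\<^esub> v) = a \<odot>\<^bsub>W\<^esub> f v"
    "bij_betw f (carrier V) (carrier W)"
  shows "lin_iso F V W f"
  using assms by (auto simp: lin_iso_def module_hom_def)

lemma lin_isoD:
  assumes "lin_iso F V W f"
  shows "v \<in> carrier V \<Longrightarrow> f v \<in> carrier W"
    and "v \<in> carrier V \<Longrightarrow> w \<in> carrier V \<Longrightarrow> f (v \<oplus>\<^bsub>V\<^esub> w) = f v \<oplus>\<^bsub>W\<^esub> f w"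
    and "a \<in> carrier F \<Longrightarrow> v \<in> carrier V \<Longrightarrow> f (a \<odot>\<^bsub>V\<^esub> v) = a \<odot>\<^bsub>W\<^esub> f v"
    and "bij_betw f (carrier V) (carrier W)"
  using assms by (auto simp: lin_iso_def module_hom_def)

lemma lin_iso_comp:
  assumes f: "lin_iso F V W f" and g: "lin_iso F W X g"
  shows "lin_iso F V X (g \<circ> f)"
  by (rule lin_isoI)
    (use lin_isoD[OF f] lin_isoD[OF g] in \<open>auto intro: bij_betw_trans\<close>)

lemma lin_iso_inv:
  assumes V: "module F V" and f: "lin_iso F V W f"
  shows "lin_iso F W V (inv_into (carrier V) f)"
proof (rule lin_isoI)
  interpret V: module F V by fact
  let ?g = "inv_into (carrier V) f"
  note f' = lin_isoD[OF f]
  have g: "w \<in> carrier W \<Longrightarrow> ?g w \<in> carrier V" "w \<in> carrier W \<Longrightarrow> f (?g w) = w" for w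
    using f'(4) by (auto simp: bij_betw_def inv_into_into f_inv_into_f)
  have g': "v \<in> carrier V \<Longrightarrow> ?g (f v) = v" for v
    using f'(4) by (auto simp: bij_betw_def)
  show "w \<in> carrier W \<Longrightarrow> ?g w \<in> carrier V" for w by (rule g)
  show "bij_betw ?g (carrier W) (carrier V)" by (rule bij_betw_inv_into[OF f'(4)])
  show "?g (v \<oplus>\<^bsub>W\<^esub> w) = ?g v \<oplus>\<^bsub>V\<^esub> ?g w" if "v \<in> carrier W" "w \<in> carrier W" for v w
    using g'[of "?g v \<oplus>\<^bsub>V\<^esub> ?g w"] f'(2)[of "?g v" "?g w"] g that by simp
  show "?g (a \<odot>\<^bsub>W\<^esub> w) = a \<odot>\<^bsub>V\<^esub> ?g w" if "a \<in> carrier F" "w \<in> carrier W" for a w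
    using g'[of "a \<odot>\<^bsub>V\<^esub> ?g w"] f'(3)[of a "?g w"] g that by simp
qed

lemma lin_iso_dim:
  assumes V: "vectorspace F V" and W: "vectorspace F W" and f: "lin_iso F V W f"
    and fd: "vectorspace.fin_dim F V"
  shows "vectorspace.fin_dim F W" "vectorspace.dim F W = vectorspace.dim F V"
proof -
  have "mod_hom F V W f"
    using V W f by (auto simp: mod_hom_def mod_hom_axioms_def lin_iso_def vectorspace_def)
  then interpret linear_map F V W f using V W by (auto simp: linear_map_def)
  have inj: "inj_on f (carrier V)" and surj: "f ` carrier V = carrier W"
    using f by (auto simp: lin_iso_def bij_betw_def)
  show "vectorspace.fin_dim F W" by (rule surj_fin_dim[OF fd surj])
  show "vectorspace.dim F W = vectorspace.dim F V" using dim_eq[OF fd inj surj] by simp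
qed

text \<open>
  Each axiom is pulled back along the injection. This spares a direct verification for the quotient
  that defines the extension of scalars.
\<close>

lemma vectorspace_transport:
  assumes W: "vectorspace F W"
    and inj: "inj_on f (carrier V)" and im: "f ` carrier V = carrier W"
    and zero: "\<zero>\<^bsub>V\<^esub> \<in> carrier V" "f \<zero>\<^bsub>V\<^esub> = \<zero>\<^bsub>W\<^esub>"
    and add: "\<And>v w. v \<in> carrier V \<Longrightarrow> w \<in> carrier V \<Longrightarrow>
      v \<oplus>\<^bsub>V\<^esub> w \<in> carrier V \<and> f (v \<oplus>\<^bsub>V\<^esub> w) = f v \<oplus>\<^bsub>W\<^esub> f w"
    and smult: "\<And>a v. a \<in> carrier F \<Longrightarrow> v \<in> carrier V \<Longrightarrow>
      a \<odot>\<^bsub>V\<^esub> v \<in> carrier V \<and> f (a \<odot>\<^bsub>V\<^esub> v) = a \<odot>\<^bsub>W\<^esub> f v"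
  shows "vectorspace F V" "lin_iso F V W f"
proof -
  interpret W: vectorspace F W by fact
  have fc: "f v \<in> carrier W" if "v \<in> carrier V" for v using im that by auto
  note ops = add smult fc zero
  have eqI: "v = w" if "v \<in> carrier V" "w \<in> carrier V" "f v = f w" for v w
    using inj that by (auto dest: inj_onD)
  show "vectorspace F V"
  proof (rule vs_criteria)
    show "field F" ..
    show "\<forall>v\<in>carrier V. \<exists>w\<in>carrier V. v \<oplus>\<^bsub>V\<^esub> w = \<zero>\<^bsub>V\<^esub>"
    proof
      fix v assume v: "v \<in> carrier V"
      then have "\<ominus>\<^bsub>W\<^esub> f v \<in> f ` carrier V" using im fc by simp
      then obtain w where w: "w \<in> carrier V" "f w = \<ominus>\<^bsub>W\<^esub> f v" by auto
      then have "f (v \<oplus>\<^bsub>V\<^esub> w) = f \<zero>\<^bsub>V\<^esub>" using v ops by (simp add: W.M.r_neg)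
      then show "\<exists>w\<in>carrier V. v \<oplus>\<^bsub>V\<^esub> w = \<zero>\<^bsub>V\<^esub>" using eqI v w ops by blast
    qed
  qed (auto intro!: eqI simp: ops W.M.a_ac W.smult_assoc1 W.smult_l_distr W.smult_r_distr)
  show "lin_iso F V W f"
    by (rule lin_isoI) (use ops inj im in \<open>auto simp: bij_betw_def\<close>)
qed

lemma vectorspace_form_on:
  assumes "vectorspace F V"
  shows "vectorspace F (form_on V q)" "lin_iso F (form_on V q) V id"
proof -
  interpret vectorspace F V by fact
  show "vectorspace F (form_on V q)" "lin_iso F (form_on V q) V id"
    using vectorspace_transport[OF assms, of id "form_on V q"] by auto
qed

context ring begin

lemma func_space_simps [simp]:
  "carrier (func_space S) = S \<rightarrow>\<^sub>E carrier R"
  "x \<oplus>\<^bsub>func_space S\<^esub> y = (\<lambda>i\<in>S. x i \<oplus> y i)"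
  "a \<odot>\<^bsub>func_space S\<^esub> x = (\<lambda>i\<in>S. a \<otimes> x i)"
  "\<zero>\<^bsub>func_space S\<^esub> = (\<lambda>i\<in>S. \<zero>)"
  by (simp_all add: func_space_def)

end

context vectorspace begin

definition comb :: "nat \<Rightarrow> (nat \<Rightarrow> 'c) \<Rightarrow> (nat \<Rightarrow> 'a) \<Rightarrow> 'c" where
  "comb n b x = (\<Oplus>\<^bsub>V\<^esub>i\<in>{..<n}. x i \<odot>\<^bsub>V\<^esub> b i)"

lemma comb_hom:
  assumes b: "b \<in> {..<n} \<rightarrow> carrier V"
  shows "comb n b \<in> module_hom K (func_space {..<n}) V"
proof -
  have c: "x i \<odot>\<^bsub>V\<^esub> b i \<in> carrier V" if "x \<in> tuples K n" "i < n" for x i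
    using that b by (auto intro!: smult_closed)
  have "comb n b (\<lambda>i\<in>{..<n}. x i \<oplus>\<^bsub>K\<^esub> y i) = comb n b x \<oplus>\<^bsub>V\<^esub> comb n b y"
    if "x \<in> tuples K n" "y \<in> tuples K n" for x y
  proof -
    have "x i \<in> carrier K" "y i \<in> carrier K" "b i \<in> carrier V" if "i < n" for i
      using \<open>x \<in> _\<close> \<open>y \<in> _\<close> b that by auto
    note mem = this
    have "comb n b (\<lambda>i\<in>{..<n}. x i \<oplus>\<^bsub>K\<^esub> y i)
        = (\<Oplus>\<^bsub>V\<^esub>i\<in>{..<n}. x i \<odot>\<^bsub>V\<^esub> b i \<oplus>\<^bsub>V\<^esub> y i \<odot>\<^bsub>V\<^esub> b i)"
      unfolding comb_def by (intro M.finsum_cong') (auto simp: mem smult_l_distr)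
    then show ?thesis
      unfolding comb_def using c that by (subst M.finsum_addf[symmetric]) auto
  qed
  moreover have "comb n b (\<lambda>i\<in>{..<n}. a \<otimes>\<^bsub>K\<^esub> x i) = a \<odot>\<^bsub>V\<^esub> comb n b x"
    if "x \<in> tuples K n" "a \<in> carrier K" for x a
  proof -
    have "x i \<in> carrier K" "b i \<in> carrier V" if "i < n" for i
      using \<open>x \<in> _\<close> b that by auto
    note mem = this
    have "comb n b (\<lambda>i\<in>{..<n}. a \<otimes>\<^bsub>K\<^esub> x i) = (\<Oplus>\<^bsub>V\<^esub>i\<in>{..<n}. a \<odot>\<^bsub>V\<^esub> (x i \<odot>\<^bsub>V\<^esub> b i))"
      unfolding comb_def using that by (intro M.finsum_cong') (auto simp: mem smult_assoc1)
    then show ?thesis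
      unfolding comb_def using c that by (subst finsum_smult_ldistr) auto
  qed
  ultimately show ?thesis
    using c by (auto simp: module_hom_def comb_def intro!: M.finsum_closed)
qed

lemma comb_reindex:
  assumes e: "inj_on e {..<n}" and B: "e ` {..<n} \<subseteq> carrier V" and a: "a \<in> e ` {..<n} \<rightarrow> carrier K"
  shows "lincomb a (e ` {..<n}) = comb n e (\<lambda>i\<in>{..<n}. a (e i))"
proof -
  have mem: "e i \<in> carrier V" "a (e i) \<in> carrier K" if "i < n" for i using B a that by auto
  have "lincomb a (e ` {..<n}) = (\<Oplus>\<^bsub>V\<^esub>i\<in>{..<n}. a (e i) \<odot>\<^bsub>V\<^esub> e i)"
    unfolding lincomb_def using e mem by (intro M.finsum_reindex) auto
  also have "\<dots> = comb n e (\<lambda>i\<in>{..<n}. a (e i))"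
    unfolding comb_def using mem by (intro M.finsum_cong') auto
  finally show ?thesis .
qed

lemma comb_bij_if_basis:
  assumes e: "inj_on e {..<n}" and B: "basis (e ` {..<n})"
  shows "lin_iso K (func_space {..<n}) V (comb n e)"
proof -
  let ?B = "e ` {..<n}"
  have Bc: "?B \<subseteq> carrier V" using B by (simp add: basis_def)
  have ex1: "\<exists>!a. a \<in> ?B \<rightarrow>\<^sub>E carrier K \<and> lincomb a ?B = v" if "v \<in> carrier V" for v
    using basis_criterion[of ?B] B Bc that by auto
  have hom: "comb n e \<in> module_hom K (func_space {..<n}) V"
    by (rule comb_hom) (use Bc in auto)
  define r where "r x = (\<lambda>v\<in>?B. x (inv_into {..<n} e v))" for x :: "nat \<Rightarrow> 'a"
  have r: "r x \<in> ?B \<rightarrow>\<^sub>E carrier K" "comb n e x = lincomb (r x) ?B" "i < n \<Longrightarrow> r x (e i) = x i"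
    if x: "x \<in> tuples K n" for x i
  proof -
    have eq: "r x (e i) = x i" if "i < n" for i using that e by (simp add: r_def)
    then show "i < n \<Longrightarrow> r x (e i) = x i" by simp
    show rc: "r x \<in> ?B \<rightarrow>\<^sub>E carrier K"
    proof (rule PiE_I)
      fix v assume "v \<in> ?B"
      then show "r x v \<in> carrier K" using eq x by (auto simp: PiE_mem)
    qed (auto simp: r_def)
    have "(\<lambda>i\<in>{..<n}. r x (e i)) = x" using eq x by (auto simp: fun_eq_iff PiE_def extensional_def)
    then show "comb n e x = lincomb (r x) ?B"
      using comb_reindex[OF e Bc, of "r x"] rc by (auto simp: PiE_def)
  qed
  have "inj_on (comb n e) (tuples K n)"
  proof (rule inj_onI)
    fix x y assume xy: "x \<in> tuples K n" "y \<in> tuples K n" "comb n e x = comb n e y"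
    moreover have "comb n e x \<in> carrier V" using hom xy(1) by (auto simp: module_hom_def)
    ultimately have "r x = r y" using ex1[of "comb n e x"] r(1,2)[of x] r(1,2)[of y] by auto
    then have "x i = y i" if "i < n" for i using r(3)[OF xy(1) that] r(3)[OF xy(2) that] by simp
    then show "x = y" using xy(1,2) by (auto intro: PiE_ext)
  qed
  moreover have "comb n e ` (tuples K n) = carrier V"
  proof
    show "comb n e ` (tuples K n) \<subseteq> carrier V"
      using hom by (auto simp: module_hom_def)
    show "carrier V \<subseteq> comb n e ` (tuples K n)"
    proof
      fix v assume "v \<in> carrier V"
      then obtain a where a: "a \<in> ?B \<rightarrow>\<^sub>E carrier K" "lincomb a ?B = v" using ex1 by blast
      then have "v = comb n e (\<lambda>i\<in>{..<n}. a (e i))" using comb_reindex[OF e Bc, of a] by auto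
      moreover have "(\<lambda>i\<in>{..<n}. a (e i)) \<in> tuples K n" using a(1) by auto
      ultimately show "v \<in> comb n e ` (tuples K n)" by blast
    qed
  qed
  ultimately show ?thesis using hom by (simp add: lin_iso_def bij_betw_def)
qed

lemma coordinates_exist:
  assumes "fin_dim"
  shows "\<exists>b. b \<in> {..<dim} \<rightarrow> carrier V \<and> lin_iso K (func_space {..<dim}) V (comb dim b)"
proof -
  obtain B where B: "finite B" "basis B" using finite_basis_exists[OF assms] by auto
  then have "card B = dim" using dim_basis by simp
  then obtain e where e: "bij_betw e {..<dim} B"
    using ex_bij_betw_nat_finite[OF B(1)] by (auto simp: atLeast0LessThan)
  then have "inj_on e {..<dim}" "e ` {..<dim} = B" by (auto simp: bij_betw_def)
  moreover from this have "e \<in> {..<dim} \<rightarrow> carrier V" using B by (auto simp: basis_def)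
  ultimately show ?thesis using comb_bij_if_basis[of e dim] B by auto
qed

end

context field begin

lemma func_space_vectorspace: "vectorspace R (func_space S)"
  by (simp add: vectorspace_def func_space_is_module field_axioms)

lemma finsum_func_space:
  assumes "finite A" "f \<in> A \<rightarrow> (S \<rightarrow>\<^sub>E carrier R)"
  shows "finsum (func_space S) f A = (\<lambda>j\<in>S. \<Oplus>v\<in>A. f v j)"
proof -
  interpret V: vectorspace R "func_space S" by (rule func_space_vectorspace)
  show ?thesis
    using assms
  proof (induction A rule: finite_induct)
    case empty
    then show ?case by simp
  next
    case (insert v A)
    then have "f v \<in> S \<rightarrow>\<^sub>E carrier R" "f \<in> A \<rightarrow> (S \<rightarrow>\<^sub>E carrier R)" by auto
    moreover from this have "j \<in> S \<Longrightarrow> f v j \<in> carrier R" "j \<in> S \<Longrightarrow> (\<lambda>v. f v j) \<in> A \<rightarrow> carrier R" for j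
      by auto
    ultimately show ?case using insert by (auto simp: fun_eq_iff)
  qed
qed

lemma comb_unit_vectors:
  assumes x: "x \<in> tuples R n"
  shows "vectorspace.comb (func_space {..<n}) n (\<lambda>i. \<lambda>j\<in>{..<n}. if i = j then \<one> else \<zero>) x = x"
proof -
  interpret V: vectorspace R "func_space {..<n}" by (rule func_space_vectorspace)
  define e where "e i = (\<lambda>j\<in>{..<n}. if i = j then \<one> else \<zero>)" for i
  have mem: "x i \<in> carrier R" "e i j \<in> carrier R" if "i < n" "j < n" for i j
    using PiE_mem[OF x] that by (auto simp: e_def)
  have "V.comb n e x = (\<lambda>j\<in>{..<n}. \<Oplus>i\<in>{..<n}. x i \<otimes> e i j)"
    unfolding V.comb_def using mem
    by (subst finsum_func_space) (auto simp: fun_eq_iff intro!: finsum_cong')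
  also have "\<dots> = x"
  proof
    fix j show "(\<lambda>j\<in>{..<n}. \<Oplus>i\<in>{..<n}. x i \<otimes> e i j) j = x j"
    proof (cases "j < n")
      case True
      have "(\<Oplus>i\<in>{..<n}. x i \<otimes> e i j) = (\<Oplus>i\<in>{..<n}. if j = i then x i else \<zero>)"
        using mem True by (intro finsum_cong') (auto simp: e_def)
      also have "\<dots> = x j" using True mem by (intro finsum_singleton) auto
      finally show ?thesis using True by simp
    next
      case False
      with x show ?thesis by (auto simp: PiE_def extensional_def)
    qed
  qed
  finally show ?thesis unfolding e_def .
qed

lemma func_space_dim:
  "vectorspace.fin_dim R (func_space {..<n})" "vectorspace.dim R (func_space {..<n}) = n"
proof -
  interpret V: vectorspace R "func_space {..<n}" by (rule func_space_vectorspace)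
  define e where "e = (\<lambda>i. \<lambda>j\<in>{..<n}. if i = j then \<one> else \<zero>)"
  let ?B = "e ` {..<n}"
  have ec: "e i \<in> tuples R n" for i by (auto simp: e_def)
  have inj: "inj_on e {..<n}"
  proof (rule inj_onI)
    fix i j assume "i \<in> {..<n}" "j \<in> {..<n}" "e i = e j"
    then have "e i i = e j i" "i < n" by auto
    then show "i = j" by (auto simp: e_def split: if_splits)
  qed
  have lc: "V.comb n e x = x" if "x \<in> tuples R n" for x
    unfolding e_def by (rule comb_unit_vectors[OF that])
  have Bc: "?B \<subseteq> carrier (func_space {..<n})" using ec by auto
  have "V.basis ?B"
  proof (subst V.basis_criterion)
    show "\<forall>v. v \<in> carrier (func_space {..<n}) \<longrightarrow>
        (\<exists>!a. a \<in> ?B \<rightarrow>\<^sub>E carrier R \<and> V.lincomb a ?B = v)"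
    proof (intro allI impI)
      fix v assume v: "v \<in> carrier (func_space {..<n})"
      have *: "V.lincomb a ?B = (\<lambda>i\<in>{..<n}. a (e i))" if "a \<in> ?B \<rightarrow>\<^sub>E carrier R" for a
      proof -
        have "a \<in> ?B \<rightarrow> carrier R" "(\<lambda>i\<in>{..<n}. a (e i)) \<in> tuples R n"
          using that by (auto simp: PiE_def)
        then show ?thesis using V.comb_reindex[OF inj Bc, of a] lc by simp
      qed
      show "\<exists>!a. a \<in> ?B \<rightarrow>\<^sub>E carrier R \<and> V.lincomb a ?B = v"
      proof (rule ex1I)
        let ?a = "\<lambda>w\<in>?B. v (inv_into {..<n} e w)"
        have a: "?a (e i) = v i" if "i < n" for i using that inj by simp
        have vc: "v i \<in> carrier R" if "i < n" for i using v that by auto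
        have ac: "?a \<in> ?B \<rightarrow>\<^sub>E carrier R"
          using vc inj by (intro restrict_PiE_iff[THEN iffD2]) auto
        moreover have "(\<lambda>i\<in>{..<n}. ?a (e i)) = v"
          using a v by (auto simp: fun_eq_iff PiE_def extensional_def)
        ultimately show "?a \<in> ?B \<rightarrow>\<^sub>E carrier R \<and> V.lincomb ?a ?B = v" using * by metis
        fix b assume b: "b \<in> ?B \<rightarrow>\<^sub>E carrier R \<and> V.lincomb b ?B = v"
        then have "b (e i) = v i" if "i < n" for i
          using *[of b] that by (auto dest: fun_cong[of _ _ i])
        then show "b = ?a" using b ac a by (intro PiE_ext[of _ ?B "\<lambda>_. carrier R"]) auto
      qed
    qed
  qed (use Bc in auto)
  then show "V.fin_dim" "V.dim = n"
    using V.dim_basis[of ?B] inj Bc unfolding V.fin_dim_def V.basis_def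
    by (auto simp: card_image V.basis_def)
qed

end

lemma dim_if_coordinates:
  assumes V: "vectorspace F V" and f: "lin_iso F (ring.func_space F {..<n}) V f"
  shows "vectorspace.fin_dim F V" "vectorspace.dim F V = n"
proof -
  interpret vectorspace F V by fact
  show "vectorspace.fin_dim F V" "vectorspace.dim F V = n"
    using lin_iso_dim[OF func_space_vectorspace V f] func_space_dim by auto
qed

lemma (in vectorspace) subspace_fin_dim:
  assumes fd: "fin_dim" and W: "subspace K W V"
  shows "vectorspace.fin_dim K (vs W)"
proof -
  interpret W: vectorspace K "vs W" by (rule subspace_is_vs[OF W])
  have sub: "submodule K W V" using W by simp
  then have WV: "W \<subseteq> carrier V" by (simp add: submodule_def)
  have li: "W.lin_dep A \<longleftrightarrow> lin_dep A" if "A \<subseteq> W" for A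
    using span_li_not_depend(2)[OF that sub] .
  let ?P = "\<lambda>A. A \<subseteq> carrier (vs W) \<and> W.lin_indpt A"
  have "finite A \<and> card A \<le> dim" if "?P A" for A
    using that WV li li_le_dim[OF fd, of A] by auto
  moreover have "?P {}" by (auto simp: W.lin_dep_def)
  ultimately obtain A where "finite A" "maximal A ?P"
    using maximal_exists[of ?P dim "{}"] by blast
  with W.max_li_is_basis[of A] show ?thesis
    unfolding W.fin_dim_def W.basis_def by auto
qed

lemma (in mod_hom) f_finsum:
  "finite A \<Longrightarrow> g \<in> A \<rightarrow> carrier M \<Longrightarrow> f (\<Oplus>\<^bsub>M\<^esub>i\<in>A. g i) = (\<Oplus>\<^bsub>N\<^esub>i\<in>A. f (g i))"
proof (induction A rule: finite_induct)
  case (insert i A)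
  then have g: "g \<in> A \<rightarrow> carrier M" "g i \<in> carrier M" by auto
  moreover from this have "(\<lambda>i. f (g i)) \<in> A \<rightarrow> carrier N" "f (g i) \<in> carrier N" by auto
  ultimately show ?case using insert by (simp add: M.finsum_closed)
qed simp

lemma lin_iso_zero:
  assumes "module F V" "module F W" "lin_iso F V W f"
  shows "f \<zero>\<^bsub>V\<^esub> = \<zero>\<^bsub>W\<^esub>"
proof -
  interpret mod_hom F V W f
    using assms by (simp add: mod_hom_def mod_hom_axioms_def lin_iso_def)
  show ?thesis by (rule f0_is_0)
qed

section \<open>Isometry and sets of values\<close>

abbreviation vals :: "('a, 'v) qform \<Rightarrow> 'a set" where
  "vals \<phi> \<equiv> qf \<phi> ` carrier \<phi>"

lemma isometric_iff:
  "isometric F \<phi> \<psi> \<longleftrightarrow> (\<exists>f. lin_iso F \<phi> \<psi> f \<and> (\<forall>v\<in>carrier \<phi>. qf \<phi> v = qf \<psi> (f v)))"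
  by (auto simp: isometric_def lin_iso_def)

lemma isometric_trans:
  assumes "isometric F \<phi> \<psi>" "isometric F \<psi> \<chi>"
  shows "isometric F \<phi> \<chi>"
proof -
  obtain f g where f: "lin_iso F \<phi> \<psi> f" "\<forall>v\<in>carrier \<phi>. qf \<phi> v = qf \<psi> (f v)"
      and g: "lin_iso F \<psi> \<chi> g" "\<forall>v\<in>carrier \<psi>. qf \<psi> v = qf \<chi> (g v)"
    using assms by (auto simp: isometric_iff)
  have "\<forall>v\<in>carrier \<phi>. qf \<phi> v = qf \<chi> ((g \<circ> f) v)"
    using f g lin_isoD(1)[OF f(1)] by auto
  with lin_iso_comp[OF f(1) g(1)] show ?thesis by (auto simp: isometric_iff)
qed

lemma isometric_sym:
  assumes "module F \<phi>" "isometric F \<phi> \<psi>"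
  shows "isometric F \<psi> \<phi>"
proof -
  obtain f where f: "lin_iso F \<phi> \<psi> f" "\<forall>v\<in>carrier \<phi>. qf \<phi> v = qf \<psi> (f v)"
    using assms by (auto simp: isometric_iff)
  have "inv_into (carrier \<phi>) f w \<in> carrier \<phi>" "f (inv_into (carrier \<phi>) f w) = w"
    if "w \<in> carrier \<psi>" for w
    using lin_isoD(4)[OF f(1)] that by (auto simp: bij_betw_def inv_into_into f_inv_into_f)
  with f have "\<forall>w\<in>carrier \<psi>. qf \<psi> w = qf \<phi> (inv_into (carrier \<phi>) f w)" by auto
  with lin_iso_inv[OF assms(1) f(1)] show ?thesis by (auto simp: isometric_iff)
qed

lemma isometric_values:
  assumes "isometric F \<phi> \<psi>"
  shows "vals \<phi> = vals \<psi>"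
proof -
  obtain f where f: "lin_iso F \<phi> \<psi> f" "\<forall>v\<in>carrier \<phi>. qf \<phi> v = qf \<psi> (f v)"
    using assms by (auto simp: isometric_iff)
  have "carrier \<psi> = f ` carrier \<phi>" using lin_isoD(4)[OF f(1)] by (simp add: bij_betw_def)
  with f(2) show ?thesis by (auto simp: image_iff)
qed

lemma isometric_anisotropic:
  assumes V: "module F \<phi>" and W: "module F \<psi>" and iso: "isometric F \<phi> \<psi>" and an: "anisotropic F \<psi>"
  shows "anisotropic F \<phi>"
proof -
  obtain f where f: "lin_iso F \<phi> \<psi> f" "\<forall>v\<in>carrier \<phi>. qf \<phi> v = qf \<psi> (f v)"
    using iso by (auto simp: isometric_iff)
  interpret V: module F \<phi> by fact
  have "v = \<zero>\<^bsub>\<phi>\<^esub>" if "v \<in> carrier \<phi>" "qf \<phi> v = \<zero>\<^bsub>F\<^esub>" for v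
  proof -
    have "f v = f \<zero>\<^bsub>\<phi>\<^esub>"
      using that f lin_isoD(1)[OF f(1)] an lin_iso_zero[OF V W f(1)] by (auto simp: anisotropic_def)
    then show ?thesis
      using that lin_isoD(4)[OF f(1)] by (auto simp: bij_betw_def dest: inj_onD)
  qed
  then show ?thesis by (auto simp: anisotropic_def)
qed

lemma ts_form_transport:
  assumes V: "vectorspace F \<phi>" and W: "ts_form F \<psi>" and iso: "isometric F \<phi> \<psi>"
  shows "ts_form F \<phi>" "vectorspace.dim F \<phi> = vectorspace.dim F \<psi>"
proof -
  interpret V: vectorspace F \<phi> by fact
  interpret W: ts_form F \<psi> by fact
  obtain f where f: "lin_iso F \<phi> \<psi> f" "\<forall>v\<in>carrier \<phi>. qf \<phi> v = qf \<psi> (f v)"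
    using iso by (auto simp: isometric_iff)
  note f' = lin_isoD[OF f(1)]
  note g = lin_iso_dim[OF W.vectorspace_axioms V lin_iso_inv[OF V.module_axioms f(1)] W.finite_dimensional]
  show "vectorspace.dim F \<phi> = vectorspace.dim F \<psi>" by (rule g)
  show "ts_form F \<phi>"
    by unfold_locales
      (use f f' g W.char_two in \<open>auto simp: W.qf_closed W.qf_smult W.qf_add\<close>)
qed

lemma diag_form_simps [simp]:
  assumes "ring F"
  shows "carrier (diag_form F n a) = tuples F n"
    "x \<oplus>\<^bsub>diag_form F n a\<^esub> y = (\<lambda>i\<in>{..<n}. x i \<oplus>\<^bsub>F\<^esub> y i)"
    "c \<odot>\<^bsub>diag_form F n a\<^esub> x = (\<lambda>i\<in>{..<n}. c \<otimes>\<^bsub>F\<^esub> x i)"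
    "\<zero>\<^bsub>diag_form F n a\<^esub> = (\<lambda>i\<in>{..<n}. \<zero>\<^bsub>F\<^esub>)"
    "qf (diag_form F n a) x = (\<Oplus>\<^bsub>F\<^esub>i\<in>{..<n}. a i \<otimes>\<^bsub>F\<^esub> x i [^]\<^bsub>F\<^esub> (2::nat))"
  using ring.func_space_simps[OF assms] by (simp_all add: diag_form_def)

lemma (in ring) vals_diag_form_cong:
  assumes "\<And>i. i < n \<Longrightarrow> f i = g i \<and> g i \<in> carrier R"
  shows "vals (diag_form R n f) = vals (diag_form R n g)"
proof -
  have "qf (diag_form R n f) x = qf (diag_form R n g) x" if x: "x \<in> tuples R n" for x
    using assms PiE_mem[OF x] by (auto simp: ring_axioms intro!: finsum_cong')
  then show ?thesis by (simp add: ring_axioms cong: image_cong)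
qed

lemma orth_sum_simps [simp]:
  "carrier (orth_sum F \<phi> \<psi>) = carrier \<phi> \<times> carrier \<psi>"
  "v \<oplus>\<^bsub>orth_sum F \<phi> \<psi>\<^esub> w = (fst v \<oplus>\<^bsub>\<phi>\<^esub> fst w, snd v \<oplus>\<^bsub>\<psi>\<^esub> snd w)"
  "c \<odot>\<^bsub>orth_sum F \<phi> \<psi>\<^esub> v = (c \<odot>\<^bsub>\<phi>\<^esub> fst v, c \<odot>\<^bsub>\<psi>\<^esub> snd v)"
  "qf (orth_sum F \<phi> \<psi>) v = qf \<phi> (fst v) \<oplus>\<^bsub>F\<^esub> qf \<psi> (snd v)"
  by (simp_all add: orth_sum_def direct_sum_def case_prod_beta)

lemma vectorspace_orth_sum:
  "vectorspace F \<phi> \<Longrightarrow> vectorspace F \<psi> \<Longrightarrow> vectorspace F (orth_sum F \<phi> \<psi>)"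
  unfolding orth_sum_def by (intro vectorspace_form_on direct_sum_is_vs)

lemma isometric_orth_sum:
  assumes "isometric F \<phi> \<psi>"
  shows "isometric F (orth_sum F \<phi> \<chi>) (orth_sum F \<psi> \<chi>)"
proof -
  obtain f where f: "lin_iso F \<phi> \<psi> f" "\<forall>v\<in>carrier \<phi>. qf \<phi> v = qf \<psi> (f v)"
    using assms by (auto simp: isometric_iff)
  have "lin_iso F (orth_sum F \<phi> \<chi>) (orth_sum F \<psi> \<chi>) (map_prod f id)"
    using lin_isoD[OF f(1)] bij_betw_map_prod[OF lin_isoD(4)[OF f(1)] bij_betw_id]
    by (intro lin_isoI) (auto simp: map_prod_def)
  with f(2) show ?thesis unfolding isometric_iff by (intro exI[of _ "map_prod f id"]) auto
qed

context ts_form begin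

lemma qf_zero [simp]: "qf \<phi> \<zero>\<^bsub>\<phi>\<^esub> = \<zero>\<^bsub>F\<^esub>"
proof -
  have "qf \<phi> (\<zero>\<^bsub>F\<^esub> \<odot>\<^bsub>\<phi>\<^esub> \<zero>\<^bsub>\<phi>\<^esub>) = \<zero>\<^bsub>F\<^esub> [^]\<^bsub>F\<^esub> (2::nat) \<otimes>\<^bsub>F\<^esub> qf \<phi> \<zero>\<^bsub>\<phi>\<^esub>"
    by (rule qf_smult) auto
  then show ?thesis by (simp add: qf_closed numeral_2_eq_2)
qed

lemma qf_finsum:
  "finite A \<Longrightarrow> f \<in> A \<rightarrow> carrier \<phi> \<Longrightarrow> qf \<phi> (finsum \<phi> f A) = (\<Oplus>\<^bsub>F\<^esub>i\<in>A. qf \<phi> (f i))"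
proof (induction A rule: finite_induct)
  case (insert i A)
  then have m: "f i \<in> carrier \<phi>" "f \<in> A \<rightarrow> carrier \<phi>" by auto
  moreover from this have "(\<lambda>i. qf \<phi> (f i)) \<in> A \<rightarrow> carrier F" "qf \<phi> (f i) \<in> carrier F"
    using qf_closed by auto
  ultimately  show ?case using insert by (simp add: qf_add M.finsum_closed)
qed simp

lemma qf_comb:
  assumes b: "b \<in> {..<n} \<rightarrow> carrier \<phi>" and x: "x \<in> tuples F n"
  shows "qf \<phi> (comb n b x) = qf (diag_form F n (\<lambda>i. qf \<phi> (b i))) x"
proof -
  have m: "b i \<in> carrier \<phi>" "x i \<in> carrier F" if "i < n" for i using b x that by auto
  have "qf \<phi> (comb n b x) = (\<Oplus>\<^bsub>F\<^esub>i\<in>{..<n}. qf \<phi> (x i \<odot>\<^bsub>\<phi>\<^esub> b i))"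
    unfolding comb_def using m by (intro qf_finsum) auto
  also have "\<dots> = (\<Oplus>\<^bsub>F\<^esub>i\<in>{..<n}. qf \<phi> (b i) \<otimes>\<^bsub>F\<^esub> x i [^]\<^bsub>F\<^esub> (2::nat))"
    using m by (intro R.finsum_cong') (auto simp: qf_smult qf_closed m_comm)
  finally show ?thesis by (simp add: is_ring)
qed

lemma add_self_vec: "v \<in> carrier \<phi> \<Longrightarrow> v \<oplus>\<^bsub>\<phi>\<^esub> v = \<zero>\<^bsub>\<phi>\<^esub>"
  using smult_l_distr[of "\<one>\<^bsub>F\<^esub>" "\<one>\<^bsub>F\<^esub>" v] char_two by simp

text \<open>In characteristic 2, \<open>\<phi>(v + w) = 0\<close> whenever \<open>\<phi>(v) = \<phi>(w)\<close>.\<close>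

lemma qf_inj_if_anisotropic:
  assumes an: "anisotropic F \<phi>" and vw: "v \<in> carrier \<phi>" "w \<in> carrier \<phi>" "qf \<phi> v = qf \<phi> w"
  shows "v = w"
proof -
  have "qf \<phi> v \<oplus>\<^bsub>F\<^esub> qf \<phi> v = \<zero>\<^bsub>F\<^esub>"
    using l_distr[of "\<one>\<^bsub>F\<^esub>" "\<one>\<^bsub>F\<^esub>" "qf \<phi> v"] char_two vw by (simp add: qf_closed)
  then have "v \<oplus>\<^bsub>\<phi>\<^esub> w = \<zero>\<^bsub>\<phi>\<^esub>"
    using an vw by (simp add: anisotropic_def qf_add)
  then have "v \<oplus>\<^bsub>\<phi>\<^esub> w = w \<oplus>\<^bsub>\<phi>\<^esub> w" using vw add_self_vec by simp
  then show ?thesis using vw by simp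
qed

lemma isometric_diag_form:
  "\<exists>b. b \<in> {..<dim} \<rightarrow> carrier \<phi> \<and> lin_iso F (func_space {..<dim}) \<phi> (comb dim b)
    \<and> isometric F (diag_form F dim (\<lambda>i. qf \<phi> (b i))) \<phi>"
proof -
  obtain b where b: "b \<in> {..<dim} \<rightarrow> carrier \<phi>" "lin_iso F (func_space {..<dim}) \<phi> (comb dim b)"
    using coordinates_exist[OF finite_dimensional] by blast
  have "lin_iso F (diag_form F dim (\<lambda>i. qf \<phi> (b i))) \<phi> (comb dim b)"
    using lin_isoD[OF b(2)] by (intro lin_isoI) (auto simp: is_ring)
  then have "isometric F (diag_form F dim (\<lambda>i. qf \<phi> (b i))) \<phi>"
    unfolding isometric_iff using qf_comb[OF b(1)] is_ring by (auto intro!: exI[of _ "comb dim b"])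
  with b show ?thesis by blast
qed

end

context field2 begin

lemma vectorspace_diag_form: "vectorspace F (diag_form F n a)"
  unfolding diag_form_def by (intro vectorspace_form_on func_space_vectorspace)

lemma ts_form_diag_form:
  assumes a: "a \<in> {..<n} \<rightarrow> carrier F"
  shows "ts_form F (diag_form F n a)" "vectorspace.dim F (diag_form F n a) = n"
proof -
  let ?D = "diag_form F n a"
  interpret D: vectorspace F ?D by (rule vectorspace_diag_form)
  have "lin_iso F (func_space {..<n}) ?D id"
    by (rule lin_isoI) (auto simp: ring_axioms)
  note d = dim_if_coordinates[OF vectorspace_diag_form this]
  show "vectorspace.dim F ?D = n" by (rule d)
  have am: "a i \<in> carrier F" if "i < n" for i using a that by auto
  show "ts_form F ?D"
  proof (unfold_locales, goal_cases)
    case 1 show ?case by (rule char2)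
  next
    case 2 show ?case by (rule d)
  next
    case (3 v)
    then have "v i \<in> carrier F" if "i < n" for i using that by (auto simp: ring_axioms)
    then have "(\<lambda>i. a i \<otimes> v i [^] (2::nat)) \<in> {..<n} \<rightarrow> carrier F" using am by auto
    then show ?case by (simp add: ring_axioms)
  next
    case (4 c v)
    then have m: "v i \<in> carrier F" if "i < n" for i using that by (auto simp: ring_axioms)
    have "qf ?D (c \<odot>\<^bsub>?D\<^esub> v) = (\<Oplus>i\<in>{..<n}. c [^] (2::nat) \<otimes> (a i \<otimes> v i [^] (2::nat)))"
      using m am 4 by (auto simp: ring_axioms square_mult m_lcomm intro!: finsum_cong')
    also have "\<dots> = c [^] (2::nat) \<otimes> qf ?D v"
      using m am 4 by (subst finsum_rdistr[symmetric]) (auto simp: ring_axioms)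
    finally show ?case .
  next
    case (5 v w)
    then have m: "v i \<in> carrier F" "w i \<in> carrier F" if "i < n" for i
      using that by (auto simp: ring_axioms)
    have "qf ?D (v \<oplus>\<^bsub>?D\<^esub> w) = (\<Oplus>i\<in>{..<n}. a i \<otimes> (v i \<oplus> w i) [^] (2::nat))"
      using m am by (auto simp: ring_axioms intro!: finsum_cong')
    also have "\<dots> = (\<Oplus>i\<in>{..<n}. a i \<otimes> v i [^] (2::nat) \<oplus> a i \<otimes> w i [^] (2::nat))"
      by (rule finsum_cong') (simp_all add: m am square_add r_distr)
    also have "\<dots> = qf ?D v \<oplus> qf ?D w"
      using m am by (subst finsum_addf) (auto simp: ring_axioms)
    finally show ?case .
  qed
qed

lemma qf_zero_form [simp]:
  assumes "x \<in> tuples F k"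
  shows "qf (zero_form F k) x = \<zero>"
proof -
  have m: "x i \<in> carrier F" if "i < k" for i using assms that by auto
  have "(\<Oplus>i\<in>{..<k}. \<zero> \<otimes> x i [^] (2::nat)) = (\<Oplus>i\<in>{..<k}. \<zero>)"
    by (rule finsum_cong') (simp_all add: m)
  then show ?thesis by (simp add: ring_axioms)
qed

lemma values_orth_sum_zero_form:
  assumes "ts_form F \<chi>"
  shows "vals (orth_sum F \<chi> (zero_form F k))
    = vals \<chi>"
proof -
  interpret \<chi>: ts_form F \<chi> by fact
  have eq: "qf (orth_sum F \<chi> (zero_form F k)) (v, x) = qf \<chi> v"
    if "v \<in> carrier \<chi>" "x \<in> tuples F k" for v x
    using that by (simp add: \<chi>.qf_closed)
  have z: "(\<lambda>i\<in>{..<k}. \<zero>) \<in> tuples F k" by auto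
  show ?thesis
  proof (intro equalityI subsetI)
    fix y assume "y \<in> vals \<chi>"
    then obtain v where "v \<in> carrier \<chi>" "y = qf \<chi> v" by auto
    then have "y = qf (orth_sum F \<chi> (zero_form F k)) (v, \<lambda>i\<in>{..<k}. \<zero>)" using eq[OF _ z] by simp
    moreover have "(v, \<lambda>i\<in>{..<k}. \<zero>) \<in> carrier (orth_sum F \<chi> (zero_form F k))"
      using \<open>v \<in> carrier \<chi>\<close> z by (simp add: ring_axioms)
    ultimately show "y \<in> vals (orth_sum F \<chi> (zero_form F k))"
      by blast
  next
    fix y assume "y \<in> vals (orth_sum F \<chi> (zero_form F k))"
    then obtain v x where "v \<in> carrier \<chi>" "x \<in> tuples F k"
        "y = qf (orth_sum F \<chi> (zero_form F k)) (v, x)"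
      by (auto simp: ring_axioms simp del: orth_sum_simps(4))
    with eq show "y \<in> vals \<chi>" by auto
  qed
qed

lemma dim_orth_sum_zero_form:
  assumes V: "vectorspace F \<chi>" and fd: "vectorspace.fin_dim F \<chi>"
  shows "vectorspace.dim F (orth_sum F \<chi> (zero_form F k)) = vectorspace.dim F \<chi> + k"
    "vectorspace.fin_dim F (orth_sum F \<chi> (zero_form F k))"
proof -
  interpret V: vectorspace F \<chi> by fact
  let ?e = "vectorspace.dim F \<chi>" and ?Z = "zero_form F k"
  let ?S = "orth_sum F \<chi> ?Z" and ?P = "orth_sum F (diag_form F ?e (\<lambda>_. \<zero>)) ?Z"
  obtain b where f: "lin_iso F (func_space {..<?e}) \<chi> (V.comb ?e b)"
    using V.coordinates_exist[OF fd] by blast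
  let ?f = "V.comb ?e b"
  note f' = lin_isoD[OF f]
  let ?s = "\<lambda>x. (restrict x {..<?e}, \<lambda>i\<in>{..<k}. x (?e + i))"
  let ?j = "\<lambda>(y, z). \<lambda>i\<in>{..<?e + k}. if i < ?e then y i else z (i - ?e)"
  have bij: "bij_betw ?s (tuples F (?e + k)) (tuples F ?e \<times> tuples F k)"
  proof (rule bij_betw_byWitness[where f' = ?j])
    show "\<forall>x\<in>tuples F (?e + k). ?j (?s x) = x"
      by (auto simp: fun_eq_iff PiE_def extensional_def)
    show "\<forall>x\<in>tuples F ?e \<times> tuples F k. ?s (?j x) = x"
    proof
      fix x assume "x \<in> tuples F ?e \<times> tuples F k"
      then obtain y z where x: "x = (y, z)" and yz: "y \<in> tuples F ?e" "z \<in> tuples F k" by auto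
      have "restrict (?j (y, z)) {..<?e} = y"
        using yz(1) by (auto simp: fun_eq_iff PiE_def extensional_def)
      moreover have "(\<lambda>i\<in>{..<k}. ?j (y, z) (?e + i)) = z"
        using yz(2) by (auto simp: fun_eq_iff PiE_def extensional_def)
      ultimately show "?s (?j x) = x" unfolding x by (simp only:)
    qed
    show "?s ` tuples F (?e + k) \<subseteq> tuples F ?e \<times> tuples F k"
    proof (rule image_subsetI)
      fix x assume x: "x \<in> tuples F (?e + k)"
      have "x i \<in> carrier F" if "i < ?e + k" for i using PiE_mem[OF x] that by simp
      then show "?s x \<in> tuples F ?e \<times> tuples F k" by (simp add: restrict_PiE_iff)
    qed
    show "?j ` (tuples F ?e \<times> tuples F k) \<subseteq> tuples F (?e + k)"
    proof
      fix x assume "x \<in> ?j ` (tuples F ?e \<times> tuples F k)"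
      then obtain y z where x: "x = ?j (y, z)" and yz: "y \<in> tuples F ?e" "z \<in> tuples F k" by auto
      have "y i \<in> carrier F" if "i < ?e" for i using PiE_mem[OF yz(1)] that by simp
      moreover have "z (i - ?e) \<in> carrier F" if "\<not> i < ?e" "i < ?e + k" for i
        using PiE_mem[OF yz(2), of "i - ?e"] that by simp
      ultimately show "x \<in> tuples F (?e + k)" unfolding x by (simp add: restrict_PiE_iff)
    qed
  qed
  have "lin_iso F (func_space {..<?e + k}) ?P ?s"
  proof (rule lin_isoI)
    show "?s x \<in> carrier ?P" if "x \<in> carrier (func_space {..<?e + k})" for x
      using bij_betw_apply[OF bij, of x] that by (simp add: ring_axioms)
    show "bij_betw ?s (carrier (func_space {..<?e + k})) (carrier ?P)"
      using bij by (simp add: ring_axioms)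
  qed (auto simp: ring_axioms fun_eq_iff)
  moreover have "lin_iso F ?P ?S (map_prod ?f id)"
  proof (rule lin_isoI)
    show "bij_betw (map_prod ?f id) (carrier ?P) (carrier ?S)"
      using bij_betw_map_prod[OF f'(4) bij_betw_id, of "tuples F k"] by (simp add: ring_axioms)
  qed (use f'(1-3) in \<open>auto simp: ring_axioms\<close>)
  ultimately have iso: "lin_iso F (func_space {..<?e + k}) ?S (map_prod ?f id \<circ> ?s)"
    by (rule lin_iso_comp)
  note d = dim_if_coordinates[OF vectorspace_orth_sum[OF V vectorspace_diag_form] iso]
  show "vectorspace.dim F ?S = ?e + k" "vectorspace.fin_dim F ?S" by (rule d)+
qed

lemma diag_form_unit_vector:
  assumes a: "a \<in> {..<d} \<rightarrow> carrier F" and i: "i < d"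
  shows "a i \<in> vals (diag_form F d a)"
proof (rule image_eqI)
  let ?e = "\<lambda>j\<in>{..<d}. if i = j then \<one> else \<zero>"
  show "?e \<in> carrier (diag_form F d a)" by (auto simp: ring_axioms)
  have am: "a j \<in> carrier F" if "j < d" for j using a that by auto
  have "qf (diag_form F d a) ?e = (\<Oplus>j\<in>{..<d}. if i = j then a j else \<zero>)"
    using am by (auto simp: ring_axioms square_eq intro!: finsum_cong')
  also have "\<dots> = a i" using am i by (intro finsum_singleton) auto
  finally show "a i = qf (diag_form F d a) ?e" by simp
qed

text \<open>
  The vectors on which \<open>\<phi>\<close> vanishes form a subspace \<open>N\<close>, because \<open>\<phi>\<close> is additive. Vectors \<open>c i\<close> with
  \<open>\<phi>(c i) = a i\<close> span a complement of \<open>N\<close>: for every \<open>v\<close> some combination \<open>x\<close> of them has the value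
  \<open>\<phi>(v)\<close>, and then \<open>v - x\<close> is in \<open>N\<close>. The last claim is there because the defect is defined through
  anisotropic parts with vectors of the same type as those of \<open>\<phi>\<close>.
\<close>

lemma normal_form:
  fixes \<phi> :: "('a, 'v) qform"
  assumes ts: "ts_form F \<phi>" and a: "a \<in> {..<d} \<rightarrow> carrier F"
    and an: "anisotropic F (diag_form F d a)"
    and vals: "vals \<phi> = vals (diag_form F d a)"
  shows "d \<le> vectorspace.dim F \<phi>"
    and "isometric F \<phi> (orth_sum F (diag_form F d a) (zero_form F (vectorspace.dim F \<phi> - d)))"
    and "\<exists>\<chi> :: ('a, 'v) qform. ts_form F \<chi> \<and> anisotropic F \<chi> \<and> isometric F (diag_form F d a) \<chi>"
proof -
  let ?D = "diag_form F d a"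
  interpret \<phi>: ts_form F \<phi> by fact
  interpret D: ts_form F ?D by (rule ts_form_diag_form[OF a])
  have Dc: "carrier ?D = tuples F d" by (simp add: ring_axioms)
  have "\<exists>v\<in>carrier \<phi>. qf \<phi> v = a i" if "i < d" for i
    using diag_form_unit_vector[OF a that] unfolding vals[symmetric] by (metis imageE)
  then obtain c where c: "\<And>i. i < d \<Longrightarrow> c i \<in> carrier \<phi> \<and> qf \<phi> (c i) = a i" by metis
  then have cc: "c \<in> {..<d} \<rightarrow> carrier \<phi>" by auto
  let ?g = "\<phi>.comb d c"
  have hom: "mod_hom F (func_space {..<d}) \<phi> ?g"
    using \<phi>.comb_hom[OF cc] func_space_is_module \<phi>.module_axioms
    by (simp add: mod_hom_def mod_hom_axioms_def)
  interpret g: mod_hom F "func_space {..<d}" \<phi> ?g by (rule hom)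
  have qg: "qf \<phi> (?g x) = qf ?D x" if "x \<in> carrier ?D" for x
  proof -
    have "qf (diag_form F d (\<lambda>i. qf \<phi> (c i))) x = qf ?D x"
      using that c a by (auto simp: ring_axioms intro!: finsum_cong')
    then show ?thesis using \<phi>.qf_comb[OF cc] that Dc by simp
  qed
  have gc: "?g x \<in> carrier \<phi>" if "x \<in> carrier ?D" for x using g.f_im that Dc by auto
  have gadd: "?g (x \<oplus>\<^bsub>?D\<^esub> y) = ?g x \<oplus>\<^bsub>\<phi>\<^esub> ?g y" if "x \<in> carrier ?D" "y \<in> carrier ?D" for x y
    using g.f_add[of x y] that by (simp add: ring_axioms)
  have gsmult: "?g (r \<odot>\<^bsub>?D\<^esub> x) = r \<odot>\<^bsub>\<phi>\<^esub> ?g x" if "r \<in> carrier F" "x \<in> carrier ?D" for r x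
    using g.f_smult[of r x] that by (simp add: ring_axioms)
  have ginj: "inj_on ?g (carrier ?D)"
  proof (rule inj_onI)
    fix x y assume xy: "x \<in> carrier ?D" "y \<in> carrier ?D" "?g x = ?g y"
    have "qf ?D x = qf ?D y" using qg[OF xy(1)] qg[OF xy(2)] xy(3) by (simp only:)
    then show "x = y" by (rule D.qf_inj_if_anisotropic[OF an xy(1,2)])
  qed
  define \<chi> where "\<chi> = \<phi>\<lparr>carrier := ?g ` carrier ?D\<rparr>"
  have "subspace F (?g ` carrier ?D) \<phi>"
    using g.im_is_submodule \<phi>.vectorspace_axioms Dc by (simp add: subspace_def g.im_def)
  then have \<chi>v: "vectorspace F \<chi>" unfolding \<chi>_def by (rule \<phi>.subspace_is_vs)
  have iso_\<chi>: "isometric F ?D \<chi>"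
    unfolding isometric_iff
  proof (intro exI conjI ballI)
    show "lin_iso F ?D \<chi> ?g"
      by (rule lin_isoI) (use gadd gsmult ginj in \<open>auto simp: \<chi>_def bij_betw_def\<close>)
    show "qf ?D x = qf \<chi> (?g x)" if "x \<in> carrier ?D" for x using qg[OF that] by (simp add: \<chi>_def)
  qed
  have iso_\<chi>': "isometric F \<chi> ?D" by (rule isometric_sym[OF D.module_axioms iso_\<chi>])
  have "ts_form F \<chi>" by (rule ts_form_transport(1)[OF \<chi>v D.ts_form_axioms iso_\<chi>'])
  moreover have "anisotropic F \<chi>"
    using \<chi>v by (intro isometric_anisotropic[OF _ D.module_axioms iso_\<chi>' an]) (simp add: vectorspace_def)
  ultimately show "\<exists>\<chi> :: ('a, 'v) qform. ts_form F \<chi> \<and> anisotropic F \<chi> \<and> isometric F ?D \<chi>"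
    using iso_\<chi> by blast
  define N where "N = {v \<in> carrier \<phi>. qf \<phi> v = \<zero>}"
  have "submodule F N \<phi>"
    by (rule submodule.intro) (auto simp: N_def \<phi>.module_axioms \<phi>.qf_add \<phi>.qf_smult)
  then have N: "subspace F N \<phi>" by (simp add: subspace_def \<phi>.vectorspace_axioms)
  interpret N: vectorspace F "\<phi>.vs N" by (rule \<phi>.subspace_is_vs[OF N])
  define k where "k = N.dim"
  obtain b where b: "lin_iso F (func_space {..<k}) (\<phi>.vs N) (N.comb k b)"
    using N.coordinates_exist[OF \<phi>.subspace_fin_dim[OF \<phi>.finite_dimensional N]] by (auto simp: k_def)
  let ?n = "N.comb k b" and ?Z = "zero_form F k"
  note n = lin_isoD[OF b]
  have Zc: "carrier ?Z = tuples F k" by (simp add: ring_axioms)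
  have nc: "?n y \<in> N" "?n y \<in> carrier \<phi>" "qf \<phi> (?n y) = \<zero>" if "y \<in> carrier ?Z" for y
    using n(1)[of y] that Zc by (auto simp: N_def)
  let ?S = "orth_sum F ?D ?Z" and ?f = "\<lambda>p. ?g (fst p) \<oplus>\<^bsub>\<phi>\<^esub> ?n (snd p)"
  have Sv: "vectorspace F ?S" by (intro vectorspace_orth_sum vectorspace_diag_form)
  have q: "qf \<phi> (?f p) = qf ?S p" if "p \<in> carrier ?S" for p
    using that qg nc gc by (auto simp: \<phi>.qf_add Zc simp del: diag_form_simps)
  have "lin_iso F ?S \<phi> ?f"
  proof (rule lin_isoI)
    show "?f p \<in> carrier \<phi>" if "p \<in> carrier ?S" for p
      using that gc nc by (auto simp del: diag_form_simps)
    show "?f (p \<oplus>\<^bsub>?S\<^esub> p') = ?f p \<oplus>\<^bsub>\<phi>\<^esub> ?f p'" if "p \<in> carrier ?S" "p' \<in> carrier ?S" for p p'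
    proof -
      obtain x y x' y' where p: "p = (x, y)" "p' = (x', y')" by fastforce
      then have m: "x \<in> carrier ?D" "x' \<in> carrier ?D" "y \<in> carrier ?Z" "y' \<in> carrier ?Z"
        using that by (auto simp del: diag_form_simps)
      have "?n (y \<oplus>\<^bsub>?Z\<^esub> y') = ?n y \<oplus>\<^bsub>\<phi>\<^esub> ?n y'"
        using n(2)[of y y'] m Zc by (simp add: ring_axioms)
      then show ?thesis
        using gadd[OF m(1,2)] gc m nc unfolding p by (simp add: \<phi>.M.a_ac del: diag_form_simps)
    qed
    show "?f (r \<odot>\<^bsub>?S\<^esub> p) = r \<odot>\<^bsub>\<phi>\<^esub> ?f p" if "r \<in> carrier F" "p \<in> carrier ?S" for r p
    proof -
      obtain x y where p: "p = (x, y)" by fastforce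
      then have m: "x \<in> carrier ?D" "y \<in> carrier ?Z"
        using that by (auto simp del: diag_form_simps)
      have "?n (r \<odot>\<^bsub>?Z\<^esub> y) = r \<odot>\<^bsub>\<phi>\<^esub> ?n y"
        using n(3)[of r y] m that Zc by (simp add: ring_axioms)
      then show ?thesis
        using gsmult[OF that(1) m(1)] gc m nc that(1) unfolding p
        by (simp add: \<phi>.smult_r_distr del: diag_form_simps)
    qed
    show "bij_betw ?f (carrier ?S) (carrier \<phi>)"
    proof (rule bij_betw_imageI)
      show "inj_on ?f (carrier ?S)"
      proof (rule inj_onI)
        fix p p' assume pp: "p \<in> carrier ?S" "p' \<in> carrier ?S" "?f p = ?f p'"
        obtain x y x' y' where p: "p = (x, y)" "p' = (x', y')" by fastforce
        then have m: "x \<in> carrier ?D" "x' \<in> carrier ?D" "y \<in> carrier ?Z" "y' \<in> carrier ?Z"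
          using pp by (auto simp del: diag_form_simps)
        have "qf ?D z = qf \<phi> (?f (z, w))" if "z \<in> carrier ?D" "w \<in> carrier ?Z" for z w
          using that qg nc gc by (simp add: \<phi>.qf_add D.qf_closed del: diag_form_simps)
        then have "qf ?D x = qf ?D x'" using m pp(3) unfolding p by metis
        then have x: "x = x'" using D.qf_inj_if_anisotropic[OF an m(1,2)] by simp
        then have "?n y = ?n y'" using pp(3) m gc nc unfolding p by simp
        then have "y = y'" using n(4) m Zc by (auto simp: bij_betw_def dest: inj_onD)
        with x show "p = p'" by (simp add: p)
      qed
      show "?f ` carrier ?S = carrier \<phi>"
      proof (intro equalityI subsetI)
        fix v assume v: "v \<in> carrier \<phi>"
        then obtain x where x: "x \<in> carrier ?D" "qf \<phi> v = qf ?D x" using vals by blast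
        let ?w = "v \<oplus>\<^bsub>\<phi>\<^esub> ?g x"
        have wN: "?w \<in> N"
          using v x gc qg add_self[OF D.qf_closed[OF x(1)]]
          by (simp add: N_def \<phi>.qf_add del: diag_form_simps)
        have "?n ` carrier ?Z = N" using n(4) Zc by (simp add: bij_betw_def)
        with wN have "?w \<in> ?n ` carrier ?Z" by (simp only:)
        then obtain y where y: "?w = ?n y" "y \<in> carrier ?Z" by (rule imageE)
        have "?f (x, y) = v \<oplus>\<^bsub>\<phi>\<^esub> (?g x \<oplus>\<^bsub>\<phi>\<^esub> ?g x)"
          using x v gc unfolding fst_conv snd_conv y(1)[symmetric] by (simp add: \<phi>.M.a_ac)
        also have "\<dots> = v" using x v gc \<phi>.add_self_vec by simp
        finally show "v \<in> ?f ` carrier ?S"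
          using x y by (intro image_eqI[of _ _ "(x, y)"]) (simp_all del: diag_form_simps)
      qed (use gc nc in \<open>auto simp del: diag_form_simps\<close>)
    qed
  qed
  moreover note S = dim_orth_sum_zero_form[OF D.vectorspace_axioms D.finite_dimensional, of k]
  ultimately have "\<phi>.dim = d + k"
    using lin_iso_dim(2)[OF Sv \<phi>.vectorspace_axioms _ S(2)] ts_form_diag_form(2)[OF a] by simp
  moreover have "isometric F ?S \<phi>"
    unfolding isometric_iff using \<open>lin_iso F ?S \<phi> ?f\<close> q by (intro exI[of _ ?f]) simp
  then have "isometric F \<phi> ?S"
    by (rule isometric_sym[OF vectorspace.axioms(1)[OF Sv]])
  ultimately show "d \<le> \<phi>.dim" "isometric F \<phi> (orth_sum F ?D (zero_form F (\<phi>.dim - d)))"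
    by simp_all
qed

lemma same_values_same_length:
  assumes "a \<in> {..<d} \<rightarrow> carrier F" "anisotropic F (diag_form F d a)"
    "b \<in> {..<e} \<rightarrow> carrier F" "anisotropic F (diag_form F e b)"
    "vals (diag_form F d a) = vals (diag_form F e b)"
  shows "d = e"
  using normal_form(1)[OF ts_form_diag_form(1)[OF assms(1)] assms(3,4,5)]
    normal_form(1)[OF ts_form_diag_form(1)[OF assms(3)] assms(1,2) assms(5)[symmetric]]
    ts_form_diag_form(2)[OF assms(1)] ts_form_diag_form(2)[OF assms(3)] by simp

lemma anisotropic_diagonalization:
  assumes ts: "ts_form F \<chi>" and an: "anisotropic F \<chi>"
  shows "\<exists>b \<in> {..<vectorspace.dim F \<chi>} \<rightarrow> carrier F.
    anisotropic F (diag_form F (vectorspace.dim F \<chi>) b) \<and>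
    vals \<chi> = vals (diag_form F (vectorspace.dim F \<chi>) b)"
proof -
  interpret \<chi>: ts_form F \<chi> by fact
  obtain b where b: "b \<in> {..<\<chi>.dim} \<rightarrow> carrier \<chi>"
      "isometric F (diag_form F \<chi>.dim (\<lambda>i. qf \<chi> (b i))) \<chi>"
    using \<chi>.isometric_diag_form by blast
  let ?D = "diag_form F \<chi>.dim (\<lambda>i. qf \<chi> (b i))"
  have "module F ?D" using vectorspace_diag_form by (simp add: vectorspace_def)
  then have "anisotropic F ?D" using isometric_anisotropic[OF _ \<chi>.module_axioms b(2) an] by simp
  moreover have "(\<lambda>i. qf \<chi> (b i)) \<in> {..<\<chi>.dim} \<rightarrow> carrier F" using b(1) \<chi>.qf_closed by auto
  ultimately show ?thesis using isometric_values[OF b(2)] by (intro bexI[of _ "\<lambda>i. qf \<chi> (b i)"]) auto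
qed

text \<open>
  An anisotropic part has the same values as the whole form, so its diagonalization is an
  anisotropic diagonal form with these values, and all such forms have the same length.
\<close>

lemma defect_eq:
  fixes \<phi> :: "('a, 'v) qform"
  assumes ts: "ts_form F \<phi>" and a: "a \<in> {..<d} \<rightarrow> carrier F"
    and an: "anisotropic F (diag_form F d a)"
    and vals: "vals \<phi> = vals (diag_form F d a)"
  shows "d + defect F \<phi> = vectorspace.dim F \<phi>"
proof -
  note nf = normal_form[OF ts a an vals]
  interpret \<phi>: ts_form F \<phi> by fact
  have "defect F \<phi> = \<phi>.dim - d"
    unfolding defect_def
  proof (rule the_equality)
    obtain \<chi> :: "('a, 'v) qform"
      where "ts_form F \<chi>" "anisotropic F \<chi>" "isometric F (diag_form F d a) \<chi>"
      using nf(3) by blast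
    then have "anisotropic_decomp F \<phi> \<chi> (\<phi>.dim - d)"
      unfolding anisotropic_decomp_def
      using isometric_trans[OF nf(2) isometric_orth_sum] by blast
    then show "\<exists>\<chi> :: ('a, 'v) qform. anisotropic_decomp F \<phi> \<chi> (\<phi>.dim - d)" by blast
  next
    fix k assume "\<exists>\<chi> :: ('a, 'v) qform. anisotropic_decomp F \<phi> \<chi> k"
    then obtain \<chi> :: "('a, 'v) qform" where \<chi>: "ts_form F \<chi>" "anisotropic F \<chi>" "isometric F \<phi> (orth_sum F \<chi> (zero_form F k))"
      by (auto simp: anisotropic_decomp_def)
    interpret \<chi>: ts_form F \<chi> by fact
    obtain b where b: "b \<in> {..<\<chi>.dim} \<rightarrow> carrier F" "anisotropic F (diag_form F \<chi>.dim b)"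
        "vals \<chi> = vals (diag_form F \<chi>.dim b)"
      using anisotropic_diagonalization[OF \<chi>(1,2)] by blast
    have "vals \<phi> = vals \<chi>"
      using isometric_values[OF \<chi>(3)] values_orth_sum_zero_form[OF \<chi>(1)] by simp
    then have "d = \<chi>.dim"
      using same_values_same_length[OF a an b(1,2)] b(3) vals by simp
    moreover obtain f where "lin_iso F \<phi> (orth_sum F \<chi> (zero_form F k)) f"
      using \<chi>(3) by (auto simp: isometric_iff)
    then have "vectorspace.dim F (orth_sum F \<chi> (zero_form F k)) = \<phi>.dim"
      using lin_iso_dim(2)[OF \<phi>.vectorspace_axioms vectorspace_orth_sum[OF \<chi>.vectorspace_axioms
        vectorspace_diag_form] _ \<phi>.finite_dimensional] by blast
    ultimately show "k = \<phi>.dim - d"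
      using dim_orth_sum_zero_form(1)[OF \<chi>.vectorspace_axioms \<chi>.finite_dimensional, of k] by simp
  qed
  with nf(1) show ?thesis by simp
qed

lemma combine_eq_finsum:
  "length Ks = length Us \<Longrightarrow> set Ks \<subseteq> carrier F \<Longrightarrow> set Us \<subseteq> carrier F \<Longrightarrow>
    combine Ks Us = (\<Oplus>i\<in>{..<length Us}. Us ! i \<otimes> Ks ! i)"
proof (induction Ks Us rule: list_induct2)
  case (Cons k Ks u Us)
  have m: "Us ! i \<otimes> Ks ! i \<in> carrier F" if "i < length Us" for i
    using Cons.prems Cons.hyps that nth_mem[of i Us] nth_mem[of i Ks] by (intro m_closed) auto
  have "(\<Oplus>i\<in>{..<length (u # Us)}. (u # Us) ! i \<otimes> (k # Ks) ! i)
      = (\<Oplus>i\<in>insert 0 (Suc ` {..<length Us}). (u # Us) ! i \<otimes> (k # Ks) ! i)"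
    by (simp add: lessThan_Suc_eq_insert_0)
  also have "\<dots> = u \<otimes> k \<oplus> (\<Oplus>i\<in>Suc ` {..<length Us}. (u # Us) ! i \<otimes> (k # Ks) ! i)"
    using m Cons.prems by (subst finsum_insert) auto
  also have "(\<Oplus>i\<in>Suc ` {..<length Us}. (u # Us) ! i \<otimes> (k # Ks) ! i) = combine Ks Us"
    using m Cons.IH Cons.prems by (subst finsum_reindex) auto
  finally show ?case using Cons.prems m_comm by simp
qed simp

text \<open>
  Since \<open>qf\<close> takes the value \<open>\<Sum> x\<^sub>i\<^sup>2 u\<^sub>i\<close> at \<open>x\<close>, isotropic vectors are linear dependences between the
  entries over \<open>F\<^sup>2\<close>.
\<close>

lemma diag_form_list:
  assumes us: "set us \<subseteq> carrier F"
  shows "qf (diag_form F (length us) ((!) us)) ` carrier (diag_form F (length us) ((!) us))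
      = Span (squares F) us"
    and "independent (squares F) us \<Longrightarrow> anisotropic F (diag_form F (length us) ((!) us))"
proof -
  let ?n = "length us"
  let ?D = "diag_form F ?n ((!) us)"
  define sq where "sq x = map (\<lambda>i. x i [^] (2::nat)) [0..<?n]" for x :: "nat \<Rightarrow> 'a"
  have q: "qf ?D x = combine (sq x) us" "set (sq x) \<subseteq> squares F" "length (sq x) = ?n"
    if x: "x \<in> carrier ?D" for x
  proof -
    have m: "x i \<in> carrier F" if "i < ?n" for i using x that by (auto simp: ring_axioms)
    then show "set (sq x) \<subseteq> squares F" "length (sq x) = ?n" by (auto simp: sq_def)
    then have "combine (sq x) us = (\<Oplus>i\<in>{..<?n}. us ! i \<otimes> sq x ! i)"
      using us squares_in_carrier by (intro combine_eq_finsum) auto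
    also have "\<dots> = qf ?D x"
      using subsetD[OF us nth_mem] m by (auto simp: ring_axioms sq_def intro!: finsum_cong')
    finally show "qf ?D x = combine (sq x) us" by simp
  qed
  show "vals ?D = Span (squares F) us"
  proof (intro equalityI subsetI)
    fix y assume "y \<in> vals ?D"
    with q show "y \<in> Span (squares F) us"
      unfolding Span_eq_combine_set[OF subfield_squares us] by blast
  next
    fix y assume "y \<in> Span (squares F) us"
    then obtain Ks where Ks: "set Ks \<subseteq> squares F" "length Ks = ?n" "y = combine Ks us"
      using Span_mem_iff_length_version[OF subfield_squares us] by blast
    have "\<forall>i<?n. \<exists>x\<in>carrier F. Ks ! i = x [^] (2::nat)"
      using Ks(1,2) nth_mem[of _ Ks] by (fastforce simp: squares_def)
    then obtain x where x: "\<And>i. i < ?n \<Longrightarrow> x i \<in> carrier F \<and> Ks ! i = x i [^] (2::nat)" by metis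
    let ?x = "restrict x {..<?n}"
    have "?x \<in> carrier ?D" using x by (simp add: ring_axioms restrict_PiE_iff)
    moreover have "sq ?x = Ks" using x Ks(2) by (auto simp: sq_def intro!: nth_equalityI)
    ultimately show "y \<in> vals ?D" using q(1)[of ?x] Ks(3) by (intro image_eqI[of _ _ ?x]) auto
  qed
  assume ind: "independent (squares F) us"
  show "anisotropic F ?D"
    unfolding anisotropic_def
  proof (intro ballI impI)
    fix x assume x: "x \<in> carrier ?D" "qf ?D x = \<zero>"
    then have "set (sq x) \<subseteq> {\<zero>}"
      using independent_imp_trivial_combine[OF subfield_squares ind q(2)[OF x(1)]] q(1,3)[OF x(1)] by simp
    then have z: "x i [^] (2::nat) = \<zero>" if "i < ?n" for i using that by (force simp: sq_def)
    have m: "x i \<in> carrier F" if "i < ?n" for i using x that by (auto simp: ring_axioms)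
    have "x i = \<zero>" if "i < ?n" for i using z[OF that] m[OF that] by simp
    then show "x = \<zero>\<^bsub>?D\<^esub>" using x(1) by (auto simp: ring_axioms fun_eq_iff PiE_def extensional_def)
  qed
qed

lemma value_basis:
  assumes ts: "ts_form F \<phi>"
  shows "\<exists>us. independent (squares F) us \<and> Span (squares F) us = vals \<phi>"
proof -
  interpret \<phi>: ts_form F \<phi> by fact
  obtain b where b: "b \<in> {..<\<phi>.dim} \<rightarrow> carrier \<phi>" "isometric F (diag_form F \<phi>.dim (\<lambda>i. qf \<phi> (b i))) \<phi>"
    using \<phi>.isometric_diag_form by blast
  let ?vs = "map (\<lambda>i. qf \<phi> (b i)) [0..<\<phi>.dim]"
  have vs: "set ?vs \<subseteq> carrier F" using b(1) by (auto intro!: \<phi>.qf_closed)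
  have "vals (diag_form F \<phi>.dim (\<lambda>i. qf \<phi> (b i))) = vals (diag_form F \<phi>.dim ((!) ?vs))"
    by (rule vals_diag_form_cong) (use vs in auto)
  then have "vals \<phi> = Span (squares F) ?vs"
    using isometric_values[OF b(2)] diag_form_list(1)[OF vs] by simp
  moreover obtain us where "independent (squares F) us" "Span (squares F) us = Span (squares F) ?vs"
    using filter_base[OF subfield_squares vs] by metis
  ultimately show ?thesis by metis
qed

text \<open>Both forms have the same normal form, with an \<open>F\<^sup>2\<close>-basis of the common values as entries.\<close>

lemma isometric_if_same_values:
  assumes \<phi>: "ts_form F \<phi>" and \<psi>: "ts_form F \<psi>"
    and dim: "vectorspace.dim F \<phi> = vectorspace.dim F \<psi>"
    and vals: "vals \<phi> = vals \<psi>"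
  shows "isometric F \<phi> \<psi>"
proof -
  obtain us where us: "independent (squares F) us" "Span (squares F) us = vals \<phi>"
    using value_basis[OF \<phi>] by blast
  have usc: "set us \<subseteq> carrier F" by (rule independent_in_carrier[OF us(1)])
  then have a: "(!) us \<in> {..<length us} \<rightarrow> carrier F" by auto
  note d = diag_form_list(1)[OF usc] and an = diag_form_list(2)[OF usc us(1)]
  have "isometric F \<phi> (orth_sum F (diag_form F (length us) ((!) us))
      (zero_form F (vectorspace.dim F \<phi> - length us)))"
    using normal_form(2)[OF \<phi> a an] d us by simp
  moreover have "isometric F \<psi> (orth_sum F (diag_form F (length us) ((!) us))
      (zero_form F (vectorspace.dim F \<phi> - length us)))"
    using normal_form(2)[OF \<psi> a an] d us vals dim by simp
  moreover have "module F \<psi>" using \<psi> by (simp add: ts_form_def vectorspace_def)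
  ultimately show ?thesis using isometric_sym isometric_trans by blast
qed

end

lemma finsum_form_on [simp]: "finsum (form_on V q) f A = finsum V f A"
proof -
  have "add (form_on V q) = add V" by (intro ext) (rule form_on_simps(3))
  then show ?thesis by (simp add: finsum_def finprod_def)
qed

section \<open>Extension of scalars\<close>

lemma free_module_simps [simp]:
  "carrier (free_module E S) = {f. (\<forall>v. f v \<in> carrier E) \<and> (\<forall>v. v \<notin> S \<longrightarrow> f v = \<zero>\<^bsub>E\<^esub>)
    \<and> finite {v. f v \<noteq> \<zero>\<^bsub>E\<^esub>}}"
  "\<zero>\<^bsub>free_module E S\<^esub> = (\<lambda>v. \<zero>\<^bsub>E\<^esub>)"
  "f \<oplus>\<^bsub>free_module E S\<^esub> g = (\<lambda>v. f v \<oplus>\<^bsub>E\<^esub> g v)"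
  "c \<odot>\<^bsub>free_module E S\<^esub> f = (\<lambda>v. c \<otimes>\<^bsub>E\<^esub> f v)"
  by (simp_all add: free_module_def)

definition support where
  "support E f = {v. f v \<noteq> \<zero>\<^bsub>E\<^esub>}"

context cring begin

lemma free_module_is_module: "module R (free_module R S)"
proof (rule module_criteria)
  let ?M = "free_module R S"
  have add: "finite {v. f v \<oplus> g v \<noteq> \<zero>}" if "f \<in> carrier ?M" "g \<in> carrier ?M" for f g
    by (rule finite_subset[of _ "{v. f v \<noteq> \<zero>} \<union> {v. g v \<noteq> \<zero>}"]) (use that in auto)
  show "\<forall>f g. f \<in> carrier ?M \<and> g \<in> carrier ?M \<longrightarrow> f \<oplus>\<^bsub>?M\<^esub> g \<in> carrier ?M"
    using add by auto
  have smult: "finite {v. c \<otimes> f v \<noteq> \<zero>}" if "f \<in> carrier ?M" "c \<in> carrier R" for f c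
    by (rule finite_subset[of _ "{v. f v \<noteq> \<zero>}"]) (use that in auto)
  show "\<forall>c f. c \<in> carrier R \<and> f \<in> carrier ?M \<longrightarrow> c \<odot>\<^bsub>?M\<^esub> f \<in> carrier ?M"
    using smult by auto
  have neg: "finite {v. \<ominus> f v \<noteq> \<zero>}" if "f \<in> carrier ?M" for f
    by (rule finite_subset[of _ "{v. f v \<noteq> \<zero>}"]) (use that in auto)
  show "\<forall>f\<in>carrier ?M. \<exists>g\<in>carrier ?M. f \<oplus>\<^bsub>?M\<^esub> g = \<zero>\<^bsub>?M\<^esub>"
  proof
    fix f assume f: "f \<in> carrier ?M"
    then show "\<exists>g\<in>carrier ?M. f \<oplus>\<^bsub>?M\<^esub> g = \<zero>\<^bsub>?M\<^esub>"
      using neg[OF f] by (intro bexI[of _ "\<lambda>v. \<ominus> f v"]) (auto simp: r_neg)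
  qed
qed (auto simp: cring_axioms a_ac m_assoc l_distr r_distr)

lemma single_closed: "e \<in> carrier R \<Longrightarrow> v \<in> S \<Longrightarrow> single R e v \<in> carrier (free_module R S)"
  by (auto simp: single_def)

lemma single_eq_smult: "e \<in> carrier R \<Longrightarrow> single R e v = e \<odot>\<^bsub>free_module R S\<^esub> single R \<one> v"
  by (auto simp: single_def)

lemma free_module_induct [consumes 1, case_names zero add single]:
  assumes f: "f \<in> carrier (free_module R S)"
    and zero: "P (\<lambda>v. \<zero>)"
    and add: "\<And>f g. f \<in> carrier (free_module R S) \<Longrightarrow> g \<in> carrier (free_module R S) \<Longrightarrow>
      P f \<Longrightarrow> P g \<Longrightarrow> P (\<lambda>v. f v \<oplus> g v)"
    and single: "\<And>e v. e \<in> carrier R \<Longrightarrow> v \<in> S \<Longrightarrow> P (single R e v)"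
  shows "P f"
proof -
  have "finite A \<Longrightarrow> support R f \<subseteq> A \<Longrightarrow> f \<in> carrier (free_module R S) \<Longrightarrow> P f" for A f
  proof (induction A arbitrary: f rule: finite_induct)
    case empty
    then have "f = (\<lambda>v. \<zero>)" by (auto simp: support_def)
    with zero show ?case by simp
  next
    case (insert v A)
    have f: "f w \<in> carrier R" "w \<notin> S \<Longrightarrow> f w = \<zero>" "finite {v. f v \<noteq> \<zero>}" for w
      using insert.prems(2) by auto
    let ?g = "f(v := \<zero>)"
    have "finite {w. ?g w \<noteq> \<zero>}" by (rule finite_subset[OF _ f(3)]) auto
    then have g: "?g \<in> carrier (free_module R S)" using f by auto
    have "support R ?g \<subseteq> A" using insert.prems(1) by (auto simp: support_def)
    then have Pg: "P ?g" using insert.IH g by blast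
    show ?case
    proof (cases "v \<in> S")
      case True
      have eq: "(\<lambda>w. single R (f v) v w \<oplus> ?g w) = f" using f by (auto simp: single_def fun_eq_iff)
      have "P (\<lambda>w. single R (f v) v w \<oplus> ?g w)"
        by (rule add[OF single_closed[OF f(1) True] g single[OF f(1) True] Pg])
      then show ?thesis unfolding eq .
    next
      case False
      then have "?g = f" using f(2)[of v] by (auto simp: fun_eq_iff)
      with Pg show ?thesis by simp
    qed
  qed
  then show ?thesis using f by (auto simp: support_def)
qed

end

context module begin

definition lift :: "('v \<Rightarrow> 'c) \<Rightarrow> ('v \<Rightarrow> 'a) \<Rightarrow> 'c" where
  "lift \<tau> f = (\<Oplus>\<^bsub>M\<^esub>v\<in>support R f. f v \<odot>\<^bsub>M\<^esub> \<tau> v)"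

lemma lift_superset:
  assumes f: "f \<in> carrier (free_module R S)" and \<tau>: "\<tau> \<in> S \<rightarrow> carrier M"
    and A: "finite A" "support R f \<subseteq> A" "A \<subseteq> S"
  shows "lift \<tau> f = (\<Oplus>\<^bsub>M\<^esub>v\<in>A. f v \<odot>\<^bsub>M\<^esub> \<tau> v)"
  unfolding lift_def
proof (rule M.add.finprod_mono_neutral_cong_left[OF A(1,2)])
  have t: "\<tau> v \<in> carrier M" if "v \<in> A" for v using \<tau> A that by auto
  have fv: "f v \<in> carrier R" for v using f by simp
  show "f v \<odot>\<^bsub>M\<^esub> \<tau> v = \<zero>\<^bsub>M\<^esub>" if "v \<in> A - support R f" for v
    using t[of v] that by (simp add: support_def)
  show "(\<lambda>v. f v \<odot>\<^bsub>M\<^esub> \<tau> v) \<in> A \<rightarrow> carrier M" using t fv by auto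
qed simp

lemma lift_hom:
  assumes \<tau>: "\<tau> \<in> S \<rightarrow> carrier M"
  shows "lift \<tau> \<in> module_hom R (free_module R S) M"
proof -
  let ?X = "free_module R S"
  interpret X: module R ?X by (rule free_module_is_module)
  have supp: "finite (support R f)" "support R f \<subseteq> S" if "f \<in> carrier ?X" for f
    using that by (auto simp: support_def)
  have mem: "f v \<odot>\<^bsub>M\<^esub> \<tau> v \<in> carrier M" "f v \<in> carrier R" "\<tau> v \<in> carrier M"
    if "f \<in> carrier ?X" "v \<in> S" for f v
    using that \<tau> by auto
  have "lift \<tau> f \<in> carrier M" if "f \<in> carrier ?X" for f
    unfolding lift_def using mem[OF that] supp[OF that] by (intro M.finsum_closed) auto
  moreover have "lift \<tau> (f \<oplus>\<^bsub>?X\<^esub> g) = lift \<tau> f \<oplus>\<^bsub>M\<^esub> lift \<tau> g"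
    if fg: "f \<in> carrier ?X" "g \<in> carrier ?X" for f g
  proof -
    let ?A = "support R f \<union> support R g"
    have A: "finite ?A" "?A \<subseteq> S" using supp fg by auto
    have fg': "f \<oplus>\<^bsub>?X\<^esub> g \<in> carrier ?X" using fg by (rule X.M.a_closed)
    have "lift \<tau> (f \<oplus>\<^bsub>?X\<^esub> g) = (\<Oplus>\<^bsub>M\<^esub>v\<in>?A. (f \<oplus>\<^bsub>?X\<^esub> g) v \<odot>\<^bsub>M\<^esub> \<tau> v)"
      using A by (intro lift_superset[OF fg' \<tau>]) (auto simp: support_def)
    also have "\<dots> = (\<Oplus>\<^bsub>M\<^esub>v\<in>?A. f v \<odot>\<^bsub>M\<^esub> \<tau> v \<oplus>\<^bsub>M\<^esub> g v \<odot>\<^bsub>M\<^esub> \<tau> v)"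
      using mem[OF fg(1)] mem[OF fg(2)] A(2)
      by (intro M.finsum_cong') (auto simp: smult_l_distr subset_iff simp del: free_module_simps(1))
    also have "\<dots> = (\<Oplus>\<^bsub>M\<^esub>v\<in>?A. f v \<odot>\<^bsub>M\<^esub> \<tau> v) \<oplus>\<^bsub>M\<^esub> (\<Oplus>\<^bsub>M\<^esub>v\<in>?A. g v \<odot>\<^bsub>M\<^esub> \<tau> v)"
      using mem(1)[OF fg(1)] mem(1)[OF fg(2)] A(2) by (intro M.finsum_addf) blast+
    also have "\<dots> = lift \<tau> f \<oplus>\<^bsub>M\<^esub> lift \<tau> g"
      using lift_superset[OF fg(1) \<tau> A(1) _ A(2)] lift_superset[OF fg(2) \<tau> A(1) _ A(2)] by simp
    finally show ?thesis .
  qed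
  moreover have "lift \<tau> (c \<odot>\<^bsub>?X\<^esub> f) = c \<odot>\<^bsub>M\<^esub> lift \<tau> f" if c: "c \<in> carrier R" and f: "f \<in> carrier ?X" for c f
  proof -
    have cf: "c \<odot>\<^bsub>?X\<^esub> f \<in> carrier ?X" using c f by (rule X.smult_closed)
    have "support R (c \<odot>\<^bsub>?X\<^esub> f) \<subseteq> support R f" using c by (auto simp: support_def)
    then have "lift \<tau> (c \<odot>\<^bsub>?X\<^esub> f) = (\<Oplus>\<^bsub>M\<^esub>v\<in>support R f. (c \<odot>\<^bsub>?X\<^esub> f) v \<odot>\<^bsub>M\<^esub> \<tau> v)"
      by (intro lift_superset[OF cf \<tau>] supp[OF f])
    also have "\<dots> = (\<Oplus>\<^bsub>M\<^esub>v\<in>support R f. c \<odot>\<^bsub>M\<^esub> (f v \<odot>\<^bsub>M\<^esub> \<tau> v))"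
      using mem[OF f] supp(2)[OF f] c
      by (intro M.finsum_cong') (auto simp: smult_assoc1 subset_iff simp del: free_module_simps(1))
    also have "\<dots> = c \<odot>\<^bsub>M\<^esub> lift \<tau> f"
      unfolding lift_def using mem(1)[OF f] supp[OF f] c
      by (intro finsum_smult_ldistr[symmetric]) blast+
    finally show ?thesis .
  qed
  ultimately show ?thesis by (simp add: module_hom_def del: free_module_simps)
qed

lemma lift_single:
  assumes e: "e \<in> carrier R" and v: "v \<in> S" and \<tau>: "\<tau> \<in> S \<rightarrow> carrier M"
  shows "lift \<tau> (single R e v) = e \<odot>\<^bsub>M\<^esub> \<tau> v"
proof -
  have "\<tau> v \<in> carrier M" using v \<tau> by auto
  then have "(\<Oplus>\<^bsub>M\<^esub>w\<in>{v}. single R e v w \<odot>\<^bsub>M\<^esub> \<tau> w) = e \<odot>\<^bsub>M\<^esub> \<tau> v"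
    using e by (simp add: single_def)
  moreover have "lift \<tau> (single R e v) = (\<Oplus>\<^bsub>M\<^esub>w\<in>{v}. single R e v w \<odot>\<^bsub>M\<^esub> \<tau> w)"
    using v by (intro lift_superset[OF single_closed[OF e v] \<tau>]) (auto simp: support_def single_def)
  ultimately show ?thesis by simp
qed

end

declare free_module_simps [simp del]

text \<open>
  Fix a basis \<open>b\<close> of the space of \<open>\<phi>\<close>. The linear map \<open>T\<close> from the free module \<open>M\<close> to \<open>E\<^sup>n\<close> that extends the
  coordinate map kills the tensor relations \<open>N\<close>, and its kernel is no larger than \<open>N\<close>. So it identifies
  \<open>M/N\<close> with \<open>E\<^sup>n\<close>, and it carries the extended form to the diagonal form \<open>D\<close> on \<open>E\<^sup>n\<close> with the entries
  \<open>h(\<phi>(b i))\<close>.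
\<close>

locale scalar_extension = \<phi>: ts_form F \<phi> + E: field2 E
  for F :: "('a, 'm) ring_scheme" and \<phi> :: "('a, 'v) qform" and E :: "('e, 'n) ring_scheme" +
  fixes h :: "'a \<Rightarrow> 'e" and b :: "nat \<Rightarrow> 'v"
  assumes h: "h \<in> ring_hom F E"
    and b: "b \<in> {..<vectorspace.dim F \<phi>} \<rightarrow> carrier \<phi>"
      "lin_iso F (ring.func_space F {..<vectorspace.dim F \<phi>}) \<phi> (vectorspace.comb \<phi> (vectorspace.dim F \<phi>) b)"
begin

abbreviation "n \<equiv> vectorspace.dim F \<phi>"
abbreviation "M \<equiv> free_module E (carrier \<phi>)"
abbreviation "N \<equiv> tensor_relations F E h \<phi>"
abbreviation "D \<equiv> diag_form E n (\<lambda>i. h (qf \<phi> (b i)))"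

definition coord :: "'v \<Rightarrow> nat \<Rightarrow> 'a" where
  "coord = inv_into (tuples F n) (\<phi>.comb n b)"

definition \<tau> :: "'v \<Rightarrow> nat \<Rightarrow> 'e" where
  "\<tau> v = (\<lambda>i\<in>{..<n}. h (coord v i))"

sublocale hom: ring_hom_ring F E h
  by (rule ring_hom_ringI2) (auto simp: h \<phi>.is_ring E.is_ring)

lemma bc: "i < n \<Longrightarrow> b i \<in> carrier \<phi>" using b(1) by auto

sublocale D: ts_form E D
  by (rule E.ts_form_diag_form) (use bc \<phi>.qf_closed in auto)

sublocale M: vectorspace E M
  by (simp add: vectorspace_def E.free_module_is_module E.field_axioms)

lemma coord_iso: "lin_iso F \<phi> (\<phi>.func_space {..<n}) coord"
  using lin_iso_inv[OF \<phi>.func_space_is_module b(2)] by (simp add: coord_def)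

lemma coord_closed: "v \<in> carrier \<phi> \<Longrightarrow> i < n \<Longrightarrow> coord v i \<in> carrier F"
  using lin_isoD(1)[OF coord_iso, of v] by auto

lemma coord_PiE: "v \<in> carrier \<phi> \<Longrightarrow> coord v \<in> tuples F n"
  using lin_isoD(1)[OF coord_iso, of v] by auto

lemma comb_coord:
  assumes v: "v \<in> carrier \<phi>"
  shows "\<phi>.comb n b (coord v) = v"
proof -
  have "\<phi>.comb n b ` (tuples F n) = carrier \<phi>"
    using lin_isoD(4)[OF b(2)] by (simp add: bij_betw_def)
  then have "v \<in> \<phi>.comb n b ` (tuples F n)" using v by (simp only:)
  then show ?thesis unfolding coord_def by (rule f_inv_into_f)
qed

lemma D_carrier: "carrier D = tuples E n"
  by (simp add: E.is_ring)

lemma \<tau>_closed: "v \<in> carrier \<phi> \<Longrightarrow> \<tau> v \<in> carrier D"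
  unfolding \<tau>_def D_carrier restrict_PiE_iff using coord_closed by simp

lemma \<tau>_add:
  assumes vw: "v \<in> carrier \<phi>" "w \<in> carrier \<phi>"
  shows "\<tau> (v \<oplus>\<^bsub>\<phi>\<^esub> w) = \<tau> v \<oplus>\<^bsub>D\<^esub> \<tau> w"
proof -
  have "coord (v \<oplus>\<^bsub>\<phi>\<^esub> w) i = coord v i \<oplus>\<^bsub>F\<^esub> coord w i" if "i < n" for i
    using fun_cong[OF lin_isoD(2)[OF coord_iso vw], of i] that by simp
  then have "h (coord (v \<oplus>\<^bsub>\<phi>\<^esub> w) i) = h (coord v i) \<oplus>\<^bsub>E\<^esub> h (coord w i)" if "i < n" for i
    using coord_closed[OF vw(1) that] coord_closed[OF vw(2) that] that by simp
  then show ?thesis unfolding diag_form_simps[OF E.is_ring] \<tau>_def by (intro restrict_ext) simp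
qed

lemma \<tau>_smult:
  assumes av: "a \<in> carrier F" "v \<in> carrier \<phi>"
  shows "\<tau> (a \<odot>\<^bsub>\<phi>\<^esub> v) = h a \<odot>\<^bsub>D\<^esub> \<tau> v"
proof -
  have "coord (a \<odot>\<^bsub>\<phi>\<^esub> v) i = a \<otimes>\<^bsub>F\<^esub> coord v i" if "i < n" for i
    using fun_cong[OF lin_isoD(3)[OF coord_iso av], of i] that by simp
  then have "h (coord (a \<odot>\<^bsub>\<phi>\<^esub> v) i) = h a \<otimes>\<^bsub>E\<^esub> h (coord v i)" if "i < n" for i
    using coord_closed[OF av(2) that] av(1) that by simp
  then show ?thesis unfolding diag_form_simps[OF E.is_ring] \<tau>_def by (intro restrict_ext) simp
qed

lemma h_square: "x \<in> carrier F \<Longrightarrow> h (x [^]\<^bsub>F\<^esub> (2::nat)) = h x [^]\<^bsub>E\<^esub> (2::nat)"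
  by (simp add: numeral_2_eq_2)

lemma h_finsum: "f \<in> A \<rightarrow> carrier F \<Longrightarrow> h (finsum F f A) = (\<Oplus>\<^bsub>E\<^esub>i\<in>A. h (f i))"
  using hom.hom_finsum[of f A] by (simp add: comp_def)

lemma qf_\<tau>: 
  assumes v: "v \<in> carrier \<phi>"
  shows "qf D (\<tau> v) = h (qf \<phi> v)"
proof -
  note c = coord_closed[OF v]
  have q: "qf \<phi> (b i) \<in> carrier F" if "i < n" for i using bc[OF that] by (rule \<phi>.qf_closed)
  have "qf \<phi> v = qf \<phi> (\<phi>.comb n b (coord v))" using comb_coord[OF v] by simp
  also have "\<dots> = (\<Oplus>\<^bsub>F\<^esub>i\<in>{..<n}. qf \<phi> (b i) \<otimes>\<^bsub>F\<^esub> coord v i [^]\<^bsub>F\<^esub> (2::nat))"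
    using \<phi>.qf_comb[OF b(1) coord_PiE[OF v]] by (simp add: \<phi>.is_ring)
  finally have "h (qf \<phi> v) = (\<Oplus>\<^bsub>E\<^esub>i\<in>{..<n}. h (qf \<phi> (b i) \<otimes>\<^bsub>F\<^esub> coord v i [^]\<^bsub>F\<^esub> (2::nat)))"
    using q c h_finsum[of "\<lambda>i. qf \<phi> (b i) \<otimes>\<^bsub>F\<^esub> coord v i [^]\<^bsub>F\<^esub> (2::nat)" "{..<n}"]
    by (simp add: Pi_def del: hom.hom_finsum)
  also have "\<dots> = (\<Oplus>\<^bsub>E\<^esub>i\<in>{..<n}. h (qf \<phi> (b i)) \<otimes>\<^bsub>E\<^esub> \<tau> v i [^]\<^bsub>E\<^esub> (2::nat))"
    using q c by (intro E.finsum_cong') (auto simp: \<tau>_def h_square)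
  finally show ?thesis by (simp add: E.is_ring)
qed

abbreviation "T \<equiv> D.lift \<tau>"

lemma \<tau>_Pi: "\<tau> \<in> carrier \<phi> \<rightarrow> carrier D" using \<tau>_closed by blast

sublocale T: mod_hom E M D T
  using D.lift_hom[OF \<tau>_Pi] D.module_axioms M.module_axioms
  by (simp add: mod_hom_def mod_hom_axioms_def)

lemma T_single: "e \<in> carrier E \<Longrightarrow> v \<in> carrier \<phi> \<Longrightarrow> T (single E e v) = e \<odot>\<^bsub>D\<^esub> \<tau> v"
  by (rule D.lift_single[OF _ _ \<tau>_Pi])

abbreviation "tensor_value f \<equiv>
  (\<Oplus>\<^bsub>E\<^esub>v\<in>{v. f v \<noteq> \<zero>\<^bsub>E\<^esub>}. f v [^]\<^bsub>E\<^esub> (2::nat) \<otimes>\<^bsub>E\<^esub> h (qf \<phi> v))"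

lemma qf_T:
  assumes f: "f \<in> carrier M"
  shows "qf D (T f) = tensor_value f"
proof -
  have vc: "f v \<in> carrier E" "v \<in> carrier \<phi>" if "v \<in> support E f" for v
    using f that by (auto simp: support_def free_module_simps)
  note m = vc(1) \<tau>_closed[OF vc(2)] vc(2)
  have fin: "finite (support E f)" using f by (simp add: support_def free_module_simps)
  have "qf D (T f) = (\<Oplus>\<^bsub>E\<^esub>v\<in>support E f. qf D (f v \<odot>\<^bsub>D\<^esub> \<tau> v))"
    unfolding D.lift_def by (rule D.qf_finsum[OF fin]) (blast intro: D.smult_closed m)
  also have "\<dots> = (\<Oplus>\<^bsub>E\<^esub>v\<in>support E f. f v [^]\<^bsub>E\<^esub> (2::nat) \<otimes>\<^bsub>E\<^esub> h (qf \<phi> v))"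
  proof (rule E.finsum_cong')
    fix v assume "v \<in> support E f"
    from m[OF this] show "qf D (f v \<odot>\<^bsub>D\<^esub> \<tau> v) = f v [^]\<^bsub>E\<^esub> (2::nat) \<otimes>\<^bsub>E\<^esub> h (qf \<phi> v)"
      using D.qf_smult[of "f v" "\<tau> v"] qf_\<tau>[of v] by (simp only:)
  qed (use m \<phi>.qf_closed in auto)
  finally show ?thesis by (simp add: support_def)
qed

abbreviation "\<delta> \<equiv> single E \<one>\<^bsub>E\<^esub>"

abbreviation "rels \<equiv>
  {\<delta> (v \<oplus>\<^bsub>\<phi>\<^esub> w) \<ominus>\<^bsub>M\<^esub> (\<delta> v \<oplus>\<^bsub>M\<^esub> \<delta> w) | v w.
     v \<in> carrier \<phi> \<and> w \<in> carrier \<phi>} \<union>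
  {\<delta> (a \<odot>\<^bsub>\<phi>\<^esub> v) \<ominus>\<^bsub>M\<^esub> single E (h a) v | a v. a \<in> carrier F \<and> v \<in> carrier \<phi>}"

lemma N_eq: "N = M.span rels"
  by (simp only: tensor_relations_def Let_def)

lemma sc: "e \<in> carrier E \<Longrightarrow> v \<in> carrier \<phi> \<Longrightarrow> single E e v \<in> carrier M"
  by (rule E.single_closed)

lemma rels_closed: "rels \<subseteq> carrier M"
proof (intro Un_least subsetI; elim CollectE exE conjE)
  fix x v w assume "v \<in> carrier \<phi>" "w \<in> carrier \<phi>"
    "x = \<delta> (v \<oplus>\<^bsub>\<phi>\<^esub> w) \<ominus>\<^bsub>M\<^esub> (\<delta> v \<oplus>\<^bsub>M\<^esub> \<delta> w)"
  then show "x \<in> carrier M"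
    using sc[OF E.one_closed] by (simp only: M.M.minus_closed M.M.a_closed \<phi>.M.a_closed)
next
  fix x a v assume "a \<in> carrier F" "v \<in> carrier \<phi>"
    "x = \<delta> (a \<odot>\<^bsub>\<phi>\<^esub> v) \<ominus>\<^bsub>M\<^esub> single E (h a) v"
  then show "x \<in> carrier M"
    using sc by (simp only: M.M.minus_closed E.one_closed hom.hom_closed \<phi>.smult_closed)
qed

lemma N_submodule: "submodule E N M"
  unfolding N_eq by (rule M.span_is_submodule[OF rels_closed])

lemma N_incl: "x \<in> rels \<Longrightarrow> x \<in> N"
  unfolding N_eq using M.in_own_span[OF rels_closed] by blast

lemma N_closed: "x \<in> N \<Longrightarrow> x \<in> carrier M"
  using N_submodule by (auto simp: submodule_def)

lemma N_add: "x \<in> N \<Longrightarrow> y \<in> N \<Longrightarrow> x \<oplus>\<^bsub>M\<^esub> y \<in> N"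
  and N_smult: "c \<in> carrier E \<Longrightarrow> x \<in> N \<Longrightarrow> c \<odot>\<^bsub>M\<^esub> x \<in> N"
  and N_zero: "\<zero>\<^bsub>M\<^esub> \<in> N"
  using N_submodule by (simp_all add: submodule_def)

lemma N_kernel: "x \<in> N \<Longrightarrow> T x = \<zero>\<^bsub>D\<^esub>"
proof -
  have "rels \<subseteq> T.ker"
  proof
    fix x assume x: "x \<in> rels"
    then have xc: "x \<in> carrier M" using rels_closed by blast
    have "T x = \<zero>\<^bsub>D\<^esub>"
      using x
    proof (elim UnE CollectE exE conjE)
      fix v w assume vw: "v \<in> carrier \<phi>" "w \<in> carrier \<phi>"
        and x: "x = \<delta> (v \<oplus>\<^bsub>\<phi>\<^esub> w) \<ominus>\<^bsub>M\<^esub> (\<delta> v \<oplus>\<^bsub>M\<^esub> \<delta> w)"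
      have "T x = T (\<delta> (v \<oplus>\<^bsub>\<phi>\<^esub> w)) \<ominus>\<^bsub>D\<^esub> (T (\<delta> v) \<oplus>\<^bsub>D\<^esub> T (\<delta> w))"
        unfolding x using sc[OF E.one_closed] vw
        by (simp only: T.f_minus T.f_add M.M.a_closed \<phi>.M.a_closed)
      also have "\<dots> = \<tau> (v \<oplus>\<^bsub>\<phi>\<^esub> w) \<ominus>\<^bsub>D\<^esub> (\<tau> v \<oplus>\<^bsub>D\<^esub> \<tau> w)"
        using vw \<tau>_closed by (simp add: T_single del: diag_form_simps)
      also have "\<dots> = \<zero>\<^bsub>D\<^esub>"
        using vw \<tau>_closed by (simp add: \<tau>_add D.M.r_neg a_minus_def del: diag_form_simps)
      finally show "T x = \<zero>\<^bsub>D\<^esub>" .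
    next
      fix a v assume av: "a \<in> carrier F" "v \<in> carrier \<phi>"
        and x: "x = \<delta> (a \<odot>\<^bsub>\<phi>\<^esub> v) \<ominus>\<^bsub>M\<^esub> single E (h a) v"
      have "T x = T (\<delta> (a \<odot>\<^bsub>\<phi>\<^esub> v)) \<ominus>\<^bsub>D\<^esub> T (single E (h a) v)"
        unfolding x using sc av
        by (simp only: T.f_minus E.one_closed hom.hom_closed \<phi>.smult_closed)
      also have "\<dots> = \<tau> (a \<odot>\<^bsub>\<phi>\<^esub> v) \<ominus>\<^bsub>D\<^esub> h a \<odot>\<^bsub>D\<^esub> \<tau> v"
        using av \<tau>_closed by (simp add: T_single del: diag_form_simps)
      also have "\<dots> = \<zero>\<^bsub>D\<^esub>"
        using av \<tau>_closed by (simp add: \<tau>_smult D.M.r_neg a_minus_def del: diag_form_simps)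
      finally show "T x = \<zero>\<^bsub>D\<^esub>" .
    qed
    with xc show "x \<in> T.ker" by (simp add: T.ker_def)
  qed
  then have "N \<subseteq> T.ker" unfolding N_eq by (rule M.span_is_subset[OF _ T.ker_is_submodule])
  then show "x \<in> N \<Longrightarrow> T x = \<zero>\<^bsub>D\<^esub>" by (auto simp: T.ker_def)
qed

end

context scalar_extension begin

lemma N_subgroup: "subgroup N (add_monoid M)"
proof (rule M.M.add.subgroupI)
  show "N \<subseteq> carrier M" using N_closed by blast
  show "N \<noteq> {}" using N_zero by blast
  show "\<ominus>\<^bsub>M\<^esub> x \<in> N" if "x \<in> N" for x
    using N_smult[OF _ that, of "\<ominus>\<^bsub>E\<^esub> \<one>\<^bsub>E\<^esub>"] M.smult_minus_1[OF N_closed[OF that]] by simp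
  show "x \<oplus>\<^bsub>M\<^esub> y \<in> N" if "x \<in> N" "y \<in> N" for x y using that by (rule N_add)
qed

sublocale N: abelian_subgroup N M
  by (rule abelian_subgroupI3[OF additive_subgroupI[OF N_subgroup] M.M.abelian_group_axioms])

abbreviation "cls f \<equiv> N +>\<^bsub>M\<^esub> f"

lemma cls_eqI:
  assumes c: "f \<in> carrier M" "g \<in> carrier M" "f \<ominus>\<^bsub>M\<^esub> g \<in> N"
  shows "cls f = cls g"
proof -
  have "f = (f \<ominus>\<^bsub>M\<^esub> g) \<oplus>\<^bsub>M\<^esub> g"
    using c(1,2) by (simp add: a_minus_def M.M.a_assoc M.M.l_neg)
  then have "f \<in> cls g"
    using M.M.a_rcosI[OF c(3) N.a_subset c(2)] by simp
  then show ?thesis using M.M.a_repr_independence[OF _ c(2) N_subgroup] by simp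
qed

lemma cls_add:
  assumes "f \<in> carrier M" "g \<in> carrier M" "f' \<in> carrier M" "g' \<in> carrier M"
    "cls f = cls g" "cls f' = cls g'"
  shows "cls (f \<oplus>\<^bsub>M\<^esub> f') = cls (g \<oplus>\<^bsub>M\<^esub> g')"
  using assms by (simp add: N.a_rcos_sum[symmetric])

lemma cls_repr:
  assumes f: "f \<in> carrier M" and g: "g \<in> cls f"
  obtains x where "x \<in> N" "g = x \<oplus>\<^bsub>M\<^esub> f"
  using g by (auto simp: a_r_coset_def')

lemma cls_smult:
  assumes e: "e \<in> carrier E" and f: "f \<in> carrier M" and g: "g \<in> cls f"
  shows "cls (e \<odot>\<^bsub>M\<^esub> g) = cls (e \<odot>\<^bsub>M\<^esub> f)"
proof -
  obtain x where x: "x \<in> N" "g = x \<oplus>\<^bsub>M\<^esub> f" by (rule cls_repr[OF f g])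
  note ef = M.smult_closed[OF e f]
  have "e \<odot>\<^bsub>M\<^esub> g = e \<odot>\<^bsub>M\<^esub> x \<oplus>\<^bsub>M\<^esub> e \<odot>\<^bsub>M\<^esub> f"
    unfolding x(2) by (rule M.smult_r_distr[OF e N_closed[OF x(1)] f])
  then have "e \<odot>\<^bsub>M\<^esub> g \<in> cls (e \<odot>\<^bsub>M\<^esub> f)"
    using M.M.a_rcosI[OF N_smult[OF e x(1)] N.a_subset ef] by simp
  then show ?thesis using M.M.a_repr_independence[OF _ ef N_subgroup] by simp
qed

lemma T_cls:
  assumes f: "f \<in> carrier M" and g: "g \<in> cls f"
  shows "g \<in> carrier M" "T g = T f"
proof -
  obtain x where x: "x \<in> N" "g = x \<oplus>\<^bsub>M\<^esub> f" by (rule cls_repr[OF f g])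
  then have xc: "x \<in> carrier M" using N_closed by blast
  show gc: "g \<in> carrier M" unfolding x(2) by (rule M.M.a_closed[OF xc f])
  have "T g = T x \<oplus>\<^bsub>D\<^esub> T f" unfolding x(2) by (rule T.f_add[OF xc f])
  then show "T g = T f" using N_kernel[OF x(1)] T.f_im[OF f] by (simp del: diag_form_simps)
qed

abbreviation "\<sigma> \<equiv> M.comb n (\<lambda>i. \<delta> (b i))"

lemma single_b: "(\<lambda>i. \<delta> (b i)) \<in> {..<n} \<rightarrow> carrier M"
  using sc[OF E.one_closed bc] by blast

sublocale \<sigma>: mod_hom E D M \<sigma>
proof -
  have "\<sigma> \<in> module_hom E (E.func_space {..<n}) M" by (rule M.comb_hom[OF single_b])
  then have "\<sigma> \<in> module_hom E D M"
    by (simp add: module_hom_def E.is_ring)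
  then show "mod_hom E D M \<sigma>"
    using D.module_axioms M.module_axioms by (simp add: mod_hom_def mod_hom_axioms_def)
qed

lemma cls_relations:
  shows "v \<in> carrier \<phi> \<Longrightarrow> w \<in> carrier \<phi> \<Longrightarrow> cls (\<delta> (v \<oplus>\<^bsub>\<phi>\<^esub> w)) = cls (\<delta> v \<oplus>\<^bsub>M\<^esub> \<delta> w)"
    and "a \<in> carrier F \<Longrightarrow> v \<in> carrier \<phi> \<Longrightarrow> cls (\<delta> (a \<odot>\<^bsub>\<phi>\<^esub> v)) = cls (h a \<odot>\<^bsub>M\<^esub> \<delta> v)"
proof -
  note s = sc[OF E.one_closed]
  assume v: "v \<in> carrier \<phi>"
  show "cls (\<delta> (v \<oplus>\<^bsub>\<phi>\<^esub> w)) = cls (\<delta> v \<oplus>\<^bsub>M\<^esub> \<delta> w)" if w: "w \<in> carrier \<phi>"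
    by (intro cls_eqI s M.M.a_closed v w \<phi>.M.a_closed N_incl UnI1) (use v w in blast)
  show "cls (\<delta> (a \<odot>\<^bsub>\<phi>\<^esub> v)) = cls (h a \<odot>\<^bsub>M\<^esub> \<delta> v)" if a: "a \<in> carrier F"
    unfolding E.single_eq_smult[OF hom.hom_closed[OF a], symmetric]
    by (intro cls_eqI s sc hom.hom_closed a v \<phi>.smult_closed N_incl UnI2) (use a v in blast)
qed

lemma cls_comb:
  assumes x: "\<And>i. i < n \<Longrightarrow> x i \<in> carrier F"
  shows "finite A \<Longrightarrow> A \<subseteq> {..<n} \<Longrightarrow>
    cls (\<delta> (\<Oplus>\<^bsub>\<phi>\<^esub>i\<in>A. x i \<odot>\<^bsub>\<phi>\<^esub> b i)) = cls (\<Oplus>\<^bsub>M\<^esub>i\<in>A. h (x i) \<odot>\<^bsub>M\<^esub> \<delta> (b i))"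
proof (induction A rule: finite_induct)
  case empty
  have "cls (\<delta> (\<zero>\<^bsub>F\<^esub> \<odot>\<^bsub>\<phi>\<^esub> \<zero>\<^bsub>\<phi>\<^esub>)) = cls (h \<zero>\<^bsub>F\<^esub> \<odot>\<^bsub>M\<^esub> \<delta> \<zero>\<^bsub>\<phi>\<^esub>)"
    by (rule cls_relations) auto
  then show ?case using sc[OF E.one_closed \<phi>.M.zero_closed] by simp
next
  case (insert i A)
  note s = sc[OF E.one_closed]
  have i: "i < n" and A: "A \<subseteq> {..<n}" using insert.prems by auto
  have xb: "x j \<odot>\<^bsub>\<phi>\<^esub> b j \<in> carrier \<phi>" "h (x j) \<odot>\<^bsub>M\<^esub> \<delta> (b j) \<in> carrier M" if "j < n" for j
    by (rule \<phi>.smult_closed[OF x[OF that] bc[OF that]],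
        rule M.smult_closed[OF hom.hom_closed[OF x[OF that]] s[OF bc[OF that]]])
  have fA: "(\<lambda>j. x j \<odot>\<^bsub>\<phi>\<^esub> b j) \<in> A \<rightarrow> carrier \<phi>" "(\<lambda>j. h (x j) \<odot>\<^bsub>M\<^esub> \<delta> (b j)) \<in> A \<rightarrow> carrier M"
    using xb A by blast+
  note w = \<phi>.M.finsum_closed[OF fA(1)]
  show ?case
    unfolding \<phi>.M.finsum_insert[OF insert.hyps(1,2) fA(1) xb(1)[OF i]]
      M.M.finsum_insert[OF insert.hyps(1,2) fA(2) xb(2)[OF i]] cls_relations(1)[OF xb(1)[OF i] w]
    by (rule cls_add[OF s[OF xb(1)[OF i]] xb(2)[OF i] s[OF w] M.M.finsum_closed[OF fA(2)]
          cls_relations(2)[OF x[OF i] bc[OF i]] insert.IH[OF A]])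
qed

lemma cls_\<delta>:
  assumes v: "v \<in> carrier \<phi>"
  shows "cls (\<delta> v) = cls (\<sigma> (\<tau> v))"
proof -
  have "\<sigma> (\<tau> v) = (\<Oplus>\<^bsub>M\<^esub>i\<in>{..<n}. h (coord v i) \<odot>\<^bsub>M\<^esub> \<delta> (b i))"
    unfolding M.comb_def
  proof (rule M.M.finsum_cong'[OF refl])
    show "(\<lambda>i. h (coord v i) \<odot>\<^bsub>M\<^esub> \<delta> (b i)) \<in> {..<n} \<rightarrow> carrier M"
      using coord_closed[OF v] single_b by (blast intro: M.smult_closed hom.hom_closed)
  qed (simp add: \<tau>_def)
  moreover have "(\<Oplus>\<^bsub>\<phi>\<^esub>i\<in>{..<n}. coord v i \<odot>\<^bsub>\<phi>\<^esub> b i) = v"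
    using comb_coord[OF v] by (simp add: \<phi>.comb_def)
  moreover have "cls (\<delta> (\<Oplus>\<^bsub>\<phi>\<^esub>i\<in>{..<n}. coord v i \<odot>\<^bsub>\<phi>\<^esub> b i))
      = cls (\<Oplus>\<^bsub>M\<^esub>i\<in>{..<n}. h (coord v i) \<odot>\<^bsub>M\<^esub> \<delta> (b i))"
    by (rule cls_comb[OF coord_closed[OF v]]) simp_all
  ultimately show ?thesis by (simp only:)
qed

text \<open>
  \<open>\<sigma>\<close> sends coordinates \<open>y\<close> to \<open>\<Sum> y\<^sub>i (1 \<otimes> b i)\<close>. Modulo \<open>N\<close> every tensor \<open>1 \<otimes> v\<close> is expanded in this
  way by its coordinates, and such tensors generate \<open>M\<close>; thus \<open>T f = 0\<close> puts \<open>f\<close> into \<open>N\<close>.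
\<close>

lemma cls_section: "f \<in> carrier M \<Longrightarrow> cls f = cls (\<sigma> (T f))"
proof (induction f rule: E.free_module_induct)
  case zero
  have "\<sigma> (T \<zero>\<^bsub>M\<^esub>) = \<zero>\<^bsub>M\<^esub>" by (simp only: T.f0_is_0 \<sigma>.f0_is_0)
  then show ?case by (simp add: free_module_simps)
next
  case (add f g)
  have T: "T f \<in> carrier D" "T g \<in> carrier D" using add.hyps T.f_im by blast+
  have "\<sigma> (T (f \<oplus>\<^bsub>M\<^esub> g)) = \<sigma> (T f) \<oplus>\<^bsub>M\<^esub> \<sigma> (T g)"
    using add.hyps T by (simp only: T.f_add \<sigma>.f_add)
  then have "cls (f \<oplus>\<^bsub>M\<^esub> g) = cls (\<sigma> (T (f \<oplus>\<^bsub>M\<^esub> g)))"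
    using cls_add[OF add.hyps(1) \<sigma>.f_im[OF T(1)] add.hyps(2) \<sigma>.f_im[OF T(2)] add.IH] by (simp only:)
  then show ?case by (simp add: free_module_simps)
next
  case (single e v)
  note t = \<sigma>.f_im[OF \<tau>_closed[OF single(2)]]
  have "\<sigma> (T (single E e v)) = e \<odot>\<^bsub>M\<^esub> \<sigma> (\<tau> v)"
    unfolding T_single[OF single] by (rule \<sigma>.f_smult[OF single(1) \<tau>_closed[OF single(2)]])
  moreover have "\<delta> v \<in> cls (\<sigma> (\<tau> v))"
    using N.a_rcos_self[OF sc[OF E.one_closed single(2)]] unfolding cls_\<delta>[OF single(2)] .
  ultimately show ?case
    using cls_smult[OF single(1) t] E.single_eq_smult[OF single(1), of v "carrier \<phi>"] by (simp only:)
qed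

lemma \<tau>_b:
  assumes i: "i < n"
  shows "\<tau> (b i) = (\<lambda>j\<in>{..<n}. if i = j then \<one>\<^bsub>E\<^esub> else \<zero>\<^bsub>E\<^esub>)"
proof -
  let ?u = "\<lambda>j\<in>{..<n}. if i = j then \<one>\<^bsub>F\<^esub> else \<zero>\<^bsub>F\<^esub>"
  have "\<phi>.comb n b ?u = (\<Oplus>\<^bsub>\<phi>\<^esub>j\<in>{..<n}. if i = j then b j else \<zero>\<^bsub>\<phi>\<^esub>)"
    unfolding \<phi>.comb_def using bc by (intro \<phi>.M.finsum_cong') auto
  also have "\<dots> = b i" using bc i by (intro \<phi>.M.finsum_singleton) auto
  finally have "coord (b i) = coord (\<phi>.comb n b ?u)" by simp
  also have "\<dots> = ?u"
    unfolding coord_def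
    by (rule inv_into_f_f) (use lin_isoD(4)[OF b(2)] in \<open>auto simp: bij_betw_def\<close>)
  finally show ?thesis by (auto simp: \<tau>_def intro!: restrict_ext)
qed

lemma T_section:
  assumes y: "y \<in> carrier D"
  shows "T (\<sigma> y) = y"
proof -
  have yi: "y i \<in> carrier E" if "i < n" for i
    using PiE_mem[OF y[unfolded D_carrier], of i] that by simp
  note s = sc[OF E.one_closed]
  have m: "y i \<odot>\<^bsub>M\<^esub> \<delta> (b i) \<in> carrier M" if "i < n" for i
    by (rule M.smult_closed[OF yi[OF that] s[OF bc[OF that]]])
  have "T (\<sigma> y) = (\<Oplus>\<^bsub>D\<^esub>i\<in>{..<n}. T (y i \<odot>\<^bsub>M\<^esub> \<delta> (b i)))"
    unfolding M.comb_def by (rule T.f_finsum) (simp_all add: m Pi_def)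
  also have "\<dots> = (\<Oplus>\<^bsub>D\<^esub>i\<in>{..<n}. y i \<odot>\<^bsub>D\<^esub> (\<lambda>j\<in>{..<n}. if i = j then \<one>\<^bsub>E\<^esub> else \<zero>\<^bsub>E\<^esub>))"
  proof (rule D.M.finsum_cong'[OF refl])
    fix i assume "i \<in> {..<n}"
    then have i: "i < n" by simp
    have "T (y i \<odot>\<^bsub>M\<^esub> \<delta> (b i)) = y i \<odot>\<^bsub>D\<^esub> (\<one>\<^bsub>E\<^esub> \<odot>\<^bsub>D\<^esub> \<tau> (b i))"
      unfolding T.f_smult[OF yi[OF i] s[OF bc[OF i]]] T_single[OF E.one_closed bc[OF i]] ..
    also have "\<one>\<^bsub>E\<^esub> \<odot>\<^bsub>D\<^esub> \<tau> (b i) = \<tau> (b i)" by (rule D.smult_one[OF \<tau>_closed[OF bc[OF i]]])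
    finally show "T (y i \<odot>\<^bsub>M\<^esub> \<delta> (b i))
        = y i \<odot>\<^bsub>D\<^esub> (\<lambda>j\<in>{..<n}. if i = j then \<one>\<^bsub>E\<^esub> else \<zero>\<^bsub>E\<^esub>)" unfolding \<tau>_b[OF i] .
  next
    show "(\<lambda>i. y i \<odot>\<^bsub>D\<^esub> (\<lambda>j\<in>{..<n}. if i = j then \<one>\<^bsub>E\<^esub> else \<zero>\<^bsub>E\<^esub>)) \<in> {..<n} \<rightarrow> carrier D"
      using yi \<tau>_closed[OF bc] \<tau>_b by (intro Pi_I D.smult_closed) auto
  qed
  also have "\<dots> = vectorspace.comb (E.func_space {..<n}) n (\<lambda>i. \<lambda>j\<in>{..<n}. if i = j then \<one>\<^bsub>E\<^esub> else \<zero>\<^bsub>E\<^esub>) y"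
    unfolding vectorspace.comb_def[OF E.func_space_vectorspace]
    by (simp add: diag_form_def)
  also have "\<dots> = y" using y by (intro E.comb_unit_vectors) (simp add: D_carrier)
  finally show ?thesis .
qed

abbreviation "Q \<equiv> base_change F E h \<phi>"

text \<open>\<open>T\<close> is constant on cosets of \<open>N\<close>, so any representative gives the induced map.\<close>

definition T_bar :: "('v \<Rightarrow> 'e) set \<Rightarrow> nat \<Rightarrow> 'e" where
  "T_bar X = T (SOME f. f \<in> X)"

lemma Q_simps:
  "carrier Q = a_rcosets\<^bsub>M\<^esub> N" "\<zero>\<^bsub>Q\<^esub> = N" "X \<oplus>\<^bsub>Q\<^esub> Y = X <+>\<^bsub>M\<^esub> Y"
  "c \<odot>\<^bsub>Q\<^esub> X = (\<Union>f\<in>X. cls (c \<odot>\<^bsub>M\<^esub> f))"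
  "qf Q X = (THE y. \<exists>f\<in>X. y =
      tensor_value f)"
  by (simp_all only: base_change_def extend_scalars_def Let_def form_on_simps partial_object.simps
      monoid.simps ring.simps module.simps)

lemma coset_cases:
  assumes "X \<in> carrier Q"
  obtains f where "f \<in> carrier M" "X = cls f"
proof -
  have "X \<in> (\<Union>f\<in>carrier M. {cls f})" using assms unfolding Q_simps A_RCOSETS_def' .
  then show thesis by (elim UN_E singletonE) (rule that)
qed

lemma coset_in_Q: "f \<in> carrier M \<Longrightarrow> cls f \<in> carrier Q"
  unfolding Q_simps by (rule M.M.a_rcosetsI[OF N.a_subset])

lemma T_bar_coset:
  assumes f: "f \<in> carrier M"
  shows "T_bar (cls f) = T f"
  unfolding T_bar_def by (rule T_cls(2)[OF f someI[where P = "\<lambda>g. g \<in> cls f", OF N.a_rcos_self[OF f]]])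

lemma smult_coset:
  assumes c: "c \<in> carrier E" and f: "f \<in> carrier M"
  shows "c \<odot>\<^bsub>Q\<^esub> (cls f) = cls (c \<odot>\<^bsub>M\<^esub> f)"
proof -
  have "cls (c \<odot>\<^bsub>M\<^esub> g) = cls (c \<odot>\<^bsub>M\<^esub> f)" if "g \<in> cls f" for g
    by (rule cls_smult[OF c f that])
  then show ?thesis unfolding Q_simps using N.a_rcos_self[OF f] by blast
qed

lemma add_coset:
  "f \<in> carrier M \<Longrightarrow> g \<in> carrier M \<Longrightarrow>
    (cls f) \<oplus>\<^bsub>Q\<^esub> (cls g) = cls (f \<oplus>\<^bsub>M\<^esub> g)"
  unfolding Q_simps by (rule N.a_rcos_sum)

lemma zero_coset: "\<zero>\<^bsub>Q\<^esub> = cls \<zero>\<^bsub>M\<^esub>"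
  unfolding Q_simps by (rule M.M.a_coset_add_zero[OF N.a_subset, symmetric])

lemma qf_Q: 
  assumes X: "X \<in> carrier Q"
  shows "qf Q X = qf D (T_bar X)"
proof -
  obtain f where f: "f \<in> carrier M" "X = cls f" using X by (rule coset_cases)
  have "tensor_value g = qf D (T f)" if "g \<in> X" for g
  proof -
    have g: "g \<in> cls f" using that f(2) by simp
    show ?thesis
      unfolding T_cls(2)[OF f(1) g, symmetric] by (rule qf_T[OF T_cls(1)[OF f(1) g], symmetric])
  qed
  note val = this[unfolded f(2)]
  note fX = N.a_rcos_self[OF f(1)]
  show ?thesis
    unfolding Q_simps(5) f(2) T_bar_coset[OF f(1)]
  proof (rule the_equality)
    show "\<exists>g\<in>cls f. qf D (T f) =
        tensor_value g"
      by (intro bexI[where x = f] fX) (rule val[OF fX, symmetric])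
    fix y assume "\<exists>g\<in>cls f. y =
        tensor_value g"
    then obtain g where g: "g \<in> cls f"
        "y = tensor_value g" by blast
    show "y = qf D (T f)" unfolding g(2) by (rule val[OF g(1)])
  qed
qed

theorem base_change_ts_form: "ts_form E Q" "vectorspace.dim E Q = n" "vals Q = vals D"
proof -
  have inj: "inj_on T_bar (carrier Q)"
  proof (rule inj_onI)
    fix X Y assume X: "X \<in> carrier Q" and Y: "Y \<in> carrier Q" and eq: "T_bar X = T_bar Y"
    obtain f where f: "f \<in> carrier M" "X = cls f" using X by (rule coset_cases)
    obtain g where g: "g \<in> carrier M" "Y = cls g" using Y by (rule coset_cases)
    have "T f = T g" using eq unfolding f(2) g(2) T_bar_coset[OF f(1)] T_bar_coset[OF g(1)] .
    then have "cls f = cls g"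
      using cls_section[OF f(1)] cls_section[OF g(1)] by simp
    then show "X = Y" unfolding f(2) g(2) .
  qed
  have im: "T_bar ` carrier Q = carrier D"
  proof (intro equalityI subsetI)
    fix y assume "y \<in> T_bar ` carrier Q"
    then obtain X where X: "X \<in> carrier Q" "y = T_bar X" by blast
    obtain f where f: "f \<in> carrier M" "X = cls f" using X(1) by (rule coset_cases)
    show "y \<in> carrier D" unfolding X(2) f(2) T_bar_coset[OF f(1)] by (rule T.f_im[OF f(1)])
  next
    fix y assume y: "y \<in> carrier D"
    note s = \<sigma>.f_im[OF y]
    have "y = T_bar (cls (\<sigma> y))" unfolding T_bar_coset[OF s] T_section[OF y] ..
    with coset_in_Q[OF s] show "y \<in> T_bar ` carrier Q" by blast
  qed
  have zero: "\<zero>\<^bsub>Q\<^esub> \<in> carrier Q" "T_bar \<zero>\<^bsub>Q\<^esub> = \<zero>\<^bsub>D\<^esub>"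
    unfolding zero_coset T_bar_coset[OF M.M.zero_closed]
    by (rule coset_in_Q[OF M.M.zero_closed], rule T.f0_is_0)
  have add: "X \<oplus>\<^bsub>Q\<^esub> Y \<in> carrier Q \<and> T_bar (X \<oplus>\<^bsub>Q\<^esub> Y) = T_bar X \<oplus>\<^bsub>D\<^esub> T_bar Y"
    if X: "X \<in> carrier Q" and Y: "Y \<in> carrier Q" for X Y
  proof -
    obtain f where f: "f \<in> carrier M" "X = cls f" using X by (rule coset_cases)
    obtain g where g: "g \<in> carrier M" "Y = cls g" using Y by (rule coset_cases)
    note fg = M.M.a_closed[OF f(1) g(1)]
    show ?thesis
      unfolding f(2) g(2) add_coset[OF f(1) g(1)] T_bar_coset[OF f(1)] T_bar_coset[OF g(1)] T_bar_coset[OF fg]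
      using coset_in_Q[OF fg] T.f_add[OF f(1) g(1)] by blast
  qed
  have smult: "c \<odot>\<^bsub>Q\<^esub> X \<in> carrier Q \<and> T_bar (c \<odot>\<^bsub>Q\<^esub> X) = c \<odot>\<^bsub>D\<^esub> T_bar X"
    if c: "c \<in> carrier E" and X: "X \<in> carrier Q" for c X
  proof -
    obtain f where f: "f \<in> carrier M" "X = cls f" using X by (rule coset_cases)
    note cf = M.smult_closed[OF c f(1)]
    show ?thesis
      unfolding f(2) smult_coset[OF c f(1)] T_bar_coset[OF f(1)] T_bar_coset[OF cf]
      using coset_in_Q[OF cf] T.f_smult[OF c f(1)] by blast
  qed
  note Q = vectorspace_transport[OF D.vectorspace_axioms inj im zero add smult]
  have iso: "isometric E Q D"
    unfolding isometric_iff by (intro exI[of _ T_bar] conjI ballI Q(2) qf_Q)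
  show "ts_form E Q" by (rule ts_form_transport(1)[OF Q(1) D.ts_form_axioms iso])
  have dim_D: "vectorspace.dim E D = n"
    by (rule E.ts_form_diag_form(2)) (use bc \<phi>.qf_closed in auto)
  show "vectorspace.dim E Q = n"
    using ts_form_transport(2)[OF Q(1) D.ts_form_axioms iso] dim_D by - (rule trans)
  show "vals Q = vals D" by (rule isometric_values[OF iso])
qed

end

section \<open>Vishik equivalence and ranks over intermediate fields\<close>

context field2 begin

text \<open>
  With the embedding \<open>x \<mapsto> x\<^sup>2\<close> of \<open>F\<close>, an intermediate field \<open>K\<close> becomes a model of the extension of \<open>F\<close> by
  the square roots of the elements of \<open>K\<close>. Its elements are copied to singleton lists, since Vishik
  equivalence refers to extensions with elements of type \<^typ>\<open>'a list\<close>.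
\<close>

definition copy_field :: "'a set \<Rightarrow> 'a list ring" where
  "copy_field K = \<lparr>carrier = (\<lambda>x. [x]) ` K, mult = (\<lambda>x y. [hd x \<otimes> hd y]), one = [\<one>],
    zero = [\<zero>], add = (\<lambda>x y. [hd x \<oplus> hd y])\<rparr>"

lemma copy_field_simps [simp]:
  "carrier (copy_field K) = (\<lambda>x. [x]) ` K" "x \<otimes>\<^bsub>copy_field K\<^esub> y = [hd x \<otimes> hd y]"
  "\<one>\<^bsub>copy_field K\<^esub> = [\<one>]" "\<zero>\<^bsub>copy_field K\<^esub> = [\<zero>]" "x \<oplus>\<^bsub>copy_field K\<^esub> y = [hd x \<oplus> hd y]"
  by (simp_all add: copy_field_def)

lemma copy_field_field2:
  assumes K: "subfield K F"
  shows "field2 (copy_field K)"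
proof -
  have "(\<lambda>x. [x]) \<in> ring_iso (F\<lparr>carrier := K\<rparr>) (copy_field K)"
    by (rule ring_iso_memI) (auto simp: bij_betw_def inj_on_def)
  then have "field (copy_field K\<lparr>zero := [\<zero>]\<rparr>)"
    using field.ring_iso_imp_img_field[OF subfield_iff(2)[OF K], of "\<lambda>x. [x]" "copy_field K"] by simp
  moreover have "copy_field K\<lparr>zero := [\<zero>]\<rparr> = copy_field K" by (simp add: copy_field_def)
  ultimately have "field (copy_field K)" by simp
  then show ?thesis by (simp add: field2_def field2_axioms_def char2)
qed

lemma square_finsum:
  "finite A \<Longrightarrow> f \<in> A \<rightarrow> carrier F \<Longrightarrow>
    (\<Oplus>i\<in>A. f i) [^] (2::nat) = (\<Oplus>i\<in>A. f i [^] (2::nat))"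
proof (induction A rule: finite_induct)
  case (insert i A)
  then have m: "f i \<in> carrier F" "f \<in> A \<rightarrow> carrier F" by auto
  then have sq: "(\<lambda>i. f i [^] (2::nat)) \<in> A \<rightarrow> carrier F" by auto
  have "(\<Oplus>i\<in>insert i A. f i) [^] (2::nat) = f i [^] (2::nat) \<oplus> (\<Oplus>i\<in>A. f i) [^] (2::nat)"
    using insert.hyps m by (simp add: square_add finsum_closed)
  also have "\<dots> = (\<Oplus>i\<in>insert i A. f i [^] (2::nat))"
    using insert m sq by simp
  finally show ?case .
qed (simp add: square_eq)

lemma copy_field_finsum:
  assumes K: "subfield K F"
  shows "finite A \<Longrightarrow> f \<in> A \<rightarrow> K \<Longrightarrow> finsum (copy_field K) (\<lambda>i. [f i]) A = [\<Oplus>i\<in>A. f i]"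
proof (induction A rule: finite_induct)
  case empty
  interpret E: field2 "copy_field K" by (rule copy_field_field2[OF K])
  show ?case by simp
next
  case (insert i A)
  interpret E: field2 "copy_field K" by (rule copy_field_field2[OF K])
  have Kc: "K \<subseteq> carrier F" using subfieldE(3)[OF K] .
  have f: "f i \<in> K" "f \<in> A \<rightarrow> K" "f \<in> A \<rightarrow> carrier F" "f i \<in> carrier F" using insert.prems Kc by auto
  have "(\<lambda>i. [f i]) \<in> A \<rightarrow> carrier (copy_field K)" "[f i] \<in> carrier (copy_field K)" using f by auto
  then have "finsum (copy_field K) (\<lambda>i. [f i]) (insert i A) = [f i] \<oplus>\<^bsub>copy_field K\<^esub> finsum (copy_field K) (\<lambda>i. [f i]) A"
    by (rule E.finsum_insert[OF insert.hyps])
  then show ?case using insert.IH[OF f(2)] insert.hyps f by simp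
qed

text \<open>
  Over the copy of \<open>K\<close> the diagonal form with entries \<open>a\<^sub>i\<^sup>2\<close> takes the value \<open>(\<Sum> k\<^sub>i a\<^sub>i)\<^sup>2\<close> at \<open>k\<close>.
\<close>

lemma diag_form_copy_field:
  assumes K: "subfield K F" and sq: "squares F \<subseteq> K" and us: "set us \<subseteq> carrier F"
  defines "C \<equiv> diag_form (copy_field K) (length us) (\<lambda>i. [us ! i [^] (2::nat)])"
  shows "vals C = (\<lambda>s. [s [^] (2::nat)]) ` Span K us"
    and "independent K us \<Longrightarrow> anisotropic (copy_field K) C"
proof -
  let ?E = "copy_field K" and ?n = "length us"
  interpret E: field2 ?E by (rule copy_field_field2[OF K])
  note Kr = subfield_props[OF K]
  have Kc: "K \<subseteq> carrier F" using subfieldE(3)[OF K] .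
  define ks where "ks x = map (\<lambda>i. hd (x i)) [0..<?n]" for x :: "nat \<Rightarrow> 'a list"
  have u: "us ! i \<in> carrier F" "us ! i [^] (2::nat) \<in> K" if "i < ?n" for i
    using subsetD[OF us nth_mem[OF that]] sq by auto
  have q: "qf C x = [(combine (ks x) us) [^] (2::nat)]" "set (ks x) \<subseteq> K" "length (ks x) = ?n"
    if x: "x \<in> tuples ?E ?n" for x
  proof -
    have k: "hd (x i) \<in> K" "hd (x i) \<in> carrier F" if "i < ?n" for i
      using PiE_mem[OF x, of i] that Kc by auto
    show s: "set (ks x) \<subseteq> K" "length (ks x) = ?n" using k by (auto simp: ks_def)
    have t: "us ! i [^] (2::nat) \<otimes> (hd (x i) \<otimes> hd (x i)) \<in> K" if "i < ?n" for i
      using u[OF that] k[OF that] Kr(6) by simp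
    have "qf C x = (\<Oplus>\<^bsub>?E\<^esub>i\<in>{..<?n}. [us ! i [^] (2::nat)] \<otimes>\<^bsub>?E\<^esub> x i [^]\<^bsub>?E\<^esub> (2::nat))"
      unfolding C_def by (rule diag_form_simps[OF E.is_ring])
    also have "\<dots> = (\<Oplus>\<^bsub>?E\<^esub>i\<in>{..<?n}. [us ! i [^] (2::nat) \<otimes> (hd (x i) \<otimes> hd (x i))])"
      using t PiE_mem[OF x] by (intro E.finsum_cong') (auto simp: E.square_eq)
    also have "\<dots> = [\<Oplus>i\<in>{..<?n}. us ! i [^] (2::nat) \<otimes> (hd (x i) \<otimes> hd (x i))]"
      using t by (intro copy_field_finsum[OF K]) auto
    also have "(\<Oplus>i\<in>{..<?n}. us ! i [^] (2::nat) \<otimes> (hd (x i) \<otimes> hd (x i)))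
        = (\<Oplus>i\<in>{..<?n}. (us ! i \<otimes> ks x ! i) [^] (2::nat))"
      using u k by (intro finsum_cong') (auto simp: ks_def square_eq m_ac)
    also have "\<dots> = (\<Oplus>i\<in>{..<?n}. us ! i \<otimes> ks x ! i) [^] (2::nat)"
      using u k by (intro square_finsum[symmetric]) (auto simp: ks_def)
    also have "(\<Oplus>i\<in>{..<?n}. us ! i \<otimes> ks x ! i) = combine (ks x) us"
      using s Kc us by (intro combine_eq_finsum[symmetric]) auto
    finally show "qf C x = [(combine (ks x) us) [^] (2::nat)]" .
  qed
  have Cc: "carrier C = tuples ?E ?n"
    unfolding C_def by (rule diag_form_simps[OF E.is_ring])
  show "vals C = (\<lambda>s. [s [^] (2::nat)]) ` Span K us"
  proof (intro equalityI subsetI)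
    fix y assume "y \<in> vals C"
    then obtain x where x: "x \<in> tuples ?E ?n" "y = qf C x" unfolding Cc by blast
    have "combine (ks x) us \<in> Span K us"
      unfolding Span_eq_combine_set[OF K us] using q(2)[OF x(1)] by blast
    then show "y \<in> (\<lambda>s. [s [^] (2::nat)]) ` Span K us" unfolding x(2) q(1)[OF x(1)] by blast
  next
    fix y assume "y \<in> (\<lambda>s. [s [^] (2::nat)]) ` Span K us"
    then obtain t where t: "y = [t [^] (2::nat)]" "t \<in> Span K us" by (rule imageE)
    then obtain Ks where Ks: "set Ks \<subseteq> K" "length Ks = ?n" "t = combine Ks us"
      using Span_mem_iff_length_version[OF K us] by blast
    let ?x = "\<lambda>i\<in>{..<?n}. [Ks ! i]"
    have "Ks ! i \<in> K" if "i < ?n" for i using Ks(1) nth_mem[of i Ks] Ks(2) that by auto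
    then have x: "?x \<in> tuples ?E ?n" by (simp add: restrict_PiE_iff)
    have "ks ?x = Ks" using Ks(2) by (auto simp: ks_def intro!: nth_equalityI)
    then have "y = qf C ?x" using q(1)[OF x] t(1) Ks(3) by simp
    then show "y \<in> vals C" unfolding Cc using x by blast
  qed
  assume ind: "independent K us"
  show "anisotropic ?E C"
    unfolding anisotropic_def
  proof (intro ballI impI)
    fix x assume "x \<in> carrier C" "qf C x = \<zero>\<^bsub>?E\<^esub>"
    then have x: "x \<in> tuples ?E ?n" "qf C x = [\<zero>]" by (simp_all add: Cc)
    have "combine (ks x) us \<in> carrier F"
      using q(2)[OF x(1)] Kc us by (intro combine_in_carrier) auto
    moreover have "(combine (ks x) us) [^] (2::nat) = \<zero>"
      using trans[OF q(1)[OF x(1), symmetric] x(2)] by simp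
    ultimately have "combine (ks x) us = \<zero>" by (rule square_zero_iff[THEN iffD1])
    then have "set (ks x) \<subseteq> {\<zero>}"
      using independent_imp_trivial_combine[OF K ind q(2)[OF x(1)]] q(3)[OF x(1)] by simp
    then have z: "hd (x i) = \<zero>" if "i < ?n" for i using that by (force simp: ks_def)
    have "x i = [\<zero>]" if "i < ?n" for i using z[OF that] PiE_mem[OF x(1), of i] that by auto
    then have "x = (\<lambda>i\<in>{..<?n}. \<zero>\<^bsub>?E\<^esub>)"
      using x(1) by (auto simp: fun_eq_iff PiE_def extensional_def)
    then show "x = \<zero>\<^bsub>C\<^esub>" unfolding C_def diag_form_simps[OF E.is_ring] .
  qed
qed

lemma Span_eq_if_Span_squares_eq:
  assumes K: "subfield K F" and sq: "squares F \<subseteq> K"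
    and us: "set us \<subseteq> carrier F" and vs: "set vs \<subseteq> carrier F"
    and eq: "Span (squares F) us = Span (squares F) vs"
  shows "Span K us = Span K vs"
proof -
  note S = subfield_squares
  have "set us \<subseteq> Span K vs" "set vs \<subseteq> Span K us"
    using Span_base_incl[OF S us] Span_base_incl[OF S vs] eq
      Span_mono_field[OF S K sq us] Span_mono_field[OF S K sq vs] by auto
  then show ?thesis by (intro equalityI mono_Span_subset[OF K] us vs)
qed

lemma frobenius_hom:
  assumes K: "subfield K F" and sq: "squares F \<subseteq> K"
  shows "(\<lambda>x. [x [^] (2::nat)]) \<in> ring_hom F (copy_field K)"
  using subsetD[OF sq square_in_squares] by (intro ring_hom_memI) (auto simp: square_mult square_add)

text \<open>
  Over the copy of \<open>K\<close> the values of \<open>\<phi>\<close> are the squares of the elements of the \<open>K\<close>-span of the values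
  over \<open>F\<close>, so a \<open>K\<close>-basis of this span gives the entries of an anisotropic part.
\<close>

lemma defect_over_copy_field:
  fixes \<phi> :: "('a, 'v) qform"
  assumes ts: "ts_form F \<phi>" and K: "subfield K F" and sq: "squares F \<subseteq> K"
    and vs: "set vs \<subseteq> carrier F" "Span (squares F) vs = vals \<phi>"
    and d: "dimension d K (Span K vs)"
  shows "d + defect (copy_field K) (base_change F (copy_field K) (\<lambda>x. [x [^] (2::nat)]) \<phi>)
    = vectorspace.dim F \<phi>"
proof -
  let ?E = "copy_field K" and ?h = "\<lambda>x. [x [^] (2::nat)]"
  interpret \<phi>: ts_form F \<phi> by fact
  interpret E: field2 ?E by (rule copy_field_field2[OF K])
  obtain b where coords: "b \<in> {..<\<phi>.dim} \<rightarrow> carrier \<phi>"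
      "lin_iso F (func_space {..<\<phi>.dim}) \<phi> (\<phi>.comb \<phi>.dim b)"
      "isometric F (diag_form F \<phi>.dim (\<lambda>i. qf \<phi> (b i))) \<phi>"
    using \<phi>.isometric_diag_form by blast
  interpret scalar_extension F \<phi> ?E ?h b
    by unfold_locales (use frobenius_hom[OF K sq] coords in auto)
  let ?as = "map (\<lambda>i. qf \<phi> (b i)) [0..<\<phi>.dim]"
  have as: "set ?as \<subseteq> carrier F" using coords(1) by (auto intro!: \<phi>.qf_closed)
  have len: "length ?as = \<phi>.dim" by simp
  have nth: "?as ! i = qf \<phi> (b i)" if "i < \<phi>.dim" for i using that by simp
  have qc: "qf \<phi> (b i) \<in> carrier F" if "i < \<phi>.dim" for i
    using coords(1) that by (auto intro!: \<phi>.qf_closed)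
  have "Span (squares F) ?as = vals \<phi>"
    using isometric_values[OF coords(3)] diag_form_list(1)[OF as]
      vals_diag_form_cong[of \<phi>.dim "\<lambda>i. qf \<phi> (b i)" "(!) ?as"] qc by simp
  then have span: "Span K ?as = Span K vs"
    using vs by (intro Span_eq_if_Span_squares_eq[OF K sq as]) auto
  obtain us where us: "independent K us" "length us = d" "Span K us = Span K vs" "set us \<subseteq> carrier F"
    using exists_base[OF K d] by blast
  let ?C = "diag_form ?E (length us) (\<lambda>i. [us ! i [^] (2::nat)])"
  have sqK: "[x [^] (2::nat)] \<in> carrier ?E" if "x \<in> carrier F" for x
    using subsetD[OF sq square_in_squares[OF that]] by simp
  have "d + defect ?E Q = vectorspace.dim ?E Q"
  proof (rule E.defect_eq[OF base_change_ts_form(1)])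
    show "(\<lambda>i. [us ! i [^] (2::nat)]) \<in> {..<d} \<rightarrow> carrier ?E"
      using us(2,4) by (intro Pi_I sqK) auto
    show "anisotropic ?E (diag_form ?E d (\<lambda>i. [us ! i [^] (2::nat)]))"
      using diag_form_copy_field(2)[OF K sq us(4,1)] us(2) by simp
    have "vals Q = vals D" by (rule base_change_ts_form(3))
    also have "\<dots> = qf (diag_form ?E \<phi>.dim (\<lambda>i. [?as ! i [^] (2::nat)])) `
        carrier (diag_form ?E \<phi>.dim (\<lambda>i. [?as ! i [^] (2::nat)]))"
      using qc sqK by (intro E.vals_diag_form_cong) (simp_all only: nth)
    also have "\<dots> = (\<lambda>s. [s [^] (2::nat)]) ` Span K us"
      using diag_form_copy_field(1)[OF K sq as] span us(3) by simp
    also have "\<dots> = qf (diag_form ?E d (\<lambda>i. [us ! i [^] (2::nat)])) `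
        carrier (diag_form ?E d (\<lambda>i. [us ! i [^] (2::nat)]))"
      using diag_form_copy_field(1)[OF K sq us(4)] us(2) by simp
    finally show "vals Q = qf (diag_form ?E d (\<lambda>i. [us ! i [^] (2::nat)])) `
        carrier (diag_form ?E d (\<lambda>i. [us ! i [^] (2::nat)]))" .
  qed
  then show ?thesis using base_change_ts_form(2) by simp
qed

lemma vishik_equivalent_dimension:
  assumes \<phi>: "ts_form F \<phi>" and \<psi>: "ts_form F \<psi>" and eq: "vishik_equivalent F \<phi> \<psi>"
    and K: "subfield K F" and sq: "squares F \<subseteq> K"
    and us: "set us \<subseteq> carrier F" "Span (squares F) us = vals \<phi>"
    and ws: "set ws \<subseteq> carrier F" "Span (squares F) ws = vals \<psi>"
    and d: "dimension d K (Span K us)"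
  shows "dimension d K (Span K ws)"
proof -
  let ?E = "copy_field K" and ?h = "\<lambda>x. [x [^] (2::nat)]"
  obtain e where e: "dimension e K (Span K ws)" using dimension_Span_le[OF K ws(1)] by blast
  have "field ?E" using copy_field_field2[OF K] by (simp add: field2_def)
  then have "defect ?E (base_change F ?E ?h \<phi>) = defect ?E (base_change F ?E ?h \<psi>)"
      "vectorspace.dim F \<phi> = vectorspace.dim F \<psi>"
    using eq frobenius_hom[OF K sq] unfolding vishik_equivalent_def by blast+
  then have "d = e"
    using defect_over_copy_field[OF \<phi> K sq us d] defect_over_copy_field[OF \<psi> K sq ws e] by simp
  with e show ?thesis by simp
qed

lemma ts_form_scale_form:
  assumes \<psi>: "ts_form F \<psi>" and c: "c \<in> carrier F"
  shows "ts_form F (scale_form F c \<psi>)" "vectorspace.dim F (scale_form F c \<psi>) = vectorspace.dim F \<psi>"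
proof -
  interpret \<psi>: ts_form F \<psi> by fact
  have s [simp]: "carrier (scale_form F c \<psi>) = carrier \<psi>" "\<zero>\<^bsub>scale_form F c \<psi>\<^esub> = \<zero>\<^bsub>\<psi>\<^esub>"
    "v \<oplus>\<^bsub>scale_form F c \<psi>\<^esub> w = v \<oplus>\<^bsub>\<psi>\<^esub> w" "a \<odot>\<^bsub>scale_form F c \<psi>\<^esub> v = a \<odot>\<^bsub>\<psi>\<^esub> v"
    "qf (scale_form F c \<psi>) v = c \<otimes> qf \<psi> v" for a v w
    by (simp_all add: scale_form_def)
  have "vectorspace F (scale_form F c \<psi>)" "lin_iso F (scale_form F c \<psi>) \<psi> id"
    using vectorspace_transport[OF \<psi>.vectorspace_axioms, of id "scale_form F c \<psi>"] by auto
  note V = this(1) and g = lin_iso_dim[OF \<psi>.vectorspace_axioms this(1)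
      lin_iso_inv[OF vectorspace.axioms(1)[OF this(1)] this(2)] \<psi>.finite_dimensional]
  interpret V: vectorspace F "scale_form F c \<psi>" by (rule V)
  show "vectorspace.dim F (scale_form F c \<psi>) = \<psi>.dim" by (rule g(2))
  show "ts_form F (scale_form F c \<psi>)"
    by unfold_locales
      (use g(1) c char2 in \<open>simp_all add: \<psi>.qf_closed \<psi>.qf_smult \<psi>.qf_add r_distr m_lcomm\<close>)
qed

section \<open>Minimal forms\<close>

text \<open>
  Write \<open>\<chi> \<simeq> u \<langle>1, a\<^sub>1, \<dots>, a\<^sub>r\<rangle>\<close>. Quotients of values are quotients of elements of the span of \<open>1\<close> and the
  \<open>a\<^sub>i\<close>, so the norm field is \<open>F\<^sup>2(a\<^sub>1, \<dots>, a\<^sub>r)\<close>. Minimality says that its degree is \<open>2\<^sup>r\<close>, which is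
  2-independence of the \<open>a\<^sub>i\<close>.
\<close>

lemma minimal_form_values:
  assumes ts: "ts_form F \<chi>" and min: "minimal_form F \<chi>"
  shows "\<exists>as u. distinct as \<and> two_independent (set as) \<and> u \<in> carrier F \<and> u \<noteq> \<zero> \<and>
    Span (squares F) (map ((\<otimes>) u) (as @ [\<one>])) = vals \<chi>"
proof -
  let ?S = "squares F"
  note S = subfield_squares
  have an: "anisotropic F \<chi>" and dim: "1 \<le> vectorspace.dim F \<chi>"
    and deg: "norm_degree F \<chi> = 2 ^ (vectorspace.dim F \<chi> - 1)"
    using min by (auto simp: minimal_form_def)
  obtain us where us: "independent ?S us" "Span ?S us = vals \<chi>"
    using value_basis[OF ts] by blast
  have usc: "set us \<subseteq> carrier F" by (rule independent_in_carrier[OF us(1)])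
  obtain b where b: "b \<in> {..<vectorspace.dim F \<chi>} \<rightarrow> carrier F"
      "anisotropic F (diag_form F (vectorspace.dim F \<chi>) b)"
      "vals \<chi> = vals (diag_form F (vectorspace.dim F \<chi>) b)"
    using anisotropic_diagonalization[OF ts an] by blast
  have "(!) us \<in> {..<length us} \<rightarrow> carrier F" using usc by auto
  then have len: "length us = vectorspace.dim F \<chi>"
    using same_values_same_length[OF _ diag_form_list(2)[OF usc us(1)] b(1,2)]
      diag_form_list(1)[OF usc] us(2) b(3) by simp
  then obtain u rest where us_eq: "us = u # rest" using dim by (cases us) auto
  have u: "u \<in> carrier F" "u \<notin> Span ?S rest" "set rest \<subseteq> carrier F"
    using us(1) usc independent_backwards(1)[of ?S u rest] unfolding us_eq by auto
  then have u0: "u \<noteq> \<zero>" using Span_subgroup_props(2)[OF S u(3)] by metis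
  have iu: "inv u \<in> carrier F" "u \<otimes> inv u = \<one>" using u u0 field_Units by auto
  define as where "as = map (\<lambda>x. x \<otimes> inv u) rest"
  have as: "set as \<subseteq> carrier F" using u(3) iu by (auto simp: as_def)
  have "u \<otimes> (x \<otimes> inv u) = x" if "x \<in> carrier F" for x
  proof -
    have "u \<otimes> (x \<otimes> inv u) = x \<otimes> (u \<otimes> inv u)" using that iu(1) u(1) by (simp add: m_ac)
    then show ?thesis using that iu by simp
  qed
  then have "map ((\<otimes>) u) as = rest" using u(3) by (auto simp: as_def o_def intro!: map_idI)
  then have "set (map ((\<otimes>) u) (as @ [\<one>])) = set us" using u(1) by (simp add: us_eq)
  then have span: "Span ?S (map ((\<otimes>) u) (as @ [\<one>])) = vals \<chi>"
    using Span_same_set[OF S, of "map ((\<otimes>) u) (as @ [\<one>])" us] usc us(2) by metis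
  have as1: "set (as @ [\<one>]) \<subseteq> carrier F" using as by simp
  have G: "subfield (adj (set as)) F" by (rule adj_subfield[OF as])
  note Gr = subfield_props[OF G]
  have G1: "Span ?S (as @ [\<one>]) \<subseteq> adj (set as)"
    by (rule Span_subset_subfield[OF S G squares_subset_adj]) (use adj_incl Gr(3) in auto)
  have vals: "vals \<chi> = (\<otimes>) u ` Span ?S (as @ [\<one>])"
    using span Span_map_mult[OF S u(1) as1] by simp
  have "norm_field F \<chi> = adj (set as)"
  proof
    let ?R = "{a \<otimes> inv b | a b. a \<in> nonzero_values F \<chi> \<and> b \<in> nonzero_values F \<chi>}"
    have "x \<in> adj (set as)" if x: "x \<in> ?R" for x
    proof -
      obtain y z where yz: "y \<in> adj (set as)" "z \<in> adj (set as)" "u \<otimes> z \<noteq> \<zero>" "x = (u \<otimes> y) \<otimes> inv (u \<otimes> z)"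
        using x G1 unfolding nonzero_values_def vals by blast
      have c: "y \<in> carrier F" "z \<in> carrier F" using yz Gr(1) by auto
      have z0: "z \<noteq> \<zero>" using yz(3) u by auto
      then have iz: "inv z \<in> carrier F" "inv z \<in> adj (set as)"
        using c yz subfield_m_inv(1)[OF G] field_Units by auto
      have "z \<otimes> inv z = \<one>" using c z0 field_Units by auto
      then have "(u \<otimes> z) \<otimes> (inv u \<otimes> inv z) = \<one>"
        using iu iz(1) c(2) u(1) by (metis m_assoc m_closed m_comm r_one)
      then have "inv (u \<otimes> z) = inv u \<otimes> inv z"
        using comm_inv_char[of "u \<otimes> z" "inv u \<otimes> inv z"] iu(1) iz(1) c(2) u(1) by simp
      then have "x = y \<otimes> inv z \<otimes> (u \<otimes> inv u)" using yz(4) c iz(1) iu(1) u(1) by (simp add: m_ac)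
      then have "x = y \<otimes> inv z" using c iz iu by simp
      then show ?thesis using yz(1) iz(2) Gr(6) by simp
    qed
    then show "norm_field F \<chi> \<subseteq> adj (set as)"
      unfolding norm_field_def
      using squares_subset_adj[of "set as"] Gr(1) by (intro generate_field_min_subfield1 G) blast+
    have sub: "?S \<union> ?R \<subseteq> carrier F" using \<open>\<And>x. x \<in> ?R \<Longrightarrow> x \<in> adj (set as)\<close> Gr(1) squares_in_carrier by blast
    have NF: "subfield (norm_field F \<chi>) F"
      unfolding norm_field_def by (rule generate_field_is_subfield[OF sub])
    have SN: "?S \<subseteq> norm_field F \<chi>" by (auto simp: norm_field_def intro: generate_field.incl)
    have "a \<in> norm_field F \<chi>" if a: "a \<in> set as" for a
    proof (cases "a = \<zero>")
      case True
      then show ?thesis using subfield_props(2)[OF NF] by simp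
    next
      case False
      have ac: "a \<in> carrier F" using a as by auto
      have base: "set (as @ [\<one>]) \<subseteq> Span ?S (as @ [\<one>])" by (rule Span_base_incl[OF S as1])
      have "u \<otimes> a \<noteq> \<zero>" using False ac u u0 integral by blast
      moreover have "u \<otimes> a \<in> (\<otimes>) u ` Span ?S (as @ [\<one>])" "u \<otimes> \<one> \<in> (\<otimes>) u ` Span ?S (as @ [\<one>])"
        by (rule imageI, use base a in auto)+
      ultimately have "u \<otimes> a \<in> nonzero_values F \<chi>" "u \<otimes> \<one> \<in> nonzero_values F \<chi>"
        unfolding nonzero_values_def vals using u u0 by simp_all
      then have "(u \<otimes> a) \<otimes> inv (u \<otimes> \<one>) \<in> ?R" by blast
      moreover have "(u \<otimes> a) \<otimes> inv (u \<otimes> \<one>) = a"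
      proof -
        have "(u \<otimes> a) \<otimes> inv (u \<otimes> \<one>) = a \<otimes> (u \<otimes> inv u)" using u(1) ac iu(1) by (simp add: m_ac)
        then show ?thesis using ac iu by simp
      qed
      ultimately show ?thesis by (auto simp: norm_field_def intro: generate_field.incl)
    qed
    then show "adj (set as) \<subseteq> norm_field F \<chi>" by (intro adj_least NF SN) blast
  qed
  moreover obtain d where d: "dimension d ?S (adj (set as))" using adj_dimension[OF _ as] by blast
  moreover have "length as = vectorspace.dim F \<chi> - 1" using len by (simp add: as_def us_eq)
  moreover have "ring.dim F ?S (adj (set as)) = d" using dimI[OF S d] by (simp add: over_def)
  ultimately have "dimension (2 ^ length as) ?S (adj (set as))"
    using deg by (simp add: norm_degree_def)
  then have "distinct as" "two_independent (set as)"
    using two_independent_if_dimension[OF as] by blast+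
  with u u0 span show ?thesis by blast
qed

lemma similar_if_vishik_equivalent:
  assumes ts: "ts_form F \<phi>" "ts_form F \<psi>"
    and an_part: "is_anisotropic_part F \<phi> \<phi>an" and min: "minimal_form F \<phi>an"
    and eq: "vishik_equivalent F \<phi> \<psi>"
  shows "similar_forms F \<phi> \<psi>"
proof -
  note S = subfield_squares
  obtain k where an: "ts_form F \<phi>an" "isometric F \<phi> (orth_sum F \<phi>an (zero_form F k))"
    using an_part by (auto simp: is_anisotropic_part_def anisotropic_decomp_def)
  have vals: "vals \<phi> = vals \<phi>an"
    using isometric_values[OF an(2)] values_orth_sum_zero_form[OF an(1)] by simp
  obtain as u where au: "distinct as" "two_independent (set as)" "u \<in> carrier F" "u \<noteq> \<zero>"
      "Span (squares F) (map ((\<otimes>) u) (as @ [\<one>])) = vals \<phi>"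
    using minimal_form_values[OF an(1) min] vals by metis
  obtain ws where w: "independent (squares F) ws" "Span (squares F) ws = vals \<psi>"
    using value_basis[OF ts(2)] by blast
  have usc: "set (map ((\<otimes>) u) (as @ [\<one>])) \<subseteq> carrier F"
    using au(2,3) by (auto simp: two_independent_def)
  interpret same_ranks F as ws u
  proof unfold_locales
    fix K d assume "subfield K F" "squares F \<subseteq> K"
      "dimension d K (Span K (map ((\<otimes>) u) (as @ [\<one>])))"
    then show "dimension d K (Span K ws)"
      by (rule vishik_equivalent_dimension[OF ts eq _ _ usc au(5)
            independent_in_carrier[OF w(1)] w(2)])
  qed (use au w in auto)
  obtain c where c: "c \<in> carrier F" "c \<noteq> \<zero>" "W = (\<otimes>) c ` U" using proportional by blast
  have ic: "inv c \<in> carrier F" "inv c \<otimes> c = \<one>" using c(1,2) field_Units by auto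
  then have ic0: "inv c \<noteq> \<zero>" using c(1) by auto
  let ?\<psi> = "scale_form F (inv c) \<psi>"
  have "inv c \<otimes> (c \<otimes> x) = x" if "x \<in> U" for x
    using U_props(1) that ic c by (auto simp: m_assoc[symmetric])
  then have "(\<otimes>) (inv c) ` W = U" unfolding c(3) by (force simp: image_image)
  moreover have "vals ?\<psi> = (\<otimes>) (inv c) ` (vals \<psi>)"
    by (simp add: scale_form_def image_image)
  ultimately have "vals \<phi> = vals ?\<psi>" using w(2) au(5) by simp
  moreover have "vectorspace.dim F \<phi> = vectorspace.dim F ?\<psi>"
    using ts_form_scale_form(2)[OF ts(2) ic(1)] eq by (simp add: vishik_equivalent_def)
  ultimately have "isometric F \<phi> ?\<psi>"
    by (intro isometric_if_same_values ts(1) ts_form_scale_form(1)[OF ts(2) ic(1)])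
  with ic ic0 show ?thesis by (auto simp: similar_forms_def)
qed

end

theorem theorem1p1:
  fixes F :: "('a, 'm) ring_scheme"
    and \<phi> :: "('a, 'v) qform" and \<psi> :: "('a, 'w) qform" and \<phi>an :: "('a, 'u) qform"
  assumes "field F" and "\<one>\<^bsub>F\<^esub> \<oplus>\<^bsub>F\<^esub> \<one>\<^bsub>F\<^esub> = \<zero>\<^bsub>F\<^esub>"
    and "ts_form F \<phi>" and "ts_form F \<psi>"
    and "is_anisotropic_part F \<phi> \<phi>an" and "minimal_form F \<phi>an"
    and "vishik_equivalent F \<phi> \<psi>"
  shows "similar_forms F \<phi> \<psi>"
proof -
  interpret field2 F using assms(1,2) by (simp add: field2_def field2_axioms_def)
  show ?thesis using assms(3-7) by (rule similar_if_vishik_equivalent)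
qed

end
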